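(* Let $H\in(0,1)$ and $T>0$. Let $\cdots<\omega_{-1}<\omega_0=0<\omega_1<\cdots$ be the real zeros of $J_{1-H}$ and let $Z_n$, $n\in\mathbb{Z}$, be independent, complex-valued Gaussian random variables with mean zero and variance $\mathbb{E}|Z_n|^2=\sigma^2(\omega_n)$, where $$\sigma^{-2}(\omega_n)=\begin{cases}(2-2H)\Gamma^2(1-H)\Big(\dfrac{\omega_n}{2}\Big)^{2H}J_{-H}^2(\omega_n)V_T,&\omega_n\ne0,\\[2mm] V_T,&\omega_n=0.\end{cases}$$ Then, with probability one, the series $$\sum_{n\in\mathbb{Z}}\frac{e^{2i\omega_nt/T}-1}{2i\omega_n/T}\,Z_n$$ converges uniformly in $t\in[0,T]$ and defines a complex-valued fractional Brownian motion (on $[0,T]$) with Hurst index $H$.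
   Context: $\Gamma$ is Euler's gamma function and $J_\nu$ the Bessel function of the first kind of order $\nu$. $V_T=d_H^2\,T^{2-2H}$ with $d_H^2=\dfrac{\Gamma(3/2-H)}{2H\,\Gamma(H+1/2)\,\Gamma(3-2H)}$. The function $(\omega/2)^{2H}J_{-H}^2(\omega)$ is understood as the even function $\big((\omega/2)^{H}J_{-H}(\omega)\big)^2$, where $(\omega/2)^HJ_{-H}(\omega)=\sum_{k\ge0}\frac{(-1)^k(\omega/2)^{2k}}{k!\,\Gamma(k-H+1)}$. The real zeros of $J_{1-H}$ are $0$, its positive zeros $\omega_1<\omega_2<\cdots$, and $\omega_{-n}=-\omega_n$. A complex-valued fractional Brownian motion with Hurst index $H$ is a continuous, centered, complex-valued Gaussian process $X$ with $\mathbb{E}X_s\overline{X_t}=\tfrac12(s^{2H}+t^{2H}-|s-t|^{2H})$. The $n=0$ term of the series is understood as $tZ_0$ (limit $\omega\to0$ of the coefficient), and sums over $\mathbb{Z}$ are limits of the partial sums over $|n|\le N$ as $N\to\infty$. *)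

theory Defs
  imports "HOL-Probability.Probability"
begin

section \<open>Bessel functions of the first kind\<close>

text \<open>
  \<open>bessel_series \<nu>\<close> is the entire function \<open>z \<mapsto> (z/2)\<^sup>-\<^sup>\<nu> J\<^sub>\<nu>(z)\<close>. The total function
  \<^const>\<open>rGamma\<close> is \<open>1/\<Gamma>\<close>, with value 0 at the poles of \<open>\<Gamma>\<close>.
\<close>

definition bessel_series :: "'a::Gamma \<Rightarrow> 'a \<Rightarrow> 'a" where
  "bessel_series \<nu> z =
     (\<Sum>k. (- 1) ^ k * (z / 2) ^ (2 * k) / fact k * rGamma (of_nat k + \<nu> + 1))"

text \<open>
  \<open>J\<^sub>\<nu>\<close> with the principal branch of \<open>(z/2)\<^sup>\<nu>\<close>; whether it vanishes at a point of the negative real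
  axis does not depend on the branch. The case \<open>\<nu> = 0\<close> is separated because
  \<^term>\<open>0 powr 0 = (0::complex)\<close>.
\<close>

definition bessel_J :: "complex \<Rightarrow> complex \<Rightarrow> complex" where
  "bessel_J \<nu> z = (if \<nu> = 0 then 1 else (z / 2) powr \<nu>) * bessel_series \<nu> z"

lemma bessel_series_eq_powr_bessel_J:
  assumes "z \<noteq> 0"
  shows "bessel_series (- \<nu>) z = (z / 2) powr \<nu> * bessel_J (- \<nu>) z"
  using assms by (simp add: bessel_J_def powr_minus)

section \<open>Gaussian variables and processes\<close>

text \<open>Almost surely constant variables count as Gaussian (variance 0).\<close>

definition gaussian_real :: "'a measure \<Rightarrow> ('a \<Rightarrow> real) \<Rightarrow> bool" where
  "gaussian_real M X \<longleftrightarrow> X \<in> borel_measurable M \<and>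
     ((\<exists>\<mu> \<sigma>. \<sigma> > 0 \<and> distributed M lborel X (normal_density \<mu> \<sigma>)) \<or>
      (\<exists>\<mu>. AE w in M. X w = \<mu>))"

text \<open>
  A complex variable \<open>Z\<close> is Gaussian if \<open>(Re Z, Im Z)\<close> is a Gaussian vector, i.e. if all its
  real-linear combinations \<open>a Re Z + b Im Z = Re ((a - \<i> b) Z)\<close> are Gaussian. Circular symmetry is
  not required. Likewise a complex process is Gaussian if its real and imaginary parts are jointly
  Gaussian.
\<close>

definition gaussian_complex :: "'a measure \<Rightarrow> ('a \<Rightarrow> complex) \<Rightarrow> bool" where
  "gaussian_complex M Z \<longleftrightarrow> Z \<in> borel_measurable M \<and>
     (\<forall>c. gaussian_real M (\<lambda>w. Re (c * Z w)))"

definition gaussian_complex_process ::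
    "'a measure \<Rightarrow> 't set \<Rightarrow> ('t \<Rightarrow> 'a \<Rightarrow> complex) \<Rightarrow> bool" where
  "gaussian_complex_process M I X \<longleftrightarrow> (\<forall>t\<in>I. X t \<in> borel_measurable M) \<and>
     (\<forall>F c. finite F \<and> F \<subseteq> I \<longrightarrow> gaussian_real M (\<lambda>w. Re (\<Sum>t\<in>F. c t * X t w)))"

definition complex_fBm :: "'a measure \<Rightarrow> real \<Rightarrow> real set \<Rightarrow> (real \<Rightarrow> 'a \<Rightarrow> complex) \<Rightarrow> bool" where
  "complex_fBm M H I X \<longleftrightarrow>
     gaussian_complex_process M I X \<and>
     (\<forall>w\<in>space M. continuous_on I (\<lambda>t. X t w)) \<and>
     (\<forall>t\<in>I. integral\<^sup>L M (X t) = 0) \<and>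
     (\<forall>s\<in>I. \<forall>t\<in>I. integral\<^sup>L M (\<lambda>w. X s w * cnj (X t w)) =
        complex_of_real ((s powr (2 * H) + t powr (2 * H) - \<bar>s - t\<bar> powr (2 * H)) / 2))"

section \<open>The series expansion\<close>

definition dH_sq :: "real \<Rightarrow> real" where
  "dH_sq H = Gamma (3 / 2 - H) / (2 * H * Gamma (H + 1 / 2) * Gamma (3 - 2 * H))"

definition V_fBm :: "real \<Rightarrow> real \<Rightarrow> real" where
  "V_fBm H T = dH_sq H * T powr (2 - 2 * H)"

text \<open>
  The function \<open>\<sigma>\<^sup>-\<^sup>2\<close>: \<open>(bessel_series (- H) x)\<^sup>2\<close> is the even function \<open>(x/2)\<^sup>2\<^sup>H J\<^sub>-\<^sub>H(x)\<^sup>2\<close>.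
\<close>

definition inv_sigma_sq :: "real \<Rightarrow> real \<Rightarrow> real \<Rightarrow> real" where
  "inv_sigma_sq H T x =
     (if x \<noteq> 0 then (2 - 2 * H) * (Gamma (1 - H))\<^sup>2 * (bessel_series (- H) x)\<^sup>2 * V_fBm H T
      else V_fBm H T)"

text \<open>The value at \<open>x = 0\<close> is the limit of the quotient as \<open>x \<rightarrow> 0\<close>.\<close>

definition fBm_coeff :: "real \<Rightarrow> real \<Rightarrow> real \<Rightarrow> complex" where
  "fBm_coeff T x t =
     (if x = 0 then of_real t
      else (exp (2 * \<i> * of_real x * of_real t / of_real T) - 1) /
           (2 * \<i> * of_real x / of_real T))"

end

theory Submission
  imports Defs "HOL-Complex_Analysis.Complex_Analysis" "HOL-Real_Asymp.Real_Asymp"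
begin

text \<open>
  Let \<open>A\<close> and \<open>C = - A'\<close> be the entire functions with \<open>A(z\<^sup>2/4) = (z/2)\<^sup>H J\<^sub>-\<^sub>H(z)\<close> and
  \<open>(z/2)\<^sup>1\<^sup>-\<^sup>H C(z\<^sup>2/4) = J\<^sub>1\<^sub>-\<^sub>H(z)\<close>. The numbers \<open>\<lambda>\<^sub>n = \<omega>\<^sub>n\<^sup>2/4\<close> (\<open>n \<ge> 0\<close>) are the zeros of \<open>E(\<lambda>) = \<lambda> C(\<lambda>)\<close>, and the
  functions \<open>s \<mapsto> A(\<lambda>\<^sub>n s)\<close> form an orthogonal (Dini) system in \<open>L\<^sup>2([0,1], s\<^sup>-\<^sup>H ds)\<close> whose squared
  norms are, up to constants, the numbers \<open>\<sigma>\<^sup>-\<^sup>2(\<omega>\<^sub>n)\<close>. By Sonine's integral the inner product of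
  \<open>A(\<lambda>\<^sub>n s)\<close> with the positive part of \<open>u\<^sup>2 - s\<close> to the power \<open>H - 1/2\<close> is a multiple of
  \<open>sin(\<omega>\<^sub>n u)/\<omega>\<^sub>n\<close>, whose modulus is \<open>|f\<^sub>n(t)|/T\<close> for \<open>u = t/T\<close> and the \<open>n\<close>-th coefficient function \<open>f\<^sub>n\<close> of
  the series. Hence Parseval's identity says that the variances \<open>\<sigma>\<^sup>2(\<omega>\<^sub>n) |f\<^sub>n(t)|\<^sup>2\<close> sum up to \<open>t\<^sup>2\<^sup>H\<close>. The covariance
  follows by polarization, since \<open>|f\<^sub>n(s) - f\<^sub>n(t)| = |f\<^sub>n(s - t)|\<close>.

  Completeness of the system is a Herglotz argument. The Gram form of the functions \<open>A(l s)\<close> after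
  projecting away the first \<open>N\<close> members is \<open>D(l,m)\<close>, and \<open>D(l,m)/E(l)\<close> is holomorphic for
  \<open>|l| < \<lambda>\<^sub>N\<close>. The Cauchy-Schwarz inequality bounds it by a multiple of \<open>1/|Im l|\<close>, the maximum principle
  makes the bound uniform on large discs, so that the quotient is nearly constant; it is small for \<open>l \<rightarrow> -\<infinity>\<close>.

  For the uniform convergence, the same identity at dyadic \<open>u\<close> gives the convergence of
  \<open>\<Sum> \<sigma>\<^sup>2(\<omega>\<^sub>n) \<omega>\<^sub>n\<^sup>H\<^sup>-\<^sup>2\<close>. Gaussian moments on a grid and the Borel-Cantelli lemma then bound the partial sums
  weighted with \<open>\<omega>\<^sub>n\<^sup>H\<^sup>/\<^sup>2\<close> by \<open>\<omega>\<^sub>N\<^sup>H\<^sup>/\<^sup>4\<close>, and summation by parts removes the weights.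
\<close>

section \<open>Bessel-Clifford functions\<close>

text \<open>For g(s) = A(l s) Bessel's equation reads -(s^(1-H) g')' = l s^(-H) g, and -E(l) is
  g'(1). The Dini system thus consists of the eigenfunctions of a Sturm-Liouville problem with a
  Neumann condition at s = 1, which is why the constant function (n = 0) belongs to it. Lommel's
  formula is the Green identity of this problem. It yields the reality of the zeros and the norms,
  and with Bessel's inequality it gives a polynomial growth bound for the zeros that takes the place
  of Bessel asymptotics. On the probabilistic side only E|Z n|^2 is prescribed, and the
  \<open>Z n\<close> may fail to be circularly symmetric. The variance of a real linear combination
  is therefore bounded but not known in closed form; its limit exists because independence makes it
  monotone in the number of terms. The complex covariance is recovered from products of real parts
  by polarization. The weights in the last step are chosen so that the weighted sums still have
  bounded variance; they then almost surely grow more slowly than the weights, which is what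
  summation by parts requires.\<close>

definition clifford :: "real \<Rightarrow> 'a::{banach,real_normed_field} \<Rightarrow> 'a" where
  "clifford a x = (\<Sum>k. of_real (rGamma (real k + a) / fact k) * (- x) ^ k)"

lemma summable_clifford:
  fixes y :: "'a::{banach,real_normed_field}"
  shows "summable (\<lambda>k. of_real (rGamma (real k + a) / fact k) * y ^ k)"
proof -
  obtain N :: nat where N: "real N \<ge> 2 * norm y + \<bar>a\<bar> + 1"
    using real_arch_simple by blast
  show ?thesis
  proof (rule summable_ratio_test[of "1/2" N])
    fix k assume "k \<ge> N"
    then have k: "real k \<ge> 2 * norm y + \<bar>a\<bar> + 1" using N by linarith
    then have pos: "real k + a \<ge> 1" by (smt (verit) norm_ge_zero)
    have "(real k + a) * rGamma (real k + a + 1) = rGamma (real k + a)"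
      by (rule rGamma_plus1)
    then have r: "rGamma (real (Suc k) + a) = rGamma (real k + a) / (real k + a)"
      using pos by (simp add: field_simps)
    have "norm (of_real (rGamma (real (Suc k) + a) / fact (Suc k)) * y ^ Suc k)
        = norm (of_real (rGamma (real k + a) / fact k) * y ^ k) * (norm y / ((real k + a) * real (Suc k)))"
      unfolding r norm_mult norm_power norm_of_real using pos
      by (simp add: abs_mult abs_divide divide_simps del: of_nat_Suc)
    also have "\<dots> \<le> norm (of_real (rGamma (real k + a) / fact k) * y ^ k) * (1/2)"
    proof (rule mult_left_mono)
      have "norm y * 2 \<le> 1 * real (Suc k)" using k by simp
      also have "\<dots> \<le> (real k + a) * real (Suc k)" using pos by (intro mult_right_mono) auto
      finally show "norm y / ((real k + a) * real (Suc k)) \<le> 1/2"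
        using pos by (simp add: divide_simps del: of_nat_Suc)
    qed auto
    finally show "norm (of_real (rGamma (real (Suc k) + a) / fact (Suc k)) * y ^ Suc k)
       \<le> 1/2 * norm (of_real (rGamma (real k + a) / fact k) * y ^ k)" by (simp only: mult.commute)
  qed simp
qed

lemma clifford_sums:
  "(\<lambda>k. of_real (rGamma (real k + a) / fact k) * (- x) ^ k) sums clifford a x"
  unfolding clifford_def by (intro summable_sums summable_clifford)

lemma clifford_has_field_derivative [derivative_intros]:
  assumes "(g has_field_derivative g') (at x within S)"
  shows "((\<lambda>x. clifford a (g x)) has_field_derivative (- clifford (a + 1) (g x) * g')) (at x within S)"
proof -
  have d: "diffs (\<lambda>k. of_real (rGamma (real k + a) / fact k))
      = (\<lambda>k. of_real (rGamma (real k + (a + 1)) / fact k) :: 'a)"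
  proof (rule ext)
    fix k
    have "diffs (\<lambda>k. of_real (rGamma (real k + a) / fact k)) k
       = (of_real (real (Suc k) * (rGamma (real (Suc k) + a) / fact (Suc k))) :: 'a)"
      by (simp only: diffs_def of_real_mult of_real_of_nat_eq)
    also have "real (Suc k) * (rGamma (real (Suc k) + a) / fact (Suc k)) = rGamma (real k + (a + 1)) / fact k"
      by (simp add: divide_simps add_ac del: of_nat_Suc) (simp add: algebra_simps)
    finally show "diffs (\<lambda>k. of_real (rGamma (real k + a) / fact k)) k
      = (of_real (rGamma (real k + (a + 1)) / fact k) :: 'a)" .
  qed
  have "((\<lambda>y. \<Sum>k. of_real (rGamma (real k + a) / fact k) * y ^ k) has_field_derivative
     (\<Sum>k. of_real (rGamma (real k + (a + 1)) / fact k) * z ^ k)) (at z)" for z :: 'a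
    using termdiffs_strong_converges_everywhere[OF summable_clifford, of a z] unfolding d .
  from DERIV_chain2[OF this, of "\<lambda>x. - g x" "- g'" x S] assms
  show ?thesis unfolding clifford_def by (auto intro: derivative_eq_intros)
qed

lemma clifford_continuous_on [continuous_intros]:
  fixes g :: "'b::topological_space \<Rightarrow> 'a::{banach,real_normed_field}"
  assumes "continuous_on S g"
  shows "continuous_on S (\<lambda>x. clifford a (g x))"
proof -
  have "continuous_on UNIV (clifford a :: 'a \<Rightarrow> 'a)"
    by (rule DERIV_continuous_on[where D = "\<lambda>x. - clifford (a + 1) x * 1"])
       (intro clifford_has_field_derivative DERIV_ident)
  then show ?thesis using assms continuous_on_compose2 by blast
qed

text \<open>\<open>rGamma (k + a) = (k + a) * rGamma (k + a + 1)\<close>, and the two parts of the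
  factor \<open>k + a\<close> give the two series on the left. Together with the derivative formula
  this is Bessel's differential equation.\<close>

lemma clifford_recurrence:
  "of_real a * clifford (a + 1) x - x * clifford (a + 2) x = clifford a x"
proof -
  let ?c = "\<lambda>a k. of_real (rGamma (real k + a) / fact k) * (- x) ^ k"
  have s1: "(\<lambda>k. of_real a * ?c (a + 1) k) sums (of_real a * clifford (a + 1) x)"
    by (intro sums_mult clifford_sums)
  have "(\<lambda>k. (- x) * ?c (a + 2) k) sums ((- x) * clifford (a + 2) x)"
    by (intro sums_mult clifford_sums)
  also have "(\<lambda>k. (- x) * ?c (a + 2) k)
     = (\<lambda>k. of_real (rGamma (real (Suc k) + (a + 1)) * real (Suc k) / fact (Suc k)) * (- x) ^ Suc k)"
  proof (rule ext)
    fix k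
    have "rGamma (real (Suc k) + (a + 1)) * real (Suc k) / fact (Suc k) = rGamma (real k + (a + 2)) / fact k"
      by (simp add: divide_simps add_ac del: of_nat_Suc) (simp add: algebra_simps)
    then show "(- x) * ?c (a + 2) k =
       of_real (rGamma (real (Suc k) + (a + 1)) * real (Suc k) / fact (Suc k)) * (- x) ^ Suc k"
      by simp
  qed
  \<comment> \<open>The summand at index 0 vanishes because of the factor \<open>real k\<close>, so
    the index shift leaves no extra term.\<close>
  finally have "(\<lambda>k. of_real (rGamma (real k + (a + 1)) * real k / fact k) * (- x) ^ k)
      sums ((- x) * clifford (a + 2) x)"
    by (subst (asm) sums_Suc_iff) simp
  from sums_add[OF s1 this]
  have "(\<lambda>k. of_real a * ?c (a + 1) k + of_real (rGamma (real k + (a + 1)) * real k / fact k) * (- x) ^ k)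
    sums (of_real a * clifford (a + 1) x - x * clifford (a + 2) x)" by simp
  also have "(\<lambda>k. of_real a * ?c (a + 1) k + of_real (rGamma (real k + (a + 1)) * real k / fact k) * (- x) ^ k) = ?c a"
  proof (rule ext)
    fix k
    have "rGamma (real k + a) = (real k + a) * rGamma (real k + a + 1)" by (rule rGamma_plus1[symmetric])
    then have "rGamma (real k + a) / fact k = a * (rGamma (real k + (a + 1)) / fact k) + rGamma (real k + (a + 1)) * real k / fact k"
      by (simp add: divide_simps add_ac) (simp add: algebra_simps)
    then show "of_real a * ?c (a + 1) k + of_real (rGamma (real k + (a + 1)) * real k / fact k) * (- x) ^ k = ?c a k"
      by (simp only: of_real_add of_real_mult mult.assoc distrib_right)
  qed
  finally show ?thesis using clifford_sums sums_unique2 by blast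
qed

lemma clifford_of_real: "clifford a (of_real x) = of_real (clifford a x)"
proof -
  have "(\<lambda>k. of_real (of_real (rGamma (real k + a) / fact k) * (- x) ^ k)) sums
     (of_real (clifford a x) :: 'a::{banach,real_normed_field})"
    by (intro sums_of_real clifford_sums)
  then have "(\<lambda>k. of_real (rGamma (real k + a) / fact k) * (- of_real x) ^ k) sums
     (of_real (clifford a x) :: 'a::{banach,real_normed_field})"
    by simp
  then show ?thesis using clifford_sums sums_unique2 by blast
qed

lemma clifford_cnj: "clifford a (cnj z) = cnj (clifford a z)"
proof -
  have "(\<lambda>k. cnj (of_real (rGamma (real k + a) / fact k) * (- z) ^ k)) sums cnj (clifford a z)"
    by (subst sums_cnj) (rule clifford_sums)
  then have "(\<lambda>k. of_real (rGamma (real k + a) / fact k) * (- cnj z) ^ k) sums cnj (clifford a z)"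
    by simp
  then show ?thesis using clifford_sums sums_unique2 by blast
qed

lemma rGamma_real_pos: "rGamma (x::real) > 0" if "x > 0"
  using Gamma_real_pos[OF that] by (simp add: rGamma_inverse_Gamma)

lemma clifford_0: "clifford a 0 = of_real (rGamma a)"
  using powser_sums_zero_iff[of "\<lambda>k. of_real (rGamma (real k + a) / fact k) :: 'a"] clifford_sums[of a "0::'a"]
  by (simp add: sums_unique2)

lemma clifford_pos:
  fixes x :: real
  assumes "a > 0" "x \<le> 0"
  shows "clifford a x > 0"
  unfolding clifford_def
proof (rule suminf_pos2[where i = 0])
  show "summable (\<lambda>k. of_real (rGamma (real k + a) / fact k) * (- x) ^ k)" by (rule summable_clifford)
  show "of_real (rGamma (real k + a) / fact k) * (- x) ^ k \<ge> 0" for k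
    using assms rGamma_real_pos[of "real k + a"] by simp
  show "of_real (rGamma (real 0 + a) / fact 0) * (- x) ^ 0 > 0" using assms rGamma_real_pos by simp
qed

section \<open>Translation between Bessel and Clifford functions\<close>

lemma neg_one_power_mult_half_power: "(- 1) ^ k * (x / 2) ^ (2 * k) = (- (x\<^sup>2 / 4)) ^ k" for x :: real
proof -
  have "(x / 2) ^ (2 * k) = (x\<^sup>2 / 4) ^ k"
    by (simp only: power_mult power_divide) simp
  then show ?thesis using power_mult_distrib[of "-1" "x\<^sup>2 / 4" k] by simp
qed

lemma bessel_series_eq_clifford:
  fixes \<nu> x :: real
  shows "bessel_series \<nu> x = clifford (\<nu> + 1) (x\<^sup>2 / 4)"
  unfolding bessel_series_def clifford_def
proof (rule suminf_cong)
  fix k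
  have "(- 1) ^ k * (x / 2) ^ (2 * k) = (- (x\<^sup>2 / 4)) ^ k"
    by (rule neg_one_power_mult_half_power)
  then show "(- 1) ^ k * (x / 2) ^ (2 * k) / fact k * rGamma (of_nat k + \<nu> + 1)
     = of_real (rGamma (real k + (\<nu> + 1)) / fact k) * (- (x\<^sup>2 / 4)) ^ k"
    by (simp add: add_ac)
qed

lemma bessel_series_complex_of_real:
  "bessel_series (complex_of_real \<nu>) (of_real x) = of_real (clifford (\<nu> + 1) (x\<^sup>2 / 4))"
proof -
  have "(\<lambda>k. complex_of_real (of_real (rGamma (real k + (\<nu> + 1)) / fact k) * (- (x\<^sup>2 / 4)) ^ k)) sums
     (of_real (clifford (\<nu> + 1) (x\<^sup>2 / 4)))"
    by (intro sums_of_real clifford_sums)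
  also have "(\<lambda>k. complex_of_real (of_real (rGamma (real k + (\<nu> + 1)) / fact k) * (- (x\<^sup>2 / 4)) ^ k))
    = (\<lambda>k. (- 1) ^ k * (of_real x / 2) ^ (2 * k) / fact k * rGamma (of_nat k + of_real \<nu> + 1))"
  proof (rule ext)
    fix k
    have 1: "(- 1) ^ k * (x / 2) ^ (2 * k) = (- (x\<^sup>2 / 4)) ^ k"
      by (rule neg_one_power_mult_half_power)
    have 2: "rGamma (of_nat k + complex_of_real \<nu> + 1) = of_real (rGamma (real k + (\<nu> + 1)))"
      by (subst rGamma_complex_of_real[symmetric]) (simp add: add_ac)
    show "complex_of_real (of_real (rGamma (real k + (\<nu> + 1)) / fact k) * (- (x\<^sup>2 / 4)) ^ k)
      = (- 1) ^ k * (of_real x / 2) ^ (2 * k) / fact k * rGamma (of_nat k + of_real \<nu> + 1)"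
      unfolding 2 1[symmetric] by simp
  qed
  finally show ?thesis unfolding bessel_series_def by (simp add: sums_iff)
qed

text \<open>\<open>0 powr \<nu> = 0\<close> whatever the order, so 0 is listed separately; elsewhere
  the power does not vanish and the zeros are those of the entire factor.\<close>

lemma bessel_J_eq_0_iff:
  assumes "\<nu> \<noteq> 0"
  shows "bessel_J (of_real \<nu>) (of_real x) = 0 \<longleftrightarrow> x = 0 \<or> clifford (\<nu> + 1) (x\<^sup>2 / 4) = 0"
  using assms by (auto simp: bessel_J_def bessel_series_complex_of_real)

section \<open>Lommel's integral\<close>

text \<open>With s = r^2 this is, up to a constant, the weight r dr of Fourier-Bessel expansions,
  after the factor r^H that makes J_{-H} entire has been compensated in the weight.\<close>

definition jac :: "real \<Rightarrow> real measure" where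
  "jac H = density lborel (\<lambda>s. ennreal (indicator {0..1} s * s powr (- H)))"

lemma space_jac [simp]: "space (jac H) = UNIV"
  and sets_jac [measurable_cong, simp]: "sets (jac H) = sets borel"
  by (auto simp: jac_def)

text \<open>A nonnegative gauge integrable function is absolutely integrable. This carries
  \<open>has_integral\<close> facts such as the Beta integral over to the Lebesgue integral.\<close>

lemma set_integrable_lborel_of_nonneg:
  fixes f :: "real \<Rightarrow> real"
  assumes "f integrable_on S" "\<And>x. x \<in> S \<Longrightarrow> f x \<ge> 0" "f \<in> borel_measurable borel" "S \<in> sets borel"
  shows "set_integrable lborel S f"
proof -
  have "f absolutely_integrable_on S"
    using assms by (intro nonnegative_absolutely_integrable_1) auto
  moreover have "(\<lambda>x. indicator S x *\<^sub>R f x) \<in> borel_measurable lborel"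
    using assms(3,4) by simp
  ultimately show ?thesis
    unfolding set_integrable_def by (simp add: integrable_completion)
qed

lemma jac_integral:
  fixes f :: "real \<Rightarrow> 'b::{banach,second_countable_topology}"
  assumes [measurable]: "f \<in> borel_measurable borel"
  shows "integral\<^sup>L (jac H) f = (LINT s:{0..1}|lborel. s powr (- H) *\<^sub>R f s)"
  unfolding jac_def set_lebesgue_integral_def
  by (subst integral_density) (auto simp: mult_ac intro!: Bochner_Integration.integral_cong split: split_indicator)

lemma jac_integrable_iff:
  fixes f :: "real \<Rightarrow> 'b::{banach,second_countable_topology}"
  assumes [measurable]: "f \<in> borel_measurable borel"
  shows "integrable (jac H) f \<longleftrightarrow> set_integrable lborel {0..1} (\<lambda>s. s powr (- H) *\<^sub>R f s)"
  unfolding jac_def set_integrable_def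
  by (subst integrable_density) (auto simp: mult_ac intro!: Bochner_Integration.integrable_cong split: split_indicator)

lemma AE_jac: "AE s in jac H. s \<in> {0<..<1}"
proof -
  have "AE s in lborel. s \<noteq> (0::real)" "AE s in lborel. s \<noteq> (1::real)"
    using AE_lborel_singleton[of 0] AE_lborel_singleton[of 1] by auto
  then show ?thesis unfolding jac_def
    by (subst AE_density) (auto simp: indicator_def)
qed

locale hurst =
  fixes H :: real
  assumes H0: "0 < H" and H1: "H < 1"
begin

lemma powr_integral: "((\<lambda>s. s powr (- H)) has_integral (1 / (1 - H))) {0..1}"
  using has_integral_powr_from_0[of "- H" 1] H1 by simp

lemma finite_measure_jac: "finite_measure (jac H)"
proof
  have "set_integrable lborel {0..1} (\<lambda>s. s powr (- H))"
    by (rule set_integrable_lborel_of_nonneg) (use powr_integral in auto)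
  then have "integrable (jac H) (\<lambda>_. 1 :: real)"
    by (subst jac_integrable_iff) auto
  then show "emeasure (jac H) (space (jac H)) \<noteq> \<infinity>"
    by (auto simp: integrable_iff_bounded)
qed

lemma jac_integrable_continuous:
  fixes f :: "real \<Rightarrow> 'b::{banach,second_countable_topology}"
  assumes "continuous_on {0..1} f" "f \<in> borel_measurable borel"
  shows "integrable (jac H) f"
proof -
  interpret finite_measure "jac H" by (rule finite_measure_jac)
  have "bounded (f ` {0..1})" using assms(1) compact_continuous_image compact_imp_bounded by blast
  then obtain B where "\<forall>x\<in>f ` {0..1}. norm x \<le> B" unfolding bounded_iff by blast
  then have B: "\<And>s. s \<in> {0..1} \<Longrightarrow> norm (f s) \<le> B" by blast
  have "AE s in jac H. norm (f s) \<le> B" using AE_jac by eventually_elim (auto intro: B)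
  then show ?thesis using assms by (intro integrable_const_bound) auto
qed

text \<open>The derivative is required only inside the interval, since the weight is singular at 0;
  continuity of \<open>F\<close> takes care of the endpoints.\<close>

lemma jac_FTC:
  fixes f F :: "real \<Rightarrow> 'b::{euclidean_space,second_countable_topology}"
  assumes "continuous_on {0..1} f" "f \<in> borel_measurable borel" "continuous_on {0..1} F"
    and "\<And>s. 0 < s \<Longrightarrow> s < 1 \<Longrightarrow> (F has_vector_derivative (s powr (- H) *\<^sub>R f s)) (at s)"
  shows "integral\<^sup>L (jac H) f = F 1 - F 0"
proof -
  have "set_integrable lborel {0..1} (\<lambda>s. s powr (- H) *\<^sub>R f s)"
    using jac_integrable_continuous[OF assms(1,2)] assms(2) by (simp add: jac_integrable_iff)
  then have "integral\<^sup>L (jac H) f = integral {0..1} (\<lambda>s. s powr (- H) *\<^sub>R f s)"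
    using assms(2) by (simp add: jac_integral set_borel_integral_eq_integral(2))
  also have "\<dots> = F 1 - F 0"
    by (rule integral_unique, rule fundamental_theorem_of_calculus_interior) (use assms in auto)
  finally show ?thesis .
qed

section \<open>The eigenfunctions A(l s) and Lommel's formulas\<close>

definition A :: "'a::{banach,real_normed_field} \<Rightarrow> 'a" where "A = clifford (1 - H)"
definition C :: "'a::{banach,real_normed_field} \<Rightarrow> 'a" where "C = clifford (2 - H)"
definition E :: "'a::{banach,real_normed_field} \<Rightarrow> 'a" where "E x = x * C x"

lemma A_deriv: "(A has_field_derivative - C x) (at x within S)"
  using clifford_has_field_derivative[OF DERIV_ident, of "1 - H" x S] by (simp add: A_def C_def)

lemma C_deriv: "(C has_field_derivative - clifford (3 - H) x) (at x within S)"
  using clifford_has_field_derivative[OF DERIV_ident, of "2 - H" x S] by (simp add: C_def)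

lemma AC_recurrence: "of_real (1 - H) * C x - x * clifford (3 - H) x = A x"
  using clifford_recurrence[of "1 - H" x] by (simp add: A_def C_def)

lemma E_deriv: "(E has_field_derivative A x + of_real H * C x) (at x within S)"
proof -
  have "(E has_field_derivative 1 * C x + - clifford (3 - H) x * x) (at x within S)"
    unfolding E_def[abs_def] by (intro DERIV_mult DERIV_ident C_deriv)
  moreover have "1 * C x + - clifford (3 - H) x * x = A x + of_real H * C x"
    using AC_recurrence[of x] by (simp add: algebra_simps)
  ultimately show ?thesis by simp
qed

lemma continuous_on_A [continuous_intros]:
  fixes g :: "'b::topological_space \<Rightarrow> 'a::{banach,real_normed_field}"
  shows "continuous_on S g \<Longrightarrow> continuous_on S (\<lambda>x. A (g x))"
  unfolding A_def by (rule clifford_continuous_on)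

lemma continuous_on_C [continuous_intros]:
  fixes g :: "'b::topological_space \<Rightarrow> 'a::{banach,real_normed_field}"
  shows "continuous_on S g \<Longrightarrow> continuous_on S (\<lambda>x. C (g x))"
  unfolding C_def by (rule clifford_continuous_on)

lemma A_of_real: "A (of_real x) = of_real (A x)" and C_of_real: "C (of_real x) = of_real (C x)"
  and E_of_real: "E (of_real x) = of_real (E x)"
  by (simp_all add: A_def C_def E_def clifford_of_real)

lemma A_cnj: "A (cnj x) = cnj (A x)" and E_cnj: "E (cnj x) = cnj (E x)"
  by (simp_all add: A_def C_def E_def clifford_cnj)

lemma A_0: "A 0 = of_real (rGamma (1 - H))" and C_0: "C 0 = of_real (rGamma (2 - H))"
  by (simp_all add: A_def C_def clifford_0)

lemma A_pos: "x \<le> 0 \<Longrightarrow> A (x::real) > 0" and C_pos: "x \<le> 0 \<Longrightarrow> C (x::real) > 0"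
  using H1 by (simp_all add: A_def C_def clifford_pos)

lemma A_measurable [measurable]: "A \<in> borel_measurable (borel :: 'b::{banach,real_normed_field} measure)"
  by (intro borel_measurable_continuous_onI continuous_on_A continuous_on_id)

text \<open>Bilinear and not sesquilinear, so that it is holomorphic in both arguments; the squared
  Hermitian norm is \<open>L l (cnj l)\<close>.\<close>

definition L :: "complex \<Rightarrow> complex \<Rightarrow> complex" where
  "L l m = integral\<^sup>L (jac H) (\<lambda>s. A (l * of_real s) * A (m * of_real s))"

text \<open>The primitive is \<open>s powr (1 - H)\<close> times \<open>G\<close>. Its derivative is
  \<open>s powr (- H)\<close> times the left side of \<open>eq\<close>, and it vanishes at 0 because
  H < 1. A closed form for an integral thus amounts to a \<open>G\<close> that satisfies
  \<open>eq\<close>.\<close>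

lemma jac_FTC_complex:
  fixes G D f :: "complex \<Rightarrow> complex"
  assumes G: "\<And>z. (G has_field_derivative D z) (at z)"
    and eq: "\<And>z. z * D z + of_real (1 - H) * G z = f z" and f: "continuous_on UNIV f"
  shows "integral\<^sup>L (jac H) (\<lambda>s. f (of_real s)) = G 1"
proof -
  define W where "W s = s powr (1 - H) *\<^sub>R G (of_real s)" for s :: real
  have fr: "continuous_on UNIV (\<lambda>s::real. f (of_real s))"
    using f by (rule continuous_on_compose2) (auto intro: continuous_intros)
  have "continuous_on UNIV G" using G by (intro DERIV_continuous_on)
  then have Gr: "continuous_on {0..1} (\<lambda>s::real. G (of_real s))"
    by (rule continuous_on_compose2) (auto intro: continuous_intros)
  have "integral\<^sup>L (jac H) (\<lambda>s. f (of_real s)) = W 1 - W 0"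
  proof (rule jac_FTC)
    have "continuous_on {0..1} (\<lambda>s. s powr (1 - H))"
      using H1 by (intro continuous_on_powr' continuous_intros) auto
    then show "continuous_on {0..1} W" unfolding W_def using Gr by (rule continuous_on_scaleR)
    fix s :: real assume s: "0 < s" "s < 1"
    have "((\<lambda>s. G (of_real s)) has_vector_derivative D (of_real s)) (at s)"
      using G by (rule has_vector_derivative_real_field)
    moreover have "((\<lambda>s. s powr (1 - H)) has_real_derivative (1 - H) * s powr (- H)) (at s)"
      using s by (auto intro!: derivative_eq_intros)
    ultimately have "(W has_vector_derivative (s powr (1 - H) *\<^sub>R D (of_real s) + ((1 - H) * s powr (- H)) *\<^sub>R G (of_real s))) (at s)"
      unfolding W_def by (intro has_vector_derivative_scaleR)
    moreover have "s powr (1 - H) = s powr (- H) * s"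
      using s powr_add[of s "- H" 1] by simp
    then have "s powr (1 - H) *\<^sub>R D (of_real s) + ((1 - H) * s powr (- H)) *\<^sub>R G (of_real s)
      = s powr (- H) *\<^sub>R (of_real s * D (of_real s) + of_real (1 - H) * G (of_real s))"
      by (simp add: scaleR_conv_of_real algebra_simps)
    ultimately show "(W has_vector_derivative s powr - H *\<^sub>R f (of_real s)) (at s)"
      unfolding eq by simp
  qed (use fr in \<open>auto intro: continuous_on_subset borel_measurable_continuous_onI\<close>)
  then show ?thesis by (simp add: W_def)
qed

lemma scaled_deriv:
  fixes l :: complex
  shows "((\<lambda>z. A (l * z)) has_field_derivative - C (l * z) * l) (at z)"
    and "((\<lambda>z. C (l * z)) has_field_derivative - clifford (3 - H) (l * z) * l) (at z)"
proof -
  have "((\<lambda>z. l * z) has_field_derivative l) (at z)" by (auto intro!: derivative_eq_intros)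
  then show "((\<lambda>z. A (l * z)) has_field_derivative - C (l * z) * l) (at z)"
    "((\<lambda>z. C (l * z)) has_field_derivative - clifford (3 - H) (l * z) * l) (at z)"
    by (rule DERIV_chain2[OF A_deriv], rule DERIV_chain2[OF C_deriv])
qed

text \<open>Green's identity. The function \<open>G\<close> is the Wronskian-like expression l C(l
  s) A(m s) - m C(m s) A(l s); the products of two values of \<open>C\<close> cancel in its
  derivative, and \<open>AC_recurrence\<close> removes \<open>clifford (3 - H)\<close>.\<close>

lemma lommel: "(l - m) * L l m = E l * A m - E m * A l"
proof -
  have "(l - m) * L l m = integral\<^sup>L (jac H) (\<lambda>s. (l - m) * (A (l * of_real s) * A (m * of_real s)))"
    unfolding L_def by simp
  also have "\<dots> = l * C (l * 1) * A (m * 1) - m * C (m * 1) * A (l * 1)"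
  proof (rule jac_FTC_complex)
    fix z
    let ?D = "l * (- clifford (3 - H) (l * z) * l) * A (m * z) + - C (m * z) * m * (l * C (l * z))
       - (m * (- clifford (3 - H) (m * z) * m) * A (l * z) + - C (l * z) * l * (m * C (m * z)))"
    show "((\<lambda>z. l * C (l * z) * A (m * z) - m * C (m * z) * A (l * z)) has_field_derivative ?D) (at z)"
      by (intro DERIV_diff DERIV_mult DERIV_cmult scaled_deriv)
    have "z * ?D + of_real (1 - H) * (l * C (l * z) * A (m * z) - m * C (m * z) * A (l * z)) =
       l * (of_real (1 - H) * C (l * z) - l * z * clifford (3 - H) (l * z)) * A (m * z)
       - m * (of_real (1 - H) * C (m * z) - m * z * clifford (3 - H) (m * z)) * A (l * z)"
      by algebra
    then show "z * ?D + of_real (1 - H) * (l * C (l * z) * A (m * z) - m * C (m * z) * A (l * z))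
        = (l - m) * (A (l * z) * A (m * z))"
      unfolding AC_recurrence by algebra
  qed (intro continuous_intros)
  finally show ?thesis by (simp add: E_def)
qed

text \<open>On the diagonal \<open>lommel\<close> reads 0 = 0. The value is the limit E' A - E A'
  there, and it is verified with a primitive of its own.\<close>

lemma L_diag: "L m m = (A m)\<^sup>2 + of_real H * A m * C m + m * (C m)\<^sup>2"
proof -
  have "L m m = A (m * 1) * A (m * 1) + of_real H * A (m * 1) * C (m * 1) + m * 1 * (C (m * 1) * C (m * 1))"
    unfolding L_def
  proof (rule jac_FTC_complex)
    fix z
    let ?a = "A (m * z)" and ?c = "C (m * z)" and ?c' = "clifford (3 - H) (m * z)"
    let ?D = "((- ?c * m) * ?a + (- ?c * m) * ?a)
        + ((of_real H * (- ?c * m)) * ?c + (- ?c' * m) * (of_real H * ?a))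
        + (m * 1 * (?c * ?c) + ((- ?c' * m) * ?c + (- ?c' * m) * ?c) * (m * z))"
    show "((\<lambda>z. A (m * z) * A (m * z) + of_real H * A (m * z) * C (m * z) + m * z * (C (m * z) * C (m * z)))
        has_field_derivative ?D) (at z)"
      by (intro DERIV_add DERIV_mult DERIV_cmult DERIV_ident scaled_deriv)
    have "m * z * ?c' = of_real (1 - H) * ?c - ?a" using AC_recurrence[of "m * z"] by (simp add: algebra_simps)
    then show "z * ?D + of_real (1 - H) * (?a * ?a + of_real H * ?a * ?c + m * z * (?c * ?c)) = ?a * ?a"
      unfolding of_real_diff of_real_1 by algebra
  qed (intro continuous_intros)
  then show ?thesis by (simp add: power2_eq_square)
qed

text \<open>By \<open>lommel\<close>, \<open>L l m\<close> is the difference quotient at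
  \<open>m\<close> of an entire function that vanishes there, and \<open>L_diag\<close> is its value
  at the removable singularity. This replaces differentiation under the integral.\<close>

lemma L_holomorphic: "(\<lambda>l. L l m) holomorphic_on UNIV"
proof -
  define g where "g l = E l * A m - E m * A l" for l
  have g: "(g has_field_derivative ((A l + of_real H * C l) * A m - E m * (- C l))) (at l)" for l
    unfolding g_def by (intro DERIV_diff DERIV_cmult DERIV_cmult_right E_deriv A_deriv)
  then have "g holomorphic_on UNIV"
    by (auto simp: holomorphic_on_open)
  then have "(\<lambda>l. if l = m then deriv g m else (g l - g m) / (l - m)) holomorphic_on UNIV"
    by (rule pole_lemma_open) simp
  also have "(\<lambda>l. if l = m then deriv g m else (g l - g m) / (l - m)) = (\<lambda>l. L l m)"
  proof (rule ext)
    fix l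
    have "deriv g m = L m m"
      using DERIV_imp_deriv[OF g[of m]] unfolding L_diag by (simp add: E_def algebra_simps power2_eq_square)
    moreover have "g m = 0" by (simp add: g_def)
    moreover have "l \<noteq> m \<Longrightarrow> L l m = g l / (l - m)"
      using lommel[of l m] by (simp add: g_def field_simps)
    ultimately show "(if l = m then deriv g m else (g l - g m) / (l - m)) = L l m" by auto
  qed
  finally show ?thesis .
qed

text \<open>\<open>A 0\<close> is 1/\<Gamma>(1-H) and not 0, so the integrand is positive near s = 0
  for every \<open>l\<close>.\<close>

lemma L_cnj_pos: "integral\<^sup>L (jac H) (\<lambda>s. (cmod (A (l * of_real s)))\<^sup>2) > 0"
proof -
  have int: "integrable (jac H) (\<lambda>s. (cmod (A (l * of_real s)))\<^sup>2)"
    by (intro jac_integrable_continuous continuous_intros) measurable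
  have "integral\<^sup>L (jac H) (\<lambda>s. (cmod (A (l * of_real s)))\<^sup>2) \<noteq> 0"
  proof
    assume "integral\<^sup>L (jac H) (\<lambda>s. (cmod (A (l * of_real s)))\<^sup>2) = 0"
    then have "AE s in jac H. A (l * of_real s) = 0"
      using integral_nonneg_eq_0_iff_AE[OF int] by simp
    then have ae: "AE s in lborel. s \<in> {0<..<1} \<longrightarrow> A (l * of_real s) = 0"
      unfolding jac_def by (subst (asm) AE_density) (auto elim!: eventually_mono)
    have "continuous_on UNIV (\<lambda>s::real. A (l * of_real s))" by (intro continuous_intros)
    then have "((\<lambda>s::real. A (l * of_real s)) \<longlongrightarrow> A (l * of_real 0)) (at 0)"
      unfolding continuous_on_def by blast
    moreover have "A (l * of_real 0) \<noteq> 0" using rGamma_real_pos[of "1 - H"] H1 by (simp add: A_0)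
    ultimately have "eventually (\<lambda>s::real. A (l * of_real s) \<noteq> 0) (at 0)"
      by (rule tendsto_imp_eventually_ne)
    then obtain d where d: "d > 0" "\<And>s. s \<noteq> 0 \<Longrightarrow> \<bar>s\<bar> < d \<Longrightarrow> A (l * of_real s) \<noteq> 0"
      by (auto simp: eventually_at dist_real_def)
    have "AE s in lborel. s \<notin> {0<..<min d 1}"
      using ae by eventually_elim (use d in auto)
    then have "emeasure lborel {0<..<min d 1} = 0"
      by (subst (asm) AE_iff_null_sets[symmetric]) (auto simp: null_sets_def)
    then show False using d by auto
  qed
  then show ?thesis using Bochner_Integration.integral_nonneg[of "jac H" "\<lambda>s. (cmod (A (l * of_real s)))\<^sup>2"]
    by (simp add: less_le)
qed

lemma L_commute: "L l m = L m l"
  unfolding L_def by (simp add: mult.commute)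

lemma L_cnj: "L l (cnj l) = of_real (integral\<^sup>L (jac H) (\<lambda>s. (cmod (A (l * of_real s)))\<^sup>2))"
proof -
  have "A (l * of_real s) * A (cnj l * of_real s) = of_real ((cmod (A (l * of_real s)))\<^sup>2)" for s
    using A_cnj[of "l * of_real s"] by (simp add: complex_norm_square[symmetric])
  then show ?thesis unfolding L_def by (simp only: integral_complex_of_real)
qed

lemma L_of_real: "L (of_real l) (of_real m) = of_real (integral\<^sup>L (jac H) (\<lambda>s. A (l * s) * A (m * s)))"
proof -
  have "A (of_real l * of_real s) * A (of_real m * of_real s) = complex_of_real (A (l * s) * A (m * s))" for s
    by (metis A_of_real of_real_mult)
  then show ?thesis unfolding L_def by (simp only: integral_complex_of_real)
qed

end

section \<open>Orthogonal systems\<close>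

lemma quadratic_form_Cauchy_Schwarz:
  fixes a b c :: real
  assumes nn: "\<And>t. a + 2 * t * b + t\<^sup>2 * c \<ge> 0"
  shows "b\<^sup>2 \<le> a * c"
proof -
  have "c \<ge> 0"
  proof (rule ccontr)
    assume c: "\<not> c \<ge> 0"
    \<comment> \<open>So large that for negative \<open>c\<close> the term
      \<open>t\<^sup>2 * c\<close> outweighs the rest of the quadratic form.\<close>
    define t where "t = (\<bar>a\<bar> + 2 * \<bar>b\<bar> + 1) / - c + 1"
    have "(\<bar>a\<bar> + 2 * \<bar>b\<bar> + 1) / - c \<ge> 0" using c by (intro divide_nonneg_pos) auto
    then have t: "t \<ge> 1" "- c * (t - 1) = \<bar>a\<bar> + 2 * \<bar>b\<bar> + 1" using c by (auto simp: t_def)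
    have "- c * t \<ge> \<bar>a\<bar> + 2 * \<bar>b\<bar> + 1" using t c by (auto simp: algebra_simps)
    then have "- c * t * t \<ge> (\<bar>a\<bar> + 2 * \<bar>b\<bar> + 1) * t" using t by (intro mult_right_mono) auto
    then have "c * t * t \<le> - (\<bar>a\<bar> * t) - 2 * t * \<bar>b\<bar> - t" by (simp add: algebra_simps)
    moreover have "2 * t * b \<le> 2 * t * \<bar>b\<bar>" using t by (intro mult_left_mono) auto
    moreover have "\<bar>a\<bar> * 1 \<le> \<bar>a\<bar> * t" using t by (intro mult_left_mono) auto
    moreover have "t\<^sup>2 * c = c * t * t" by (simp add: power2_eq_square)
    ultimately have "a + 2 * t * b + t\<^sup>2 * c < 0" using t abs_ge_self[of a] by linarith
    then show False using nn[of t] by simp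
  qed
  show ?thesis
  proof (cases "c = 0")
    case True
    have "b = 0"
    proof (rule ccontr)
      assume "b \<noteq> 0"
      then have "a + 2 * (- (\<bar>a\<bar> + 1) / (2 * b)) * b = a - \<bar>a\<bar> - 1" by (simp add: field_simps)
      then show False using nn[of "- (\<bar>a\<bar> + 1) / (2 * b)"] True by simp
    qed
    then show ?thesis using True by simp
  next
    case False
    then have "c > 0" using \<open>c \<ge> 0\<close> by simp
    moreover have eq: "a + 2 * (- b / c) * b + (- b / c)\<^sup>2 * c = a - b\<^sup>2 / c"
      using False by (simp add: field_simps power2_eq_square)
    have "a - b\<^sup>2 / c \<ge> 0" using nn[of "- b / c"] unfolding eq .
    ultimately show ?thesis by (simp add: field_simps)
  qed
qed

locale orthogonal_system =
  fixes M :: "'b measure" and \<phi> :: "nat \<Rightarrow> 'b \<Rightarrow> real"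
  assumes phi_measurable: "\<And>n. \<phi> n \<in> borel_measurable M"
    and phi_square_integrable: "\<And>n. integrable M (\<lambda>s. (\<phi> n s)\<^sup>2)"
    and phi_orthogonal: "\<And>i j. i \<noteq> j \<Longrightarrow> integral\<^sup>L M (\<lambda>s. \<phi> i s * \<phi> j s) = 0"
    and phi_nonzero: "\<And>n. integral\<^sup>L M (\<lambda>s. \<phi> n s * \<phi> n s) > 0"
begin

definition L2 :: "('b \<Rightarrow> real) \<Rightarrow> bool" where
  "L2 f \<longleftrightarrow> f \<in> borel_measurable M \<and> integrable M (\<lambda>s. (f s)\<^sup>2)"

definition ip :: "('b \<Rightarrow> real) \<Rightarrow> ('b \<Rightarrow> real) \<Rightarrow> real" where
  "ip f g = integral\<^sup>L M (\<lambda>s. f s * g s)"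

lemma L2_phi: "L2 (\<phi> n)"
  using phi_measurable phi_square_integrable by (simp add: L2_def)

lemma L2_mult: "L2 f \<Longrightarrow> L2 g \<Longrightarrow> integrable M (\<lambda>s. f s * g s)"
proof -
  assume fg: "L2 f" "L2 g"
  then have [measurable]: "f \<in> borel_measurable M" "g \<in> borel_measurable M" by (auto simp: L2_def)
  show ?thesis
  proof (rule Bochner_Integration.integrable_bound)
    show "integrable M (\<lambda>s. (f s)\<^sup>2 + (g s)\<^sup>2)" using fg by (auto simp: L2_def)
    have "\<bar>x * y\<bar> \<le> x\<^sup>2 + y\<^sup>2" for x y :: real
    proof -
      have "2 * \<bar>x * y\<bar> \<le> x\<^sup>2 + y\<^sup>2"
        using sum_squares_bound[of "\<bar>x\<bar>" "\<bar>y\<bar>"] by (simp add: abs_mult)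
      then show ?thesis using zero_le_power2[of x] zero_le_power2[of y] by linarith
    qed
    then show "AE s in M. norm (f s * g s) \<le> norm ((f s)\<^sup>2 + (g s)\<^sup>2)"
      by (intro AE_I2) (metis abs_of_nonneg norm_ge_zero order_trans real_norm_def)
  qed measurable
qed

lemma L2_add: "L2 f \<Longrightarrow> L2 g \<Longrightarrow> L2 (\<lambda>s. f s + g s)"
  using L2_mult[of f g] by (auto simp: L2_def power2_sum mult.assoc)

lemma L2_scale: "L2 f \<Longrightarrow> L2 (\<lambda>s. c * f s)"
  by (auto simp: L2_def power_mult_distrib)

lemma L2_0: "L2 (\<lambda>s. 0)" by (simp add: L2_def)

lemma L2_sum: "(\<And>i. i \<in> I \<Longrightarrow> L2 (f i)) \<Longrightarrow> L2 (\<lambda>s. \<Sum>i\<in>I. f i s)"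
  by (induction I rule: infinite_finite_induct) (auto simp: L2_0 L2_add)

lemma L2_diff: "L2 f \<Longrightarrow> L2 g \<Longrightarrow> L2 (\<lambda>s. f s - g s)"
  using L2_add[of f "\<lambda>s. (-1) * g s"] L2_scale[of g "-1"] by simp

lemma ip_commute: "ip f g = ip g f" by (simp add: ip_def mult.commute)

lemma ip_add: "L2 f \<Longrightarrow> L2 g \<Longrightarrow> L2 h \<Longrightarrow> ip (\<lambda>s. f s + g s) h = ip f h + ip g h"
  using L2_mult[of f h] L2_mult[of g h] by (simp add: ip_def distrib_right)

lemma ip_scale: "ip (\<lambda>s. c * f s) h = c * ip f h"
  by (simp add: ip_def mult.assoc)

lemma ip_sum: "(\<And>i. i \<in> I \<Longrightarrow> L2 (f i)) \<Longrightarrow> L2 h \<Longrightarrow> ip (\<lambda>s. \<Sum>i\<in>I. f i s) h = (\<Sum>i\<in>I. ip (f i) h)"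
  by (induction I rule: infinite_finite_induct) (simp_all add: ip_add L2_sum, simp_all add: ip_def)

lemma ip_self_nonneg: "ip f f \<ge> 0" by (simp add: ip_def)

text \<open>The Gram form of the components orthogonal to the first \<open>N\<close> members.
  Keeping it as a form in two functions, and not only as the remainder in Bessel's inequality, makes
  a Cauchy-Schwarz inequality for remainders available.\<close>

definition defect :: "nat \<Rightarrow> ('b \<Rightarrow> real) \<Rightarrow> ('b \<Rightarrow> real) \<Rightarrow> real" where
  "defect N f g = ip f g - (\<Sum>n<N. ip f (\<phi> n) * ip g (\<phi> n) / ip (\<phi> n) (\<phi> n))"

lemma defect_commute: "defect N f g = defect N g f"
  by (simp add: defect_def ip_commute mult.commute)

lemma defect_add: "L2 f \<Longrightarrow> L2 g \<Longrightarrow> L2 h \<Longrightarrow> defect N (\<lambda>s. f s + g s) h = defect N f h + defect N g h"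
  by (simp add: defect_def ip_add L2_phi add_divide_distrib distrib_right sum.distrib)

lemma defect_scale: "defect N (\<lambda>s. c * f s) h = c * defect N f h"
  by (simp add: defect_def ip_scale algebra_simps sum_distrib_left)

text \<open>Bessel's inequality: the value is the squared norm of \<open>f\<close> minus its
  projection, the \<open>g\<close> of the proof.\<close>

lemma defect_self_nonneg:
  assumes f: "L2 f"
  shows "defect N f f \<ge> 0"
proof -
  define c where "c n = ip f (\<phi> n) / ip (\<phi> n) (\<phi> n)" for n
  define g where "g s = (\<Sum>n<N. c n * \<phi> n s)" for s
  have g: "L2 g" unfolding g_def by (intro L2_sum L2_scale L2_phi)
  have gp: "ip g h = (\<Sum>n<N. c n * ip (\<phi> n) h)" if "L2 h" for h
    unfolding g_def using that by (subst ip_sum) (auto intro: L2_scale L2_phi simp: ip_scale)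
  have gg: "ip g (\<phi> k) = ip f (\<phi> k)" if "k < N" for k
  proof -
    have "ip g (\<phi> k) = (\<Sum>n<N. if n = k then ip f (\<phi> k) else 0)"
      unfolding gp[OF L2_phi]
    proof (rule sum.cong)
      fix n show "c n * ip (\<phi> n) (\<phi> k) = (if n = k then ip f (\<phi> k) else 0)"
        using phi_nonzero[of k] phi_orthogonal[of n k] by (auto simp: c_def ip_def)
    qed simp
    then show ?thesis using that by simp
  qed
  have "ip g f = (\<Sum>n<N. ip f (\<phi> n) * ip f (\<phi> n) / ip (\<phi> n) (\<phi> n))"
    unfolding gp[OF f] by (simp add: c_def ip_commute)
  moreover have "ip g g = ip g f"
    unfolding gp[OF g] gp[OF f]
  proof (rule sum.cong)
    fix n assume "n \<in> {..<N}"
    then show "c n * ip (\<phi> n) g = c n * ip (\<phi> n) f"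
      using gg[of n] ip_commute[of "\<phi> n" g] ip_commute[of "\<phi> n" f] by simp
  qed simp
  moreover have "ip (\<lambda>s. f s + (- 1) * g s) (\<lambda>s. f s + (- 1) * g s) = ip f f - 2 * ip g f + ip g g"
  proof -
    define F where "F = (\<lambda>s. f s + (- 1) * g s)"
    have gm: "L2 (\<lambda>s. (- 1) * g s)" using g by (rule L2_scale)
    have F: "L2 F" unfolding F_def by (rule L2_add[OF f gm])
    have "ip F h = ip f h - ip g h" if "L2 h" for h
      unfolding F_def using ip_add[OF f gm that] ip_scale[of "-1" g h] by simp
    from this[OF F] this[OF f] this[OF g] have "ip F F = ip f f - 2 * ip g f + ip g g"
      using ip_commute[of f F] ip_commute[of g F] ip_commute[of f g] by linarith
    then show ?thesis by (simp only: F_def)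
  qed
  ultimately show ?thesis
    using ip_self_nonneg[of "\<lambda>s. f s + (- 1) * g s"] by (simp add: defect_def)
qed

lemma defect_add_scale:
  assumes "L2 f" "L2 g"
  shows "defect N (\<lambda>s. f s + t * g s) (\<lambda>s. f s + t * g s) = defect N f f + 2 * t * defect N f g + t\<^sup>2 * defect N g g"
proof -
  have tg: "L2 (\<lambda>s. t * g s)" using assms by (intro L2_scale)
  have 1: "defect N (\<lambda>s. f s + t * g s) h = defect N f h + t * defect N g h" if "L2 h" for h
    using defect_add[OF assms(1) tg that] by (simp add: defect_scale)
  define F where "F = (\<lambda>s. f s + t * g s)"
  have F: "L2 F" unfolding F_def by (rule L2_add[OF assms(1) tg])
  note 1 = 1[folded F_def]
  have "defect N F F = (defect N f f + t * defect N g f) + t * (defect N f g + t * defect N g g)"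
    using 1[OF F] 1[OF assms(1)] 1[OF assms(2)] defect_commute[of N f F] defect_commute[of N g F] by simp
  then have "defect N F F = defect N f f + 2 * t * defect N f g + t\<^sup>2 * defect N g g"
    using defect_commute[of N g f] by (simp add: algebra_simps power2_eq_square)
  then show ?thesis by (simp only: F_def)
qed

lemma defect_Cauchy_Schwarz:
  assumes "L2 f" "L2 g"
  shows "(defect N f g)\<^sup>2 \<le> defect N f f * defect N g g"
proof (rule quadratic_form_Cauchy_Schwarz)
  fix t show "defect N f f + 2 * t * defect N f g + t\<^sup>2 * defect N g g \<ge> 0"
    unfolding defect_add_scale[OF assms, symmetric]
    using assms by (intro defect_self_nonneg L2_add L2_scale)
qed

lemma defect_le_ip: "defect N f f \<le> ip f f"
  using phi_nonzero by (auto simp: defect_def ip_def intro!: sum_nonneg divide_nonneg_pos)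

text \<open>Parallelogram law for the form \<open>defect N\<close>, with the nonnegative term of the
  difference dropped.\<close>

lemma defect_self_add_le:
  assumes "L2 f" "L2 g"
  shows "defect N (\<lambda>s. f s + g s) (\<lambda>s. f s + g s) \<le> 2 * defect N f f + 2 * defect N g g"
proof -
  have "0 \<le> defect N (\<lambda>s. f s + (- 1) * g s) (\<lambda>s. f s + (- 1) * g s)"
    using assms by (intro defect_self_nonneg L2_add L2_scale)
  then show ?thesis using defect_add_scale[OF assms, of N 1] defect_add_scale[OF assms, of N "-1"] by simp
qed

text \<open>Membership in the closed linear span of the system, encoded by the decay of the
  remainder in Bessel's inequality.\<close>

definition expandable :: "('b \<Rightarrow> real) \<Rightarrow> bool" where
  "expandable f \<longleftrightarrow> L2 f \<and> (\<lambda>N. defect N f f) \<longlonglongrightarrow> 0"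

lemma expandable_add:
  assumes "expandable f" "expandable g"
  shows "expandable (\<lambda>s. f s + g s)"
proof -
  have fg: "L2 f" "L2 g" using assms by (auto simp: expandable_def)
  have "(\<lambda>N. 2 * defect N f f + 2 * defect N g g) \<longlonglongrightarrow> 2 * 0 + 2 * 0"
    using assms by (intro tendsto_intros) (auto simp: expandable_def)
  then have lim: "(\<lambda>N. 2 * defect N f f + 2 * defect N g g) \<longlonglongrightarrow> 0" by simp
  have "(\<lambda>N. defect N (\<lambda>s. f s + g s) (\<lambda>s. f s + g s)) \<longlonglongrightarrow> 0"
  proof (rule tendsto_sandwich[OF _ _ tendsto_const lim])
    show "\<forall>\<^sub>F N in sequentially. 0 \<le> defect N (\<lambda>s. f s + g s) (\<lambda>s. f s + g s)"
      using fg by (intro always_eventually allI defect_self_nonneg L2_add)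
    show "\<forall>\<^sub>F N in sequentially. defect N (\<lambda>s. f s + g s) (\<lambda>s. f s + g s) \<le> 2 * defect N f f + 2 * defect N g g"
      using fg by (intro always_eventually allI defect_self_add_le)
  qed
  then show ?thesis using fg by (simp add: expandable_def L2_add)
qed

lemma expandable_scale:
  assumes "expandable f"
  shows "expandable (\<lambda>s. c * f s)"
proof -
  have "defect N (\<lambda>s. c * f s) (\<lambda>s. c * f s) = c * (c * defect N f f)" for N
    by (simp add: defect_scale defect_commute[of N f "\<lambda>s. c * f s"])
  moreover have "(\<lambda>N. c * (c * defect N f f)) \<longlonglongrightarrow> c * (c * 0)"
    using assms by (intro tendsto_intros) (auto simp: expandable_def)
  ultimately show ?thesis using assms by (simp add: expandable_def L2_scale)
qed

lemma expandable_0: "expandable (\<lambda>s. 0)"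
  by (simp add: expandable_def L2_0 defect_def ip_def)

lemma expandable_sum: "(\<And>i. i \<in> I \<Longrightarrow> expandable (f i)) \<Longrightarrow> expandable (\<lambda>s. \<Sum>i\<in>I. f i s)"
  by (induction I rule: infinite_finite_induct) (auto simp: expandable_0 expandable_add)

text \<open>The remainder of \<open>f\<close> is at most twice that of \<open>g\<close> plus twice
  the squared norm of \<open>f - g\<close>, and the latter bound is uniform in
  \<open>N\<close>.\<close>

lemma expandable_limit:
  assumes f: "L2 f"
    and approx: "\<And>e. e > 0 \<Longrightarrow> \<exists>g. expandable g \<and> ip (\<lambda>s. f s - g s) (\<lambda>s. f s - g s) < e"
  shows "expandable f"
proof -
  have "(\<lambda>N. defect N f f) \<longlonglongrightarrow> 0"
  proof (rule LIMSEQ_I)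
    fix r :: real assume r: "r > 0"
    then obtain g where g: "expandable g" "ip (\<lambda>s. f s - g s) (\<lambda>s. f s - g s) < r / 4"
      using approx[of "r / 4"] by auto
    have g2: "L2 g" "(\<lambda>N. defect N g g) \<longlonglongrightarrow> 0" using g by (auto simp: expandable_def)
    then obtain N0 where N0: "\<And>N. N \<ge> N0 \<Longrightarrow> norm (defect N g g - 0) < r / 4"
      using LIMSEQ_D[OF g2(2), of "r / 4"] r by auto
    have "norm (defect N f f - 0) < r" if "N \<ge> N0" for N
    proof -
      have "defect N f f = defect N (\<lambda>s. (f s - g s) + g s) (\<lambda>s. (f s - g s) + g s)" by simp
      also have "\<dots> \<le> 2 * defect N (\<lambda>s. f s - g s) (\<lambda>s. f s - g s) + 2 * defect N g g"
        using f g2 by (intro defect_self_add_le L2_diff)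
      finally have "defect N f f < r"
        using N0[OF that] g(2) defect_le_ip[of N "\<lambda>s. f s - g s"] by simp
      then show ?thesis using defect_self_nonneg[OF f, of N] by simp
    qed
    then show "\<exists>no. \<forall>n\<ge>no. norm (defect n f f - 0) < r" by blast
  qed
  then show ?thesis using f by (simp add: expandable_def)
qed

lemma parseval:
  assumes "expandable f"
  shows "(\<lambda>n. (ip f (\<phi> n))\<^sup>2 / ip (\<phi> n) (\<phi> n)) sums ip f f"
proof -
  have "(\<lambda>N. ip f f - defect N f f) \<longlonglongrightarrow> ip f f - 0"
    using assms by (intro tendsto_intros) (auto simp: expandable_def)
  then show ?thesis by (simp add: sums_def defect_def power2_eq_square)
qed

end

section \<open>Completeness of the Dini system\<close>

text \<open>Near a zero of \<open>G\<close> the quotient equals that of the difference quotients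
  \<open>F1\<close> and \<open>G1\<close>, and \<open>G1\<close> does not vanish there; the value at
  the zero itself is the one of de l'Hospital's rule.\<close>

lemma holomorphic_quotient_simple_zeros:
  assumes F: "F holomorphic_on S" and G: "G holomorphic_on S" and S: "open S"
    and zeros: "\<And>z. z \<in> S \<Longrightarrow> G z = 0 \<Longrightarrow> F z = 0 \<and> deriv G z \<noteq> 0"
  obtains q where "q holomorphic_on S" "\<And>z. z \<in> S \<Longrightarrow> F z = q z * G z"
proof
  define q where "q z = (if G z = 0 then deriv F z / deriv G z else F z / G z)" for z
  show "F z = q z * G z" if "z \<in> S" for z using zeros[OF that] by (auto simp: q_def)
  show "q holomorphic_on S"
  proof (rule holomorphic_on_open[THEN iffD2, OF S], rule ballI)
    fix a assume a: "a \<in> S"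
    define F1 where "F1 z = (if z = a then deriv F a else (F z - F a) / (z - a))" for z
    define G1 where "G1 z = (if z = a then deriv G a else (G z - G a) / (z - a))" for z
    have hol: "F1 holomorphic_on S" "G1 holomorphic_on S"
      unfolding F1_def G1_def by (rule pole_lemma_open[OF F S], rule pole_lemma_open[OF G S])
    show "\<exists>f'. (q has_field_derivative f') (at a)"
    proof (cases "G a = 0")
      case False
      have "continuous (at a) G" using G S a holomorphic_on_imp_continuous_on continuous_on_eq_continuous_at by blast
      then have "eventually (\<lambda>z. G z \<noteq> 0) (nhds a)"
        using False tendsto_imp_eventually_ne[of G "G a" "at a" 0]
        by (auto simp: continuous_at eventually_at_filter eventually_nhds elim!: eventually_mono)
      then have ev: "eventually (\<lambda>z. F z / G z = q z) (nhds a)" by eventually_elim (simp add: q_def)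
      have "(F has_field_derivative deriv F a) (at a)" "(G has_field_derivative deriv G a) (at a)"
        using F G S a holomorphic_derivI by blast+
      then have D: "((\<lambda>z. F z / G z) has_field_derivative ((deriv F a * G a - F a * deriv G a) / (G a * G a))) (at a)"
        using False by (intro DERIV_divide)
      show ?thesis by (rule exI, rule DERIV_cong_ev[THEN iffD1, OF refl ev refl D])
    next
      case True
      then have z: "F a = 0" "deriv G a \<noteq> 0" using zeros[OF a] by auto
      have G1a: "G1 a \<noteq> 0" using z by (simp add: G1_def)
      have "continuous (at a) G1" using hol(2) S a holomorphic_on_imp_continuous_on continuous_on_eq_continuous_at by blast
      then have "eventually (\<lambda>z. G1 z \<noteq> 0) (at a)"
        using G1a tendsto_imp_eventually_ne[of G1 "G1 a" "at a" 0] by (auto simp: continuous_at)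
      then have "eventually (\<lambda>z. G1 z \<noteq> 0) (nhds a)"
        using G1a by (auto simp: eventually_at_filter elim!: eventually_mono)
      then have ev: "eventually (\<lambda>z. F1 z / G1 z = q z) (nhds a)"
      proof eventually_elim
        case (elim z)
        show ?case
        proof (cases "z = a")
          case True then show ?thesis using \<open>G a = 0\<close> by (simp add: F1_def G1_def q_def)
        next
          case False
          then show ?thesis using elim \<open>G a = 0\<close> z by (auto simp: F1_def G1_def q_def)
        qed
      qed
      have "(F1 has_field_derivative deriv F1 a) (at a)" "(G1 has_field_derivative deriv G1 a) (at a)"
        using hol S a holomorphic_derivI by blast+
      then have D: "((\<lambda>z. F1 z / G1 z) has_field_derivative ((deriv F1 a * G1 a - F1 a * deriv G1 a) / (G1 a * G1 a))) (at a)"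
        using G1a by (intro DERIV_divide)
      show ?thesis by (rule exI, rule DERIV_cong_ev[THEN iffD1, OF refl ev refl D])
    qed
  qed
qed

text \<open>Infinitely many real zeros, enumerated in increasing order, belong to the assumptions;
  that \<open>E\<close> has no nonreal zeros is proved below. The zero \<open>lam 0 = 0\<close>
  comes from the factor \<open>x\<close> in \<open>E x\<close>.\<close>

locale bessel_zeros = hurst +
  fixes lam :: "nat \<Rightarrow> real"
  assumes lam_0: "lam 0 = 0" and lam_mono: "strict_mono lam"
    and lam_zeros: "\<And>x. E x = 0 \<longleftrightarrow> x \<in> range lam"
begin

lemma lam_nonneg: "lam n \<ge> 0"
  using lam_mono lam_0 by (metis le0 strict_mono_less_eq)

lemma lam_inj: "i \<noteq> j \<Longrightarrow> lam i \<noteq> lam j"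
  using lam_mono by (metis strict_mono_eq)

lemma E_lam: "E (lam n) = 0" and E_lam_complex: "E (complex_of_real (lam n)) = 0"
  using lam_zeros by (auto simp: E_of_real)

text \<open>For a nonreal zero \<open>z\<close>, \<open>lommel\<close> would make
  \<open>L z (cnj z)\<close> vanish, but this is the squared norm of A(z s).\<close>

lemma E_zero_real: fixes z :: complex shows "E z = 0 \<Longrightarrow> Im z = 0"
proof (rule ccontr)
  assume E: "E z = 0" and im: "Im z \<noteq> 0"
  have "E (cnj z) = 0" by (simp add: E_cnj E)
  then have "(z - cnj z) * L z (cnj z) = 0" using lommel[of z "cnj z"] E by simp
  moreover have "z - cnj z \<noteq> 0" using im by (simp add: complex_eq_iff)
  moreover have "L z (cnj z) \<noteq> 0" using L_cnj_pos[of z] unfolding L_cnj by auto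
  ultimately show False by simp
qed

lemma E_zero_iff: fixes z :: complex shows "E z = 0 \<longleftrightarrow> (\<exists>n. z = of_real (lam n))"
proof
  assume "E z = 0"
  then have z: "z = of_real (Re z)" using E_zero_real[of z] by (simp add: complex_eq_iff)
  then have "E (Re z) = 0" using \<open>E z = 0\<close> by (metis E_of_real of_real_eq_0_iff)
  then obtain n where "Re z = lam n" unfolding lam_zeros by auto
  then show "\<exists>n. z = of_real (lam n)" using z by metis
qed (auto simp: E_lam_complex)

abbreviation \<phi> :: "nat \<Rightarrow> real \<Rightarrow> real" where "\<phi> n s \<equiv> A (lam n * s)"

sublocale orthogonal_system "jac H" "\<phi>"
proof
  show "\<phi> n \<in> borel_measurable (jac H)" for n by measurable
  show "integrable (jac H) (\<lambda>s. (\<phi> n s)\<^sup>2)" for n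
    by (intro jac_integrable_continuous continuous_intros) measurable
  show "integral\<^sup>L (jac H) (\<lambda>s. \<phi> i s * \<phi> j s) = 0" if "i \<noteq> j" for i j
  proof -
    have "(complex_of_real (lam i) - of_real (lam j)) * L (lam i) (lam j) = 0"
      unfolding lommel by (simp add: E_lam_complex)
    then have "L (lam i) (lam j) = 0" using lam_inj[OF that] by simp
    then show ?thesis unfolding L_of_real by simp
  qed
  show "integral\<^sup>L (jac H) (\<lambda>s. \<phi> n s * \<phi> n s) > 0" for n
  proof -
    have "cmod (A (complex_of_real (lam n) * of_real s)) = \<bar>\<phi> n s\<bar>" for s
      by (metis A_of_real norm_of_real of_real_mult)
    then show ?thesis using L_cnj_pos[of "of_real (lam n)"] by (simp add: power2_eq_square)
  qed
qed

abbreviation As :: "real \<Rightarrow> real \<Rightarrow> real" where "As l \<equiv> \<lambda>s. A (l * s)"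
abbreviation Re_A :: "complex \<Rightarrow> real \<Rightarrow> real" where "Re_A l \<equiv> \<lambda>s. Re (A (l * of_real s))"
abbreviation Im_A :: "complex \<Rightarrow> real \<Rightarrow> real" where "Im_A l \<equiv> \<lambda>s. Im (A (l * of_real s))"

definition nrm :: "nat \<Rightarrow> real" where "nrm n = ip (\<phi> n) (\<phi> n)"

lemma nrm_pos: "nrm n > 0" unfolding nrm_def ip_def by (rule phi_nonzero)

lemma L_lam_diag: "L (lam n) (lam n) = of_real (nrm n)"
  unfolding L_of_real nrm_def ip_def ..

lemma C_lam: "n \<noteq> 0 \<Longrightarrow> C (lam n) = 0"
  using E_lam[of n] lam_inj[of n 0] by (simp add: E_def lam_0)

lemma nrm_eq: "n \<noteq> 0 \<Longrightarrow> nrm n = (A (lam n))\<^sup>2"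
proof -
  assume n: "n \<noteq> 0"
  have "complex_of_real (nrm n) = of_real ((A (lam n))\<^sup>2)"
    unfolding L_lam_diag[symmetric] L_diag by (simp add: A_of_real C_of_real C_lam[OF n])
  then show ?thesis by (simp only: of_real_eq_iff)
qed

lemma nrm_0: "nrm 0 = (A 0)\<^sup>2 / (1 - H)"
proof -
  have C0: "(1 - H) * C 0 = (A 0 :: real)" using AC_recurrence[of "0::real"] by simp
  have "complex_of_real (nrm 0) = of_real ((A 0)\<^sup>2 + H * A 0 * C 0)"
    unfolding L_lam_diag[symmetric] L_diag by (simp add: lam_0 A_0 C_0)
  then have "nrm 0 = (A 0)\<^sup>2 + H * A 0 * C 0" by (simp only: of_real_eq_iff)
  also have "\<dots> = (A 0)\<^sup>2 / (1 - H)"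
  proof -
    have "(1 - H) * ((A 0)\<^sup>2 + H * A 0 * C 0) = (1 - H) * (A 0)\<^sup>2 + H * A 0 * ((1 - H) * C 0)"
      by (simp add: algebra_simps)
    also have "\<dots> = (A 0)\<^sup>2" unfolding C0 by (simp add: algebra_simps power2_eq_square)
    finally show ?thesis using H1 by (simp add: field_simps)
  qed
  finally show ?thesis .
qed

text \<open>The residue of \<open>A / E\<close> at \<open>lam n\<close>. The exceptional value at 0
  arises because E'(0) = C(0) = A(0)/(1-H), whereas E' = A at the other zeros.\<close>

definition b :: "nat \<Rightarrow> real" where "b n = (A (lam n))\<^sup>2 / nrm n"

lemma b_eq: "b n = (if n = 0 then 1 - H else 1)"
proof (cases "n = 0")
  case True
  have "A (0::real) \<noteq> 0" using A_pos[of 0] by simp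
  then show ?thesis using True by (simp add: b_def nrm_0 lam_0)
next
  case False
  then show ?thesis using nrm_eq[OF False] nrm_pos[of n] by (simp add: b_def)
qed

lemma b_pos: "b n > 0" using H1 by (simp add: b_eq)

lemma E_deriv_lam: "deriv E (complex_of_real (lam n)) \<noteq> 0"
proof -
  have "deriv E (complex_of_real (lam n)) = of_real (A (lam n) + H * C (lam n))"
    using DERIV_imp_deriv[OF E_deriv[of "complex_of_real (lam n)" UNIV]] by (simp add: A_of_real C_of_real)
  moreover have "A (lam n) + H * C (lam n) \<noteq> 0"
  proof (cases "n = 0")
    case True
    have "A (0::real) + H * C 0 > 0" using A_pos[of 0] C_pos[of 0] H0 by (intro add_pos_pos) auto
    then show ?thesis using True lam_0 by simp
  next
    case False
    then show ?thesis using nrm_eq[OF False] nrm_pos[of n] C_lam[OF False] by auto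
  qed
  ultimately show ?thesis by (simp only: of_real_eq_0_iff not_False_eq_True)
qed

text \<open>The complex bilinear extension of \<open>defect\<close>: holomorphic in
  \<open>l\<close>, and for \<open>m = cnj l\<close> the squared norm of what the projection leaves
  of A(l s).\<close>

definition Dc :: "nat \<Rightarrow> complex \<Rightarrow> complex \<Rightarrow> complex" where
  "Dc N l m = L l m - (\<Sum>n<N. L l (lam n) * L m (lam n) / nrm n)"

lemma L2_A: "L2 (As l)"
  unfolding L2_def by (intro conjI jac_integrable_continuous continuous_intros) measurable

lemma L2_Re: "L2 (Re_A l)" and L2_Im: "L2 (Im_A l)"
  unfolding L2_def by (intro conjI jac_integrable_continuous continuous_intros; measurable)+

lemma L_real_right:
  fixes l :: complex and m :: real
  shows "L l (of_real m) = Complex (ip (Re_A l) (As m)) (ip (Im_A l) (As m))"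
proof -
  let ?f = "\<lambda>s::real. A (l * of_real s) * A (of_real m * of_real s)"
  have int: "integrable (jac H) ?f" by (intro jac_integrable_continuous continuous_intros) measurable
  have "A (complex_of_real m * of_real s) = of_real (A (m * s))" for s by (metis A_of_real of_real_mult)
  then show ?thesis unfolding L_def ip_def
    using integral_Re[OF int] integral_Im[OF int] by (simp add: complex_eq_iff)
qed

lemma L_cnj_ip: "L l (cnj l) = of_real (ip (Re_A l) (Re_A l)
    + ip (Im_A l) (Im_A l))"
  unfolding L_cnj ip_def cmod_power2 power2_eq_square[symmetric]
  using L2_Re[of l] L2_Im[of l] by (simp add: L2_def)

lemma Dc_real_right:
  "Dc N l (of_real m) = Complex (defect N (Re_A l) (As m))
     (defect N (Im_A l) (As m))"
proof -
  have "L (of_real m) (of_real x) = of_real (ip (As m) (As x))" for x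
    unfolding L_of_real ip_def ..
  then show ?thesis
    unfolding Dc_def defect_def by (simp add: L_real_right complex_eq_iff nrm_def)
qed

lemma Dc_cnj:
  "Dc N l (cnj l) = of_real (defect N (Re_A l) (Re_A l)
     + defect N (Im_A l) (Im_A l))"
proof -
  have Lc: "L (cnj l) (of_real x) = cnj (L l (of_real x))" for x
  proof -
    have "A (cnj l * of_real s) = cnj (A (l * of_real s))" for s :: real
      using A_cnj[of "l * of_real s"] by simp
    then show ?thesis unfolding L_real_right by (simp add: complex_eq_iff ip_def)
  qed
  have "L l (of_real x) * L (cnj l) (of_real x) =
      of_real ((ip (Re_A l) (As x))\<^sup>2 + (ip (Im_A l) (As x))\<^sup>2)" for x
    unfolding Lc complex_norm_square[symmetric] unfolding L_real_right by (simp add: cmod_def)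
  then show ?thesis unfolding Dc_def L_cnj_ip defect_def
    by (simp add: nrm_def sum.distrib add_divide_distrib power2_eq_square)
qed

text \<open>The inequality is applied to the real and imaginary parts of A(l s) separately; their
  defects add up to \<open>Dc N l (cnj l)\<close>.\<close>

lemma Dc_Cauchy_Schwarz:
  fixes m :: real
  shows "(cmod (Dc N l (of_real m)))\<^sup>2 \<le> Re (Dc N l (cnj l)) * defect N (As m) (As m)"
proof -
  have "(cmod (Dc N l (of_real m)))\<^sup>2 = (defect N (Re_A l) (As m))\<^sup>2
     + (defect N (Im_A l) (As m))\<^sup>2"
    unfolding Dc_real_right by (simp add: cmod_def)
  also have "\<dots> \<le> defect N (Re_A l) (Re_A l) * defect N (As m) (As m)
     + defect N (Im_A l) (Im_A l) * defect N (As m) (As m)"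
    by (intro add_mono defect_Cauchy_Schwarz L2_Re L2_Im L2_A)
  finally show ?thesis unfolding Dc_cnj by (simp add: distrib_right)
qed

text \<open>The member \<open>\<phi> n\<close> with \<open>n < N\<close> is projected away. Hence
  the first \<open>N\<close> zeros of \<open>E\<close> cancel in the quotient of
  \<open>Dc N l m\<close> by \<open>E l\<close>.\<close>

lemma Dc_lam: "n < N \<Longrightarrow> Dc N (of_real (lam n)) m = 0"
proof -
  assume n: "n < N"
  have "L (lam n) (lam k) = (if k = n then of_real (nrm n) else 0)" for k
    using phi_orthogonal[of n k] L_lam_diag[of n] L_of_real[of "lam n" "lam k"] by auto
  then have "(\<Sum>k<N. L (lam n) (lam k) * L m (lam k) / nrm k) = (\<Sum>k<N. if k = n then L m (lam n) else 0)"
    using nrm_pos by (intro sum.cong) (auto simp: less_imp_neq[OF nrm_pos, symmetric])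
  also have "\<dots> = L m (lam n)" using n by simp
  finally show ?thesis unfolding Dc_def by (simp add: L_commute)
qed

text \<open>\<open>- A / E\<close> is a Herglotz function with poles \<open>lam n\<close>; \<open>h N\<close> has the first \<open>N\<close> of them removed. By
  \<open>Dc_eq_h\<close> and \<open>Dc_Cauchy_Schwarz\<close> it is still Herglotz.\<close>

definition h :: "nat \<Rightarrow> complex \<Rightarrow> complex" where
  "h N l = (\<Sum>n<N. of_real (b n) / (l - of_real (lam n))) - A l / E l"

text \<open>After division by \<open>E l * E m\<close>, Lommel's formula becomes a difference of two
  values of \<open>A / E\<close>, and by partial fractions each projection term becomes a difference
  of two values of \<open>b n / (l - lam n)\<close>.\<close>

lemma Dc_eq_h:
  fixes l m :: complex
  assumes "l \<noteq> m" "E l \<noteq> 0" "E m \<noteq> 0"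
  shows "Dc N l m * (l - m) = E l * E m * (h N l - h N m)"
proof -
  have Ln: "L z (lam n) = E z * A (lam n) / (z - lam n)" if "E z \<noteq> 0" for z n
  proof -
    have "z \<noteq> lam n" using that E_lam_complex by auto
    then show ?thesis using lommel[of z "lam n"] by (simp add: E_lam_complex A_of_real field_simps)
  qed
  have "L l (lam n) * L m (lam n) / nrm n * (l - m) = E l * E m * (of_real (b n) / (m - of_real (lam n)) - of_real (b n) / (l - of_real (lam n)))" for n
  proof -
    have ne: "l \<noteq> lam n" "m \<noteq> lam n" using assms E_lam_complex by auto
    have "L l (lam n) * L m (lam n) / nrm n = E l * E m * b n / ((l - of_real (lam n)) * (m - of_real (lam n)))"
      unfolding Ln[OF assms(2)] Ln[OF assms(3)] b_def by (simp add: power2_eq_square mult_ac)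
    moreover have "of_real (b n) / (m - of_real (lam n)) - of_real (b n) / (l - of_real (lam n)) = b n * (l - m) / ((l - of_real (lam n)) * (m - of_real (lam n)))"
      using ne by (simp add: field_simps)
    ultimately show ?thesis by simp
  qed
  then have "(\<Sum>n<N. L l (lam n) * L m (lam n) / nrm n) * (l - m)
     = E l * E m * ((\<Sum>n<N. of_real (b n) / (m - of_real (lam n))) - (\<Sum>n<N. of_real (b n) / (l - of_real (lam n))))"
    by (simp add: sum_distrib_right sum_subtractf[symmetric] sum_distrib_left)
  moreover have "L l m * (l - m) = E l * E m * (A m / E m - A l / E l)"
  proof -
    have "E l * E m * (A m / E m - A l / E l) = E l * A m - E m * A l"
      using assms by (simp add: right_diff_distrib)
    then show ?thesis using lommel[of l m] by (simp add: mult.commute)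
  qed
  ultimately show ?thesis unfolding Dc_def h_def by (simp add: algebra_simps)
qed

lemma h_cnj: "h N (cnj l) = cnj (h N l)"
  by (simp add: h_def A_cnj E_cnj)

end

section \<open>Growth of the zeros and decay of the defect\<close>

context bessel_zeros
begin

lemma ip_A: "(l - m) * ip (As l) (As m) = E l * A m - E m * A l"
proof -
  have "complex_of_real ((l - m) * ip (As l) (As m)) = of_real (E l * A m - E m * A l)"
    using lommel[of "of_real l" "of_real m"] unfolding L_of_real ip_def by (simp add: A_of_real E_of_real)
  then show ?thesis by (simp only: of_real_eq_iff)
qed

lemma ip_A_phi: "m < 0 \<Longrightarrow> ip (As m) (\<phi> n) = E m * A (lam n) / (m - lam n)"
  using ip_A[of m "lam n"] lam_nonneg[of n] by (simp add: E_lam field_simps)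

lemma E_neg: "m < 0 \<Longrightarrow> E m < (0::real)"
  using C_pos[of m] by (simp add: E_def mult_neg_pos)

text \<open>Bessel's inequality for A(-s) bounds the sum of
  \<open>b n / (1 + lam n)\<^sup>2\<close>, and since \<open>lam\<close> increases, the first
  \<open>N\<close> terms are at least \<open>(1 - H) / (1 + lam N)\<^sup>2\<close> each. A crude
  substitute for the asymptotics of the zeros.\<close>

lemma lam_growth: "\<exists>K>0. \<forall>n. real n \<le> K * (1 + lam n)\<^sup>2"
proof -
  let ?f = "As (- 1)"
  define K0 where "K0 = ip ?f ?f / (E (- 1))\<^sup>2"
  have m1: "- 1 < (0::real)" by simp
  have E: "E (- 1) \<noteq> (0::real)" using E_neg[of "-1"] by simp
  have "real N * (1 - H) / (1 + lam N)\<^sup>2 \<le> K0" for N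
  proof -
    have "0 \<le> defect N ?f ?f" by (intro defect_self_nonneg L2_A)
    then have "(\<Sum>n<N. ip ?f (\<phi> n) * ip ?f (\<phi> n) / nrm n) \<le> ip ?f ?f"
      unfolding defect_def nrm_def by simp
    also have "(\<Sum>n<N. ip ?f (\<phi> n) * ip ?f (\<phi> n) / nrm n) = (E (- 1))\<^sup>2 * (\<Sum>n<N. b n / (1 + lam n)\<^sup>2)"
      unfolding sum_distrib_left
    proof (rule sum.cong)
      fix n
      have "(- 1 - lam n)\<^sup>2 = (1 + lam n)\<^sup>2" by (simp add: power2_eq_square algebra_simps)
      moreover have "ip ?f (\<phi> n) * ip ?f (\<phi> n) / nrm n = (E (- 1))\<^sup>2 * b n / (- 1 - lam n)\<^sup>2"
        unfolding ip_A_phi[OF m1] b_def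
        by (simp add: power2_eq_square mult_ac)
      ultimately show "ip ?f (\<phi> n) * ip ?f (\<phi> n) / nrm n = (E (- 1))\<^sup>2 * (b n / (1 + lam n)\<^sup>2)" by simp
    qed simp
    finally have "(\<Sum>n<N. b n / (1 + lam n)\<^sup>2) \<le> K0"
      using E unfolding K0_def by (simp add: field_simps)
    moreover have "(\<Sum>n<N. (1 - H) / (1 + lam N)\<^sup>2) \<le> (\<Sum>n<N. b n / (1 + lam n)\<^sup>2)"
    proof (rule sum_mono)
      fix n assume "n \<in> {..<N}"
      then have "lam n \<le> lam N" using lam_mono by (simp add: strict_mono_less_eq)
      then have "(1 + lam n)\<^sup>2 \<le> (1 + lam N)\<^sup>2" using lam_nonneg[of n] by (intro power_mono) auto
      moreover have "(1 + lam n)\<^sup>2 > 0" using lam_nonneg[of n] by (intro zero_less_power) linarith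
      moreover have "1 - H \<le> b n" using H0 by (simp add: b_eq)
      ultimately show "(1 - H) / (1 + lam N)\<^sup>2 \<le> b n / (1 + lam n)\<^sup>2"
        using H1 b_pos[of n] by (intro frac_le) auto
    qed
    ultimately show ?thesis by simp
  qed
  note K0 = this
  have *: "real n * (1 - H) \<le> K0 * (1 + lam n)\<^sup>2" for n
  proof -
    have "(1 + lam n)\<^sup>2 > 0" using lam_nonneg[of n] by (intro zero_less_power) linarith
    then show ?thesis using K0[of n] by (simp add: pos_divide_le_eq)
  qed
  have "real n \<le> (\<bar>K0\<bar> + 1) / (1 - H) * (1 + lam n)\<^sup>2" for n
  proof -
    have "K0 * (1 + lam n)\<^sup>2 \<le> (\<bar>K0\<bar> + 1) * (1 + lam n)\<^sup>2" by (intro mult_right_mono) auto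
    then show ?thesis using *[of n] H1 by (simp add: field_simps)
  qed
  then show ?thesis using H1 by (intro exI[of _ "(\<bar>K0\<bar> + 1) / (1 - H)"]) auto
qed

lemma lam_unbounded: "\<exists>N0. \<forall>N\<ge>N0. lam N > R"
proof -
  obtain K where K: "K > 0" "\<And>n. real n \<le> K * (1 + lam n)\<^sup>2" using lam_growth by auto
  obtain N0 where N0: "real N0 > K * (1 + \<bar>R\<bar>)\<^sup>2" using reals_Archimedean2 by blast
  have "lam N > R" if "N \<ge> N0" for N
  proof (rule ccontr)
    assume "\<not> lam N > R"
    then have "K * (1 + lam N)\<^sup>2 \<le> K * (1 + \<bar>R\<bar>)\<^sup>2"
      using lam_nonneg[of N] K by (intro mult_left_mono power_mono) auto
    then show False using K(2)[of N] N0 that by simp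
  qed
  then show ?thesis by blast
qed

lemma Dc_of_real: "Dc N (of_real l) (of_real m) = of_real (defect N (As l) (As m))"
proof -
  have "A (complex_of_real l * of_real s) = of_real (A (l * s))" for s by (metis A_of_real of_real_mult)
  then show ?thesis unfolding Dc_real_right by (simp add: complex_eq_iff defect_def ip_def)
qed

lemma Dc_holomorphic: "(\<lambda>l. Dc N l m) holomorphic_on S"
proof -
  have "(\<lambda>l. L l m) holomorphic_on S" for m using L_holomorphic holomorphic_on_subset by blast
  then show ?thesis unfolding Dc_def
    using nrm_pos by (intro holomorphic_intros) (auto simp: less_imp_neq[OF nrm_pos, symmetric])
qed

text \<open>Multiplying by \<open>R\<^sup>2 - l\<^sup>2\<close>, whose modulus on the circle \<open>|l| = R\<close> is \<open>2 R |Im l|\<close>, turns the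
  estimate of the quotient by \<open>1 / |Im l|\<close> into a uniform one.\<close>

lemma Dc_quotient_bound:
  fixes m :: real
  assumes m: "m < 0" and R: "R > 0" "\<bar>m\<bar> \<le> R" "R < lam N"
    and q: "q holomorphic_on ball 0 (lam N)" "\<And>l. l \<in> ball 0 (lam N) \<Longrightarrow> Dc N l (of_real m) = q l * E l"
    and l: "cmod l \<le> R / 2"
  shows "cmod (q l) \<le> 6 * ip (As m) (As m) / \<bar>E m\<bar>"
proof -
  define d0 where "d0 = ip (As m) (As m)"
  define dN where "dN = defect N (As m) (As m)"
  have dN: "0 \<le> dN" "dN \<le> d0" unfolding dN_def d0_def by (auto intro: defect_self_nonneg L2_A defect_le_ip)
  have Em: "\<bar>E m\<bar> > 0" using E_neg[OF m] by simp
  have Emc: "E (complex_of_real m) \<noteq> 0" using Em by (simp add: E_of_real)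
  have key: "cmod (q l * (of_real (R\<^sup>2) - l\<^sup>2)) \<le> 4 * R\<^sup>2 * d0 / \<bar>E m\<bar>" if lR: "cmod l = R" for l
  proof (cases "Im l = 0")
    \<comment> \<open>At the two real points of the circle the multiplier vanishes.\<close>
    case True
    then have "l = of_real (Re l)" "\<bar>Re l\<bar> = R" using lR by (auto simp: complex_eq_iff cmod_def)
    then have "l\<^sup>2 = of_real (R\<^sup>2)" by (metis of_real_power power2_abs)
    then show ?thesis using dN Em by simp
  next
    case False
    have lb: "l \<in> ball 0 (lam N)" using lR R by simp
    have El: "E l \<noteq> 0" using False E_zero_real by blast
    have lm: "l \<noteq> of_real m" using False by auto
    define S where "S = Re (Dc N l (cnj l))"
    have S: "Dc N l (cnj l) = of_real S" unfolding S_def Dc_cnj by simp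
    have "cnj l \<noteq> l" using False by (auto simp: complex_eq_iff)
    then have "of_real S * (l - cnj l) = E l * E (cnj l) * (h N l - h N (cnj l))"
      using Dc_eq_h[of l "cnj l" N] El S by (simp add: E_cnj)
    then have "of_real S * (l - cnj l) = of_real ((cmod (E l))\<^sup>2) * (h N l - cnj (h N l))"
      by (simp only: E_cnj h_cnj complex_norm_square)
    then have "Im (of_real S * (l - cnj l)) = Im (of_real ((cmod (E l))\<^sup>2) * (h N l - cnj (h N l)))" by simp
    \<comment> \<open>\<open>Dc_eq_h\<close> at the pair \<open>l\<close>, \<open>cnj l\<close>
      expresses the squared norm \<open>S\<close> through the imaginary part of
      \<open>h\<close>.\<close>
    then have SI: "S * Im l = (cmod (E l))\<^sup>2 * Im (h N l)" by simp
    have "q l * E l * (l - of_real m) = E l * E (of_real m) * (h N l - h N (of_real m))"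
      using Dc_eq_h[OF lm El Emc, of N] unfolding q(2)[OF lb] .
    then have "E l * (q l * (l - of_real m)) = E l * (of_real (E m) * (h N l - h N (of_real m)))"
      by (simp only: E_of_real mult_ac)
    then have qh: "q l * (l - of_real m) = of_real (E m) * (h N l - h N (of_real m))"
      using iffD1[OF mult_left_cancel[OF El]] by blast
    have "Im (h N (of_real m)) = 0" using h_cnj[of N "of_real m"] by (metis Reals_cnj_iff complex_is_Real_iff complex_cnj_complex_of_real)
    then have "\<bar>Im (h N l)\<bar> \<le> cmod (h N l - h N (of_real m))"
      using abs_Im_le_cmod[of "h N l - h N (of_real m)"] by simp
    then have "\<bar>E m\<bar> * \<bar>Im (h N l)\<bar> \<le> cmod (q l * (l - of_real m))"
      unfolding qh norm_mult using Em by simp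
    then have Ih: "\<bar>E m\<bar> * \<bar>Im (h N l)\<bar> \<le> cmod (q l) * cmod (l - of_real m)" by (simp add: norm_mult)
    \<comment> \<open>Cauchy-Schwarz bounds |q|^2 in terms of \<open>S\<close>, \<open>SI\<close>
      trades \<open>S\<close> for Im h, and \<open>Ih\<close> bounds Im h by |q| again. Cancelling
      one factor |q| leaves the bound by 1/|Im l|.\<close>
    have "(cmod (q l))\<^sup>2 * (cmod (E l))\<^sup>2 \<le> S * dN"
      using Dc_Cauchy_Schwarz[of N l m] unfolding S_def dN_def q(2)[OF lb] by (simp add: norm_mult power_mult_distrib)
    then have "(cmod (q l))\<^sup>2 * (cmod (E l))\<^sup>2 * \<bar>Im l\<bar> \<le> S * dN * \<bar>Im l\<bar>" by (intro mult_right_mono) auto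
    also have "\<dots> \<le> \<bar>S * Im l\<bar> * dN"
    proof -
      have "S * (dN * \<bar>Im l\<bar>) \<le> \<bar>S\<bar> * (dN * \<bar>Im l\<bar>)" using dN by (intro mult_right_mono) auto
      then show ?thesis by (simp add: abs_mult mult_ac)
    qed
    also have "\<dots> = (cmod (E l))\<^sup>2 * (\<bar>Im (h N l)\<bar> * dN)" unfolding SI by (simp add: abs_mult)
    finally have "(cmod (E l))\<^sup>2 * ((cmod (q l))\<^sup>2 * \<bar>Im l\<bar>) \<le> (cmod (E l))\<^sup>2 * (\<bar>Im (h N l)\<bar> * dN)"
      by (simp add: mult_ac)
    then have "(cmod (q l))\<^sup>2 * \<bar>Im l\<bar> \<le> \<bar>Im (h N l)\<bar> * dN"
      using El by (simp add: mult_le_cancel_left)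
    then have "\<bar>E m\<bar> * ((cmod (q l))\<^sup>2 * \<bar>Im l\<bar>) \<le> \<bar>E m\<bar> * (\<bar>Im (h N l)\<bar> * dN)"
      by (intro mult_left_mono) auto
    also have "\<dots> \<le> cmod (q l) * cmod (l - of_real m) * dN"
      using mult_right_mono[OF Ih dN(1)] by (simp add: mult_ac)
    finally have "cmod (q l) * (cmod (q l) * \<bar>Im l\<bar> * \<bar>E m\<bar>) \<le> cmod (q l) * (cmod (l - of_real m) * dN)"
      by (simp add: power2_eq_square mult_ac)
    then have qI: "cmod (q l) * \<bar>Im l\<bar> * \<bar>E m\<bar> \<le> cmod (l - of_real m) * dN"
      using dN by (cases "q l = 0") (auto simp: mult_le_cancel_left)
    have "cmod (l - of_real m) \<le> 2 * R" using norm_triangle_ineq4[of l "of_real m"] lR R by simp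
    then have "cmod (l - of_real m) * dN \<le> 2 * R * d0" using dN R by (intro mult_mono) auto
    then have qI2: "cmod (q l) * \<bar>Im l\<bar> \<le> 2 * R * d0 / \<bar>E m\<bar>" using qI Em by (simp add: field_simps)
    have "of_real (R\<^sup>2) - l\<^sup>2 = l * (cnj l - l)"
      using lR complex_norm_square[of l] by (simp add: algebra_simps power2_eq_square)
    also have "cmod \<dots> = R * (2 * \<bar>Im l\<bar>)" unfolding norm_mult lR
      by (simp add: cmod_def real_sqrt_mult)
    finally have "cmod (q l * (of_real (R\<^sup>2) - l\<^sup>2)) = 2 * R * (cmod (q l) * \<bar>Im l\<bar>)" by (simp add: norm_mult)
    also have "\<dots> \<le> 2 * R * (2 * R * d0 / \<bar>E m\<bar>)" using qI2 R by (intro mult_left_mono) auto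
    finally show ?thesis by (simp add: power2_eq_square)
  qed
  have sub: "cball 0 R \<subseteq> ball 0 (lam N)" using R by auto
  have hol: "(\<lambda>l. q l * (of_real (R\<^sup>2) - l\<^sup>2)) holomorphic_on ball 0 (lam N)"
    using q(1) by (intro holomorphic_intros)
  have "cmod (q l * (of_real (R\<^sup>2) - l\<^sup>2)) \<le> 4 * R\<^sup>2 * d0 / \<bar>E m\<bar>"
  proof (rule maximum_modulus_frontier[of "\<lambda>l. q l * (of_real (R\<^sup>2) - l\<^sup>2)" "cball 0 R"])
    show "(\<lambda>l. q l * (of_real (R\<^sup>2) - l\<^sup>2)) holomorphic_on interior (cball 0 R)"
      using hol sub holomorphic_on_subset interior_subset by (metis (no_types, lifting) order_trans)
    show "continuous_on (closure (cball 0 R)) (\<lambda>l. q l * (of_real (R\<^sup>2) - l\<^sup>2))"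
      using holomorphic_on_imp_continuous_on[OF hol] sub continuous_on_subset by (metis closed_cball closure_closed)
  qed (use l R key in auto)
  moreover have "3/4 * R\<^sup>2 \<le> cmod (of_real (R\<^sup>2) - l\<^sup>2)"
  proof -
    have "(cmod l)\<^sup>2 \<le> (R/2)\<^sup>2" using l by (intro power_mono) auto
    moreover have "R\<^sup>2 - (cmod l)\<^sup>2 \<le> cmod (of_real (R\<^sup>2) - l\<^sup>2)"
      using norm_triangle_ineq2[of "of_real (R\<^sup>2) :: complex" "l\<^sup>2"] by (simp add: norm_power)
    ultimately show ?thesis by (simp add: power_divide)
  qed
  then have "cmod (q l) * (3/4 * R\<^sup>2) \<le> cmod (q l * (of_real (R\<^sup>2) - l\<^sup>2))"
    unfolding norm_mult by (intro mult_left_mono) auto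
  ultimately have "cmod (q l) * (3/4 * R\<^sup>2) \<le> 4 * R\<^sup>2 * d0 / \<bar>E m\<bar>" by linarith
  \<comment> \<open>4 is at most 6 * 3/4.\<close>
  also have "\<dots> \<le> (6 * d0 / \<bar>E m\<bar>) * (3/4 * R\<^sup>2)" using R Em dN by (simp add: field_simps)
  finally show ?thesis using R unfolding d0_def by (simp only: mult_le_cancel_right) auto
qed

text \<open>At \<open>m\<close> and at \<open>l\<close> the quotient \<open>q\<close> of
  \<open>Dc\<close> by \<open>E\<close> equals \<open>dN / E m\<close> and \<open>dl / E l\<close>.
  Cauchy's estimate lets \<open>q\<close> change by O((m - l)/R) between them, and at the far point
  Lommel's formula makes it small. The bound tends to 0 if first \<open>m - l\<close> and then
  \<open>R\<close> grows. The 24 is the 6 of \<open>Dc_quotient_bound\<close> times the 4 of the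
  radius R/4.\<close>

lemma defect_bound:
  fixes m l :: real
  assumes m: "m < 0" and l: "l < m" "\<bar>l\<bar> \<le> R / 4" and R: "R < lam N"
  shows "defect N (As m) (As m) / (E m)\<^sup>2
     \<le> (- A m / E m) / (m - l) + 24 * ip (As m) (As m) / (E m)\<^sup>2 * (m - l) / R"
proof -
  define d0 where "d0 = ip (As m) (As m)"
  define dN where "dN = defect N (As m) (As m)"
  define dl where "dl = defect N (As l) (As m)"
  have R0: "R > 0" "\<bar>m\<bar> \<le> R / 4" using m l by auto
  have Em: "E m < 0" and El: "E l < 0" using E_neg m l by auto
  have "\<exists>q. q holomorphic_on ball 0 (lam N) \<and> (\<forall>z\<in>ball 0 (lam N). Dc N z (of_real m) = q z * E z)"
  proof (rule holomorphic_quotient_simple_zeros[of "\<lambda>l. Dc N l (of_real m)" "ball 0 (lam N)" E])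
    show "E holomorphic_on ball 0 (lam N)"
      using E_deriv by (auto simp: holomorphic_on_open)
    fix z :: complex assume z: "z \<in> ball 0 (lam N)" "E z = 0"
    then obtain n where n: "z = of_real (lam n)" using E_zero_iff by blast
    then have "n < N" using z lam_nonneg[of n] lam_mono by (auto simp: strict_mono_less)
    then show "Dc N z (of_real m) = 0 \<and> deriv E z \<noteq> 0" unfolding n using Dc_lam E_deriv_lam by auto
  next
    fix q assume "q holomorphic_on ball 0 (lam N)" "\<And>z. z \<in> ball 0 (lam N) \<Longrightarrow> Dc N z (of_real m) = q z * E z"
    then show ?thesis by blast
  qed (auto intro: Dc_holomorphic)
  then obtain q where q: "q holomorphic_on ball 0 (lam N)" "\<And>z. z \<in> ball 0 (lam N) \<Longrightarrow> Dc N z (of_real m) = q z * E z"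
    by blast
  define B where "B = 6 * d0 / \<bar>E m\<bar>"
  have B: "cmod (q z) \<le> B" if "cmod z \<le> R / 2" for z
    unfolding B_def d0_def using R0 R by (intro Dc_quotient_bound[OF m _ _ R q that]) auto
  have "cmod (q (of_real l) - q (of_real m)) \<le> B / (R / 4) * cmod (of_real l - of_real m)"
  proof (rule field_differentiable_bound[where S = "cball 0 (R / 4)" and f' = "deriv q"])
    fix z :: complex assume z: "z \<in> cball 0 (R / 4)"
    then have "z \<in> ball 0 (lam N)" using R R0 by auto
    then show "(q has_field_derivative deriv q z) (at z within cball 0 (R / 4))"
      using q(1) holomorphic_derivI has_field_derivative_at_within by blast
    have sub: "cball z (R / 4) \<subseteq> cball 0 (R / 2)"
    proof
      fix w assume "w \<in> cball z (R / 4)"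
      then show "w \<in> cball 0 (R / 2)" using z norm_triangle_ineq[of "w - z" z]
        by (auto simp: dist_norm norm_minus_commute)
    qed
    then have sub2: "cball z (R / 4) \<subseteq> ball 0 (lam N)" using R R0 by fastforce
    have "cmod ((deriv ^^ 1) q z) \<le> fact 1 * B / (R / 4) ^ 1"
    proof (rule Cauchy_inequality)
      show "q holomorphic_on ball z (R / 4)" using q(1) sub2 holomorphic_on_subset ball_subset_cball by (metis order_trans)
      show "continuous_on (cball z (R / 4)) q"
        using holomorphic_on_imp_continuous_on[OF q(1)] sub2 continuous_on_subset by blast
      fix x assume "cmod (z - x) = R / 4"
      then have "x \<in> cball z (R / 4)" by (simp add: dist_norm)
      then show "cmod (q x) \<le> B" using sub B by auto
    qed (use R0 in auto)
    then show "cmod (deriv q z) \<le> B / (R / 4)" by simp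
  qed (use l R0 in auto)
  moreover have "cmod (of_real l - of_real m) = m - l" using l by (simp flip: of_real_diff)
  ultimately have qq: "cmod (q (of_real l) - q (of_real m)) \<le> B / (R / 4) * (m - l)" by simp
  have "q (of_real l) = of_real (dl / E l)" "q (of_real m) = of_real (dN / E m)"
    using q(2)[of "of_real l"] q(2)[of "of_real m"] R R0 l El Em unfolding Dc_of_real dl_def dN_def
    by (auto simp: E_of_real field_simps)
  then have "cmod (q (of_real l) - q (of_real m)) = \<bar>dl / E l - dN / E m\<bar>"
    by (simp only: of_real_diff[symmetric] norm_of_real)
  then have "dl / E l - dN / E m \<le> B / (R / 4) * (m - l)" using qq by linarith
  then have "(dl / E l - dN / E m) / (- E m) \<le> (B / (R / 4) * (m - l)) / (- E m)"
    using Em by (intro divide_right_mono) auto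
  moreover have "(dl / E l - dN / E m) / (- E m) = dN / (E m)\<^sup>2 - dl / (E l * E m)"
    using Em El by (simp add: field_simps power2_eq_square)
  moreover have "(B / (R / 4) * (m - l)) / (- E m) = 24 * d0 / (E m)\<^sup>2 * (m - l) / R"
    using Em unfolding B_def by (simp add: power2_eq_square)
  moreover have "dl / (E l * E m) \<le> (- A m / E m) / (m - l)"
  proof -
    have EE: "E l * E m > 0" using El Em by (simp add: mult_neg_neg)
    \<comment> \<open>For negative \<open>l\<close> and \<open>m\<close> every projection term is
      nonnegative and may be dropped.\<close>
    have "dl \<le> ip (As l) (As m)"
    proof -
      have "0 \<le> ip (As l) (\<phi> n) * ip (As m) (\<phi> n) / ip (\<phi> n) (\<phi> n)" for n
      proof -
        have lm: "l < 0" "(l - lam n) * (m - lam n) > 0"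
          using l m lam_nonneg[of n] by (auto intro: mult_neg_neg)
        have "ip (As l) (\<phi> n) * ip (As m) (\<phi> n)
          = (E l * E m) * (A (lam n))\<^sup>2 / ((l - lam n) * (m - lam n))"
          unfolding ip_A_phi[OF m] ip_A_phi[OF lm(1)] by (simp add: power2_eq_square)
        also have "\<dots> \<ge> 0" using EE lm(2) by simp
        finally show ?thesis using nrm_pos[of n] by (simp add: nrm_def)
      qed
      then show ?thesis unfolding dl_def defect_def by (simp add: sum_nonneg)
    qed
    also have "\<dots> = (E l * A m - E m * A l) / (l - m)" using ip_A[of l m] l by (simp add: field_simps)
    finally have "dl / (E l * E m) \<le> (E l * A m - E m * A l) / (l - m) / (E l * E m)"
      using EE by (intro divide_right_mono) auto
    also have "\<dots> = (A l / E l - A m / E m) / (m - l)" using El Em l by (simp add: field_simps)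
    also have "\<dots> \<le> (- A m / E m) / (m - l)"
      using l m A_pos[of l] El by (intro divide_right_mono) (auto simp: divide_nonneg_neg)
    finally show ?thesis .
  qed
  ultimately show ?thesis unfolding d0_def[symmetric] dN_def[symmetric] by linarith
qed

lemma expandable_A: "m < 0 \<Longrightarrow> expandable (As m)"
proof -
  assume m: "m < 0"
  define d0 where "d0 = ip (As m) (As m)"
  define c where "c = - A m / E m"
  define c' where "c' = 24 * d0 / (E m)\<^sup>2"
  have Em: "E m < 0" using E_neg[OF m] .
  have c: "c > 0" unfolding c_def using A_pos[of m] m Em by (simp add: divide_pos_neg)
  have c': "c' \<ge> 0" unfolding c'_def d0_def using ip_self_nonneg by simp
  have "(\<lambda>N. defect N (As m) (As m) / (E m)\<^sup>2) \<longlonglongrightarrow> 0"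
  proof (rule LIMSEQ_I)
    fix r :: real assume r: "r > 0"
    \<comment> \<open>The comparison point is \<open>m - t\<close>. Its distance \<open>t\<close> is
      fixed first, and then \<open>R\<close> is chosen large in terms of \<open>t\<close>.\<close>
    define t where "t = 2 * c / r + 1"
    have t: "t > 0" "c / t < r / 2" using c r by (auto simp: t_def field_simps intro: add_pos_pos)
    define u where "u = 4 * c' * t / r"
    define v where "v = \<bar>m - t\<bar>"
    have v: "v \<ge> 0" unfolding v_def by (rule abs_ge_zero)
    define R where "R = 4 * v + u + 1"
    have ct: "u \<ge> 0" unfolding u_def using c' t r by simp
    have R: "R > 0" unfolding R_def using ct v by (intro add_nonneg_pos add_nonneg_nonneg) auto
    have R4: "v \<le> R / 4" unfolding R_def using ct by (simp add: field_simps)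
    have "c' * t * 4 \<le> R * r"
    proof -
      have "u \<le> R" unfolding R_def using v by simp
      then show ?thesis using r unfolding u_def by (simp add: field_simps)
    qed
    moreover have "0 < R * r" using R r by simp
    ultimately have "c' * t < R * r / 2" by linarith
    then have cR: "c' * t / R < r / 2" using R by (simp add: pos_divide_less_eq mult_ac)
    obtain N0 where N0: "\<And>N. N \<ge> N0 \<Longrightarrow> lam N > R" using lam_unbounded by blast
    have "norm (defect N (As m) (As m) / (E m)\<^sup>2 - 0) < r" if "N \<ge> N0" for N
    proof -
      have "defect N (As m) (As m) / (E m)\<^sup>2 \<le> c / t + c' * t / R"
        using defect_bound[OF m, of "m - t" R N] t R4[unfolded v_def] N0[OF that] by (simp add: c_def c'_def d0_def)
      also have "\<dots> < r / 2 + r / 2" using t(2) cR by (intro add_strict_mono)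
      finally have "defect N (As m) (As m) / (E m)\<^sup>2 < r" by simp
      moreover have "defect N (As m) (As m) \<ge> 0" by (intro defect_self_nonneg L2_A)
      ultimately show ?thesis by (simp add: abs_of_nonneg)
    qed
    then show "\<exists>no. \<forall>n\<ge>no. norm (defect n (As m) (As m) / (E m)\<^sup>2 - 0) < r" by blast
  qed
  then have "(\<lambda>N. (E m)\<^sup>2 * (defect N (As m) (As m) / (E m)\<^sup>2)) \<longlonglongrightarrow> (E m)\<^sup>2 * 0"
    by (intro tendsto_intros)
  then show ?thesis using Em by (simp add: expandable_def L2_A)
qed

end

section \<open>Sonine's integral and Parseval's identity\<close>

text \<open>The truncated power of Riemann-Liouville fractional integration, without the Gamma
  factor.\<close>

definition beta_kernel :: "real \<Rightarrow> real \<Rightarrow> real \<Rightarrow> real" where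
  "beta_kernel b v s = (if s < v then (v - s) powr (b - 1) else 0)"

lemma beta_kernel_measurable [measurable]: "beta_kernel b v \<in> borel_measurable borel"
  unfolding beta_kernel_def[abs_def] by measurable

lemma beta_kernel_nonneg: "beta_kernel b v s \<ge> 0"
  by (simp add: beta_kernel_def)

lemma has_integral_Beta_scaled:
  fixes a b v :: real
  assumes "a > 0" "b > 0" "v > 0"
  shows "((\<lambda>x. x powr (a - 1) * (v - x) powr (b - 1)) has_integral (v powr (a + b - 1) * Beta a b)) {0..v}"
proof -
  have "((\<lambda>x. (1 / v * x) powr (a - 1) * (1 - 1 / v * x) powr (b - 1)) has_integral Beta a b /\<^sub>R (1 / v)) {0..v}"
    using has_integral_affinity'[of "\<lambda>t. t powr (a - 1) * (1 - t) powr (b - 1)" "Beta a b" 0 1 "1 / v" 0]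
      has_integral_Beta_real[OF assms(1,2)] assms(3) by simp
  then have "((\<lambda>x. v powr (a + b - 2) * ((1 / v * x) powr (a - 1) * (1 - 1 / v * x) powr (b - 1)))
      has_integral (v powr (a + b - 2) * (Beta a b /\<^sub>R (1 / v)))) {0..v}"
    by (rule has_integral_mult_right)
  moreover have "v powr (a + b - 2) * (Beta a b /\<^sub>R (1 / v)) = v powr (a + b - 1) * Beta a b"
  proof -
    have "v powr (a + b - 1) = v powr (a + b - 2) * v"
      using assms(3) powr_add[of v "a + b - 2" 1] by simp
    then show ?thesis using assms(3) by simp
  qed
  moreover have "v powr (a + b - 2) * ((1 / v * x) powr (a - 1) * (1 - 1 / v * x) powr (b - 1))
     = x powr (a - 1) * (v - x) powr (b - 1)" if "x \<in> {0..v}" for x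
  proof -
    have "v powr (a + b - 2) = v powr (a - 1) * v powr (b - 1)"
      by (simp flip: powr_add)
    moreover have "v powr (a - 1) * (1 / v * x) powr (a - 1) = x powr (a - 1)"
      using that assms(3) by (simp flip: powr_mult)
    moreover have "v powr (b - 1) * (1 - 1 / v * x) powr (b - 1) = (v - x) powr (b - 1)"
    proof -
      have "1 - 1 / v * x \<ge> 0" using that assms(3) by simp
      moreover have "v * (1 - 1 / v * x) = v - x" using assms(3) by (simp add: right_diff_distrib)
      ultimately show ?thesis using assms(3) powr_mult[of v "1 - 1 / v * x" "b - 1"] by simp
    qed
    ultimately show ?thesis by (simp add: mult_ac)
  qed
  ultimately show ?thesis using has_integral_cong[of "{0..v}"] by (metis (no_types, lifting))
qed

section \<open>Beta integrals and the power series of A\<close>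

context hurst
begin

lemma jac_beta_kernel:
  assumes b: "b > 0" and v: "0 < v" "v \<le> 1"
  shows "integrable (jac H) (\<lambda>s. s ^ k * beta_kernel b v s)" (is ?A)
    and "integral\<^sup>L (jac H) (\<lambda>s. s ^ k * beta_kernel b v s) = v powr (real k - H + b) * Beta (real k + 1 - H) b" (is ?B)
proof -
  let ?f = "\<lambda>s. s powr (- H) * (s ^ k * beta_kernel b v s)"
  let ?I = "v powr (real k - H + b) * Beta (real k + 1 - H) b"
  have "((\<lambda>x. x powr ((real k + 1 - H) - 1) * (v - x) powr (b - 1)) has_integral v powr ((real k + 1 - H) + b - 1) * Beta (real k + 1 - H) b) {0..v}"
    using H1 b v by (intro has_integral_Beta_scaled) auto
  then have "((\<lambda>x. x powr (real k - H) * (v - x) powr (b - 1)) has_integral ?I) {0..v}"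
    by (simp add: algebra_simps)
  moreover have "x powr (real k - H) * (v - x) powr (b - 1) = ?f x" if "x \<in> {0..v}" for x
  proof (cases "x = 0 \<or> x = v")
    \<comment> \<open>At the endpoints both sides are 0, because \<open>0 powr a = 0\<close> for
      every \<open>a\<close>.\<close>
    case True then show ?thesis using v by (auto simp: beta_kernel_def)
  next
    case False
    then have "0 < x" "x < v" using that by auto
    then show ?thesis using powr_add[of x "- H" "real k"] by (simp add: beta_kernel_def powr_realpow add.commute)
  qed
  ultimately have "(?f has_integral ?I) {0..v}"
    using has_integral_cong[of "{0..v}" "\<lambda>x. x powr (real k - H) * (v - x) powr (b - 1)" ?f] by blast
  moreover have "(?f has_integral 0) {v..1}"
    by (rule has_integral_is_0) (auto simp: beta_kernel_def)
  ultimately have I: "(?f has_integral ?I) {0..1}"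
    using has_integral_combine[of 0 v 1 ?f ?I 0] v by simp
  have S: "set_integrable lborel {0..1} ?f"
    by (rule set_integrable_lborel_of_nonneg) (use I in \<open>auto simp: beta_kernel_nonneg\<close>)
  then show ?A by (subst jac_integrable_iff) auto
  show ?B using set_borel_integral_eq_integral(2)[OF S] integral_unique[OF I]
    by (subst jac_integral) auto
qed

lemma jac_integral_const: "integral\<^sup>L (jac H) (\<lambda>_. c :: real) = c / (1 - H)"
proof -
  have "integrable (jac H) (\<lambda>_. c)" by (rule jac_integrable_continuous) auto
  then have S: "set_integrable lborel {0..1} (\<lambda>s. s powr (- H) *\<^sub>R c)"
    by (subst (asm) jac_integrable_iff) auto
  have "integral\<^sup>L (jac H) (\<lambda>_. c) = integral {0..1} (\<lambda>s. s powr (- H) * c)"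
    using set_borel_integral_eq_integral(2)[OF S] by (subst jac_integral) auto
  also have "\<dots> = c / (1 - H)"
    using integral_unique[OF powr_integral] by simp
  finally show ?thesis .
qed

definition A_coeff :: "nat \<Rightarrow> real" where "A_coeff k = rGamma (real k + (1 - H)) / fact k"

lemma A_coeff_pos: "A_coeff k > 0"
  using rGamma_real_pos[of "real k + (1 - H)"] H1 by (simp add: A_coeff_def)

lemma A_sums: "(\<lambda>k. A_coeff k * (- x) ^ k) sums (A x :: real)"
  using clifford_sums[of "1 - H" x] by (simp add: A_coeff_def A_def)

lemma summable_A_coeff: "summable (\<lambda>k. A_coeff k * x ^ k)"
  using sums_summable[OF A_sums[of "- x"]] by simp

end

section \<open>From A(m s) with m < 0 to the fractional kernels\<close>

context bessel_zeros
begin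

text \<open>The measure \<open>jac H\<close> has the finite mass 1/(1-H), so uniform closeness
  implies closeness in L2.\<close>

lemma expandable_uniform_limit:
  assumes f: "L2 f" and approx: "\<And>e. e > 0 \<Longrightarrow> \<exists>g. expandable g \<and> (\<forall>s\<in>{0<..<1}. \<bar>f s - g s\<bar> \<le> e)"
  shows "expandable f"
proof (rule expandable_limit[OF f])
  fix e :: real assume e: "e > 0"
  define d where "d = sqrt (e * (1 - H) / 2)"
  have d: "d > 0" "d\<^sup>2 = e * (1 - H) / 2" using e H1 by (auto simp: d_def)
  obtain g where g: "expandable g" "\<And>s. s \<in> {0<..<1} \<Longrightarrow> \<bar>f s - g s\<bar> \<le> d" using approx[OF d(1)] by blast
  have "ip (\<lambda>s. f s - g s) (\<lambda>s. f s - g s) \<le> integral\<^sup>L (jac H) (\<lambda>_. d\<^sup>2)"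
    unfolding ip_def
  proof (rule integral_mono_AE)
    show "integrable (jac H) (\<lambda>s. (f s - g s) * (f s - g s))"
      using f g by (intro L2_mult L2_diff) (auto simp: expandable_def)
    show "integrable (jac H) (\<lambda>_. d\<^sup>2)" by (intro jac_integrable_continuous) auto
    show "AE s in jac H. (f s - g s) * (f s - g s) \<le> d\<^sup>2"
      using AE_jac
    proof eventually_elim
      case (elim s)
      then have "\<bar>f s - g s\<bar>\<^sup>2 \<le> d\<^sup>2" using g(2) by (intro power_mono) auto
      then show ?case by (simp add: power2_eq_square)
    qed
  qed
  also have "\<dots> = e / 2" unfolding jac_integral_const d(2) using H1 by (simp add: field_simps)
  also have "\<dots> < e" using e by simp
  finally show "\<exists>g. expandable g \<and> ip (\<lambda>s. f s - g s) (\<lambda>s. f s - g s) < e" using g by blast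
qed

lemma L2_continuous: "continuous_on {0..1} f \<Longrightarrow> f \<in> borel_measurable borel \<Longrightarrow> L2 f"
  unfolding L2_def by (intro conjI jac_integrable_continuous continuous_intros) auto

text \<open>The monomials are limits of divided differences of \<open>t \<mapsto> A (- t s)\<close> at \<open>t = 0\<close>.\<close>

lemma expandable_power: "expandable (\<lambda>s. s ^ k)"
proof (induction k rule: less_induct)
  case (less k)
  show ?case
  proof (rule expandable_uniform_limit)
    show "L2 (\<lambda>s. s ^ k)" by (intro L2_continuous continuous_intros) measurable
    fix e :: real assume e: "e > 0"
    \<comment> \<open>\<open>B\<close> compares all coefficients with the one of degree
      \<open>k\<close>: the terms of degree above \<open>k\<close>, divided by
      \<open>t ^ k * A_coeff k\<close>, amount to at most \<open>t * B\<close> once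
      \<open>t \<le> 1\<close>. Those of degree below \<open>k\<close> are subtracted in
      \<open>g\<close> by the induction hypothesis.\<close>
    define B where "B = (\<Sum>j. A_coeff j) / A_coeff k"
    have sc: "summable A_coeff" using summable_A_coeff[of 1] by simp
    have B: "B > 0" unfolding B_def using A_coeff_pos sc by (intro divide_pos_pos suminf_pos) auto
    define t where "t = min 1 (e / B)"
    have t: "t > 0" "t \<le> 1" "t * B \<le> e" using e B by (auto simp: t_def min_def field_simps)
    define g where "g s = 1 / (t ^ k * A_coeff k) * (A (- t * s) + (\<Sum>j<k. (- (A_coeff j * t ^ j)) * s ^ j))" for s
    have "expandable g"
      unfolding g_def using less t by (intro expandable_scale expandable_add expandable_sum expandable_A) auto
    moreover have "\<bar>s ^ k - g s\<bar> \<le> e" if s: "s \<in> {0<..<1}" for s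
    proof -
      let ?a = "\<lambda>j. A_coeff j * (t * s) ^ j"
      have "?a sums A (- t * s)" using A_sums[of "- t * s"] by simp
      then have A: "A (- t * s) = (\<Sum>j. ?a (j + Suc k)) + (\<Sum>j<Suc k. ?a j)"
        using suminf_split_initial_segment[of ?a "Suc k"] by (auto simp: sums_iff)
      define r where "r = (\<Sum>j. ?a (j + Suc k))"
      have "A (- t * s) + (\<Sum>j<k. (- (A_coeff j * t ^ j)) * s ^ j) = r + A_coeff k * t ^ k * s ^ k"
        unfolding A r_def[symmetric] by (simp add: sum_negf power_mult_distrib mult.assoc)
      then have "g s = r / (t ^ k * A_coeff k) + s ^ k"
        unfolding g_def using t A_coeff_pos[of k] by (simp add: field_simps)
      then have *: "\<bar>s ^ k - g s\<bar> = \<bar>r\<bar> / (t ^ k * A_coeff k)"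
        using t A_coeff_pos[of k] by (simp add: abs_mult)
      have sum_a: "summable (\<lambda>j. ?a (j + Suc k))"
        using summable_A_coeff[of "t * s"] by (rule summable_ignore_initial_segment)
      have r0: "0 \<le> r" unfolding r_def using s t A_coeff_pos by (intro suminf_nonneg[OF sum_a] mult_nonneg_nonneg less_imp_le[OF A_coeff_pos]) auto
      have "r \<le> (\<Sum>j. t ^ Suc k * A_coeff (j + Suc k))"
        unfolding r_def
      proof (rule suminf_le[OF _ sum_a])
        show "summable (\<lambda>j. t ^ Suc k * A_coeff (j + Suc k))"
          by (intro summable_mult summable_ignore_initial_segment sc)
        fix j
        have "(t * s) ^ (j + Suc k) \<le> (t * 1) ^ (j + Suc k)" using s t by (intro power_mono mult_left_mono) auto
        also have "\<dots> = t ^ j * t ^ Suc k" by (simp add: power_add)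
        also have "\<dots> \<le> 1 * t ^ Suc k" using t by (intro mult_right_mono power_le_one) auto
        finally show "?a (j + Suc k) \<le> t ^ Suc k * A_coeff (j + Suc k)"
          using A_coeff_pos[of "j + Suc k"] by (simp add: mult.commute)
      qed
      also have "\<dots> = t ^ Suc k * (\<Sum>j. A_coeff (j + Suc k))"
        by (intro suminf_mult summable_ignore_initial_segment sc)
      also have "\<dots> \<le> t ^ Suc k * (\<Sum>j. A_coeff j)"
        using t suminf_split_initial_segment[OF sc, of "Suc k"] sum_nonneg[of "{..<Suc k}" A_coeff] A_coeff_pos
        by (intro mult_left_mono) (auto simp: less_imp_le)
      finally have "\<bar>r\<bar> \<le> t ^ Suc k * (\<Sum>j. A_coeff j)" using r0 by simp
      then have "\<bar>s ^ k - g s\<bar> \<le> t ^ Suc k * (\<Sum>j. A_coeff j) / (t ^ k * A_coeff k)"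
        unfolding * using t A_coeff_pos[of k] by (intro divide_right_mono) auto
      also have "\<dots> = t * B" unfolding B_def using t by simp
      finally show ?thesis using t by simp
    qed
    ultimately show "\<exists>g. expandable g \<and> (\<forall>s\<in>{0<..<1}. \<bar>s ^ k - g s\<bar> \<le> e)" by blast
  qed
qed

lemma expandable_continuous:
  assumes "continuous_on {0..1} f" "f \<in> borel_measurable borel"
  shows "expandable f"
proof (rule expandable_uniform_limit)
  show "L2 f" using assms by (rule L2_continuous)
  fix e :: real assume "e > 0"
  then obtain g where g: "real_polynomial_function g" "\<And>x. x \<in> {0..1} \<Longrightarrow> \<bar>f x - g x\<bar> < e"
    using Stone_Weierstrass_real_polynomial_function[OF _ assms(1)] by (metis compact_Icc)
  then obtain a n where "g = (\<lambda>x. \<Sum>i\<le>n. a i * x ^ i)" unfolding real_polynomial_function_iff_sum by blast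
  then have "expandable g" by (simp only:) (intro expandable_sum expandable_scale expandable_power)
  then show "\<exists>g. expandable g \<and> (\<forall>s\<in>{0<..<1}. \<bar>f s - g s\<bar> \<le> e)"
    using g(2) by (intro exI[of _ g]) (auto intro!: less_imp_le)
qed

abbreviation K :: "real \<Rightarrow> real \<Rightarrow> real" where "K u \<equiv> beta_kernel (H + 1 / 2) (u\<^sup>2)"

text \<open>The exponent 2H - 1 exceeds -1, so \<open>K u\<close> is square integrable for every H
  in (0,1), even where it is unbounded.\<close>

lemma K_square: "(K u s)\<^sup>2 = beta_kernel (2 * H) (u\<^sup>2) s"
proof (cases "s < u\<^sup>2")
  case True
  have "((u\<^sup>2 - s) powr (H + 1 / 2 - 1))\<^sup>2 = (u\<^sup>2 - s) powr ((H + 1 / 2 - 1) * 2)"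
    using True by (simp add: powr_powr flip: powr_numeral)
  then show ?thesis using True by (simp add: beta_kernel_def algebra_simps)
qed (simp add: beta_kernel_def)

lemma sq_unit: assumes "0 < u" "u \<le> 1" shows "0 < u\<^sup>2" "u\<^sup>2 \<le> (1::real)"
  using assms by (auto simp: power_le_one)

lemma L2_K:
  assumes u: "0 < u" "u \<le> 1"
  shows "L2 (K u)"
  unfolding L2_def K_square using jac_beta_kernel(1)[of "2 * H" "u\<^sup>2" 0] H0 sq_unit[OF u] by simp

lemma ip_K_K:
  assumes u: "0 < u" "u \<le> 1"
  shows "ip (K u) (K u) = u powr (2 * H) * Beta (1 - H) (2 * H)"
proof -
  have "ip (K u) (K u) = integral\<^sup>L (jac H) (\<lambda>s. s ^ 0 * beta_kernel (2 * H) (u\<^sup>2) s)"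
    unfolding ip_def power2_eq_square[symmetric, of "K u _"] K_square by simp
  also have "\<dots> = (u\<^sup>2) powr (real 0 - H + 2 * H) * Beta (real 0 + 1 - H) (2 * H)"
    using H0 sq_unit[OF u] by (intro jac_beta_kernel(2)) auto
  also have "(u\<^sup>2) powr (real 0 - H + 2 * H) = u powr (2 * H)"
    using u by (simp add: powr_powr flip: powr_numeral)
  finally show ?thesis by simp
qed

text \<open>For \<open>H < 1/2\<close> the kernel \<open>K u\<close> has a pole at \<open>u\<^sup>2\<close>; with \<open>x = (u\<^sup>2 - s)\<^sub>+\<close> the approximants
  \<open>x powr (H + 1/2) / (x + \<epsilon>)\<close> are continuous.\<close>

lemma expandable_K:
  assumes u: "0 < u" "u \<le> 1"
  shows "expandable (K u)"
proof (rule expandable_limit[OF L2_K[OF u]])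
  define g where "g n s = (max 0 (u\<^sup>2 - s)) powr (H + 1 / 2) / (max 0 (u\<^sup>2 - s) + 1 / real (Suc n))" for n s
  have den: "max 0 (u\<^sup>2 - s) + 1 / real (Suc n) > 0" for n s by (intro add_nonneg_pos) auto
  have gm [measurable]: "g n \<in> borel_measurable borel" for n unfolding g_def[abs_def] by measurable
  have g: "expandable (g n)" for n
  proof (rule expandable_continuous)
    show "continuous_on {0..1} (g n)" unfolding g_def
    proof (intro continuous_on_divide ballI)
      show "continuous_on {0..1} (\<lambda>s. (max 0 (u\<^sup>2 - s)) powr (H + 1 / 2))"
        using H0 by (intro continuous_on_powr' continuous_intros) auto
      show "max 0 (u\<^sup>2 - s) + 1 / real (Suc n) \<noteq> 0" for s using den[of s n] by simp
    qed (intro continuous_intros)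
  qed measurable
  \<comment> \<open>With x = (u^2 - s)_+ and \<epsilon> = 1/(n+1) the error is \<open>K u s\<close>
    times \<epsilon>/(x + \<epsilon>). This factor lies in [0,1] and tends to 0 for x > 0, so the
    square of \<open>K u\<close> is a dominating function.\<close>
  have diff: "K u s - g n s = K u s * ((1 / real (Suc n)) / (max 0 (u\<^sup>2 - s) + 1 / real (Suc n)))" for n s
  proof (cases "s < u\<^sup>2")
    case True
    have "(u\<^sup>2 - s) powr ((H + 1 / 2 - 1) + 1) = (u\<^sup>2 - s) powr (H + 1 / 2 - 1) * (u\<^sup>2 - s)"
      unfolding powr_add using True by simp
    then have "(u\<^sup>2 - s) powr (H + 1 / 2) = (u\<^sup>2 - s) powr (H + 1 / 2 - 1) * (u\<^sup>2 - s)"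
      by (simp only: diff_add_cancel)
    then have "g n s = K u s * ((u\<^sup>2 - s) / (max 0 (u\<^sup>2 - s) + 1 / real (Suc n)))"
      using True by (simp add: g_def beta_kernel_def)
    then have "K u s - g n s = K u s * (1 - (u\<^sup>2 - s) / (max 0 (u\<^sup>2 - s) + 1 / real (Suc n)))"
      by (simp add: right_diff_distrib)
    also have "1 - (u\<^sup>2 - s) / (max 0 (u\<^sup>2 - s) + 1 / real (Suc n)) = (1 / real (Suc n)) / (max 0 (u\<^sup>2 - s) + 1 / real (Suc n))"
    proof -
      define d where "d = 1 / real (Suc n)"
      have "d > 0" by (simp add: d_def)
      then have "1 - (u\<^sup>2 - s) / (max 0 (u\<^sup>2 - s) + d) = d / (max 0 (u\<^sup>2 - s) + d)"
        using True by (simp add: max_def field_simps)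
      then show ?thesis unfolding d_def .
    qed
    finally show ?thesis .
  qed (simp add: beta_kernel_def g_def)
  have "(\<lambda>n. integral\<^sup>L (jac H) (\<lambda>s. (K u s - g n s) * (K u s - g n s))) \<longlonglongrightarrow> integral\<^sup>L (jac H) (\<lambda>s. 0)"
  proof (rule integral_dominated_convergence)
    show "integrable (jac H) (\<lambda>s. (K u s)\<^sup>2)" using L2_K[OF u] by (simp add: L2_def)
    show "AE s in jac H. (\<lambda>n. (K u s - g n s) * (K u s - g n s)) \<longlonglongrightarrow> 0"
    proof (rule AE_I2)
      fix s
      have "(\<lambda>n. K u s - g n s) \<longlonglongrightarrow> 0"
      proof (cases "s < u\<^sup>2")
        case True
        have i0: "(\<lambda>n. 1 / real (Suc n)) \<longlonglongrightarrow> 0" using LIMSEQ_inverse_real_of_nat by (simp add: inverse_eq_divide)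
        have "(\<lambda>n. K u s * ((1 / real (Suc n)) / (max 0 (u\<^sup>2 - s) + 1 / real (Suc n)))) \<longlonglongrightarrow>
            K u s * (0 / (max 0 (u\<^sup>2 - s) + 0))"
          using True by (intro tendsto_mult tendsto_divide tendsto_add tendsto_const i0) auto
        then show ?thesis unfolding diff by simp
      qed (simp add: beta_kernel_def g_def)
      from tendsto_mult[OF this this] show "(\<lambda>n. (K u s - g n s) * (K u s - g n s)) \<longlonglongrightarrow> 0" by simp
    qed
    fix n
    show "AE s in jac H. norm ((K u s - g n s) * (K u s - g n s)) \<le> (K u s)\<^sup>2"
    proof (rule AE_I2)
      fix s
      have "(1 / real (Suc n)) / (max 0 (u\<^sup>2 - s) + 1 / real (Suc n)) \<le> 1"
        by (subst divide_le_eq_1_pos[OF den]) simp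
      moreover have "0 \<le> (1 / real (Suc n)) / (max 0 (u\<^sup>2 - s) + 1 / real (Suc n))"
        using den[of s n] by (intro divide_nonneg_pos) auto
      ultimately have "\<bar>K u s - g n s\<bar> \<le> \<bar>K u s\<bar> * 1" unfolding diff abs_mult
        by (intro mult_left_mono) auto
      then have "\<bar>K u s - g n s\<bar>\<^sup>2 \<le> \<bar>K u s\<bar>\<^sup>2" by (intro power_mono) auto
      then show "norm ((K u s - g n s) * (K u s - g n s)) \<le> (K u s)\<^sup>2" by (simp add: power2_eq_square)
    qed
  qed measurable
  then have lim: "(\<lambda>n. ip (\<lambda>s. K u s - g n s) (\<lambda>s. K u s - g n s)) \<longlonglongrightarrow> 0" by (simp add: ip_def)
  fix e :: real assume "e > 0"
  then obtain n where "ip (\<lambda>s. K u s - g n s) (\<lambda>s. K u s - g n s) < e"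
    using order_tendstoD(2)[OF lim] eventually_happens'[OF sequentially_bot] by blast
  then show "\<exists>g. expandable g \<and> ip (\<lambda>s. K u s - g s) (\<lambda>s. K u s - g s) < e" using g by blast
qed

end

section \<open>Sonine's integral, term by term\<close>

lemma fact_odd_Gamma: "fact (2 * k + 1) * sqrt pi = 2 ^ (2 * k + 1) * fact k * Gamma (real k + 3 / 2)"
proof (induction k)
  case 0
  have "Gamma (1 / 2 + 1 :: real) = 1 / 2 * Gamma (1 / 2)" 
  proof (rule Gamma_plus1)
    show "(1 / 2 :: real) \<notin> \<int>\<^sub>\<le>\<^sub>0" using nonpos_Ints_nonpos[of "1 / 2 :: real"] by auto
  qed
  then show ?case by (simp add: Gamma_one_half_real)
next
  case (Suc k)
  have "real k + 3 / 2 \<notin> \<int>\<^sub>\<le>\<^sub>0" by (intro notI) (auto elim!: nonpos_Ints_cases simp: field_simps)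
  then have G: "Gamma (real (Suc k) + 3 / 2) = (real k + 3 / 2) * Gamma (real k + 3 / 2)"
    using Gamma_plus1[of "real k + 3 / 2"] by (simp add: add_ac)
  have "fact (2 * Suc k + 1) = (2 * real k + 3) * ((2 * real k + 2) * fact (2 * k + 1))"
    by (simp add: algebra_simps)
  then have "fact (2 * Suc k + 1) * sqrt pi = (2 * real k + 3) * (2 * real k + 2) * (fact (2 * k + 1) * sqrt pi)"
    by simp
  also have "\<dots> = (2 * real k + 3) * (2 * real k + 2) * (2 ^ (2 * k + 1) * fact k * Gamma (real k + 3 / 2))"
    unfolding Suc.IH ..
  also have "\<dots> = 2 ^ (2 * Suc k + 1) * fact (Suc k) * Gamma (real (Suc k) + 3 / 2)"
    unfolding G by (simp add: algebra_simps)
  finally show ?case .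
qed

text \<open>The value at x = 0 is the limit, in line with the convention for the term n = 0 of the
  series.\<close>

definition sinc_at :: "real \<Rightarrow> real \<Rightarrow> real" where
  "sinc_at x u = (if x = 0 then u else sin (x * u) / x)"

lemma sinc_at_sums: "(\<lambda>k. (- 1) ^ k * x ^ (2 * k) * u ^ (2 * k + 1) / fact (2 * k + 1)) sums sinc_at x u"
proof (cases "x = 0")
  case True
  have "(\<lambda>k. (- 1) ^ k * 0 ^ (2 * k) * u ^ (2 * k + 1) / fact (2 * k + 1)) sums
     (\<Sum>k\<in>{0}. (- 1) ^ k * 0 ^ (2 * k) * u ^ (2 * k + 1) / fact (2 * k + 1))"
    by (rule sums_finite) auto
  then show ?thesis using True by (simp add: sinc_at_def)
next
  case False
  have "(\<lambda>k. (- 1) ^ k / fact (2 * k + 1) * (x * u) ^ (2 * k + 1) / x) sums (sin (x * u) / x)"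
    by (intro sums_divide sin_paired)
  moreover have "(- 1) ^ k / fact (2 * k + 1) * (x * u) ^ (2 * k + 1) / x
      = (- 1) ^ k * x ^ (2 * k) * u ^ (2 * k + 1) / fact (2 * k + 1)" for k
    using False by (simp add: power_mult_distrib)
  ultimately show ?thesis using False by (simp only: sinc_at_def if_False)
qed

context bessel_zeros
begin

text \<open>Each power of s in the series of \<open>A\<close> gives a Beta integral. Its factor
  \<Gamma>(k+1-H) cancels against the coefficient of \<open>A\<close>, and
  \<open>fact_odd_Gamma\<close> turns the remaining k! \<Gamma>(k+3/2) into (2k+1)!, which leaves
  the sine series.\<close>

lemma ip_K_A:
  assumes u: "0 < u" "u \<le> 1"
  shows "ip (K u) (\<lambda>s. A (x\<^sup>2 / 4 * s)) = 2 * Gamma (H + 1 / 2) / sqrt pi * sinc_at x u"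
proof -
  let ?l = "x\<^sup>2 / 4"
  let ?t = "\<lambda>k. 2 * Gamma (H + 1 / 2) / sqrt pi * ((- 1) ^ k * x ^ (2 * k) * u ^ (2 * k + 1) / fact (2 * k + 1))"
  let ?f = "\<lambda>k s. A_coeff k * (- ?l) ^ k * (s ^ k * K u s)"
  have kint: "integrable (jac H) (\<lambda>s. s ^ k * K u s)" for k
    using H0 sq_unit[OF u] by (intro jac_beta_kernel(1)) auto
  have fs: "(\<lambda>k. ?f k s) sums (K u s * A (?l * s))" for s
  proof -
    have "(\<lambda>k. K u s * (A_coeff k * (- (?l * s)) ^ k)) sums (K u s * A (?l * s))" by (intro sums_mult A_sums)
    moreover have "K u s * (A_coeff k * (- (?l * s)) ^ k) = ?f k s" for k
      using power_mult_distrib[of "- ?l" s k] by simp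
    ultimately show ?thesis by (simp only:)
  qed
  have "(\<lambda>k. integral\<^sup>L (jac H) (?f k)) sums (integral\<^sup>L (jac H) (\<lambda>s. \<Sum>k. ?f k s))"
  proof (rule sums_integral)
    show "integrable (jac H) (?f k)" for k using kint by simp
    show "AE s in jac H. summable (\<lambda>k. norm (?f k s))"
    proof (rule AE_I2)
      fix s
      have "summable (\<lambda>k. \<bar>K u s\<bar> * (A_coeff k * (?l * \<bar>s\<bar>) ^ k))" by (intro summable_mult summable_A_coeff)
      moreover have "norm (?f k s) = \<bar>K u s\<bar> * (A_coeff k * (?l * \<bar>s\<bar>) ^ k)" for k
        using A_coeff_pos[of k] by (simp add: abs_mult power_abs power_mult_distrib power_divide)
      ultimately show "summable (\<lambda>k. norm (?f k s))" by simp
    qed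
    \<comment> \<open>On [0,1] the factor \<open>s ^ k\<close> is at most 1; what remains is a
      multiple of the series of \<open>A\<close> at \<open>- ?l\<close>.\<close>
    show "summable (\<lambda>k. integral\<^sup>L (jac H) (\<lambda>s. norm (?f k s)))"
    proof (rule summable_comparison_test')
      show "summable (\<lambda>k. integral\<^sup>L (jac H) (K u) * (A_coeff k * ?l ^ k))" by (intro summable_mult summable_A_coeff)
      fix k :: nat
      have "integral\<^sup>L (jac H) (\<lambda>s. norm (?f k s)) \<le> integral\<^sup>L (jac H) (\<lambda>s. (A_coeff k * ?l ^ k) * K u s)"
      proof (rule integral_mono_AE)
        show "integrable (jac H) (\<lambda>s. norm (?f k s))" using kint by simp
        show "integrable (jac H) (\<lambda>s. (A_coeff k * ?l ^ k) * K u s)" using kint[of 0] by simp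
        show "AE s in jac H. norm (?f k s) \<le> (A_coeff k * ?l ^ k) * K u s"
          using AE_jac
        proof eventually_elim
          case (elim s)
          have "norm (?f k s) = (A_coeff k * ?l ^ k) * K u s * s ^ k"
            using elim A_coeff_pos[of k] beta_kernel_nonneg[of "H + 1 / 2" "u\<^sup>2" s]
            by (simp add: abs_mult power_abs)
          also have "\<dots> \<le> (A_coeff k * ?l ^ k) * K u s * 1"
            using elim A_coeff_pos[of k] beta_kernel_nonneg[of "H + 1 / 2" "u\<^sup>2" s]
            by (intro mult_left_mono power_le_one mult_nonneg_nonneg) auto
          finally show ?case by simp
        qed
      qed
      then show "norm (integral\<^sup>L (jac H) (\<lambda>s. norm (?f k s))) \<le> integral\<^sup>L (jac H) (K u) * (A_coeff k * ?l ^ k)"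
        by (simp add: mult.commute)
    qed
  qed
  moreover have "(\<Sum>k. ?f k s) = K u s * A (?l * s)" for s using fs sums_iff by blast
  ultimately have 1: "(\<lambda>k. integral\<^sup>L (jac H) (?f k)) sums ip (K u) (\<lambda>s. A (?l * s))"
    unfolding ip_def by simp
  have "(\<lambda>k. integral\<^sup>L (jac H) (?f k)) =
     ?t"
  proof (rule ext)
    fix k
    have "integral\<^sup>L (jac H) (?f k) = A_coeff k * (- ?l) ^ k * ((u\<^sup>2) powr (real k - H + (H + 1 / 2)) * Beta (real k + 1 - H) (H + 1 / 2))"
      using jac_beta_kernel(2)[of "H + 1 / 2" "u\<^sup>2" k] H0 sq_unit[OF u] by simp
    also have "(u\<^sup>2) powr (real k - H + (H + 1 / 2)) = u ^ (2 * k + 1)"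
    proof -
      have "(u\<^sup>2) powr (real k - H + (H + 1 / 2)) = u powr (2 * (real k + 1 / 2))"
        using u by (simp add: powr_powr flip: powr_numeral)
      also have "\<dots> = u powr real (2 * k + 1)" by (simp add: algebra_simps)
      finally show ?thesis using u by (simp only: powr_realpow)
    qed
    also have "Beta (real k + 1 - H) (H + 1 / 2) = Gamma (real k + 1 - H) * Gamma (H + 1 / 2) / Gamma (real k + 3 / 2)"
      by (simp add: Beta_def add_ac)
    also have "A_coeff k * (- ?l) ^ k * (u ^ (2 * k + 1) * (Gamma (real k + 1 - H) * Gamma (H + 1 / 2) / Gamma (real k + 3 / 2)))
      = (- ?l) ^ k * u ^ (2 * k + 1) * Gamma (H + 1 / 2) / (fact k * Gamma (real k + 3 / 2))"
    proof -
      have "Gamma (real k + 1 - H) > 0" using H1 by (intro Gamma_real_pos) auto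
      then have "A_coeff k * Gamma (real k + 1 - H) = 1 / fact k"
        by (simp add: A_coeff_def rGamma_inverse_Gamma field_simps)
      moreover have "A_coeff k * (- ?l) ^ k * (u ^ (2 * k + 1) * (Gamma (real k + 1 - H) * Gamma (H + 1 / 2) / Gamma (real k + 3 / 2)))
        = (A_coeff k * Gamma (real k + 1 - H)) * ((- ?l) ^ k * u ^ (2 * k + 1) * Gamma (H + 1 / 2) / Gamma (real k + 3 / 2))"
        by (simp only: times_divide_eq_right times_divide_eq_left mult_ac)
      ultimately show ?thesis by (simp only: times_divide_eq_right times_divide_eq_left divide_divide_eq_left mult_1_left mult.commute)
    qed
    also have "\<dots> = ?t k"
    proof -
      have gen: "X / q * U * G / (F * P / (2 * q)) = 2 * G / P * (X * U / F)"
        if "q \<noteq> 0" "F \<noteq> 0" "P \<noteq> 0" for X q U G F P :: real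
        using that by (simp add: field_simps)
      have "(- 1) ^ k * x ^ (2 * k) / 4 ^ k * u ^ (2 * k + 1) * Gamma (H + 1 / 2) / (fact (2 * k + 1) * sqrt pi / (2 * 4 ^ k))
        = ?t k"
        by (rule gen) (use pi_gt_zero in auto)
      moreover have "(- ?l) ^ k = (- 1) ^ k * x ^ (2 * k) / 4 ^ k"
        using power_mult_distrib[of "- 1" ?l k] by (simp add: power_divide power_mult)
      moreover have "fact k * Gamma (real k + 3 / 2) = fact (2 * k + 1) * sqrt pi / (2 * 4 ^ k)"
      proof -
        have "(2::real) ^ (2 * k + 1) = 2 * 4 ^ k" by (simp add: power_mult)
        then show ?thesis using fact_odd_Gamma[of k] by (simp add: field_simps del: fact_Suc)
      qed
      ultimately show ?thesis by (simp only:)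
    qed
    finally show "integral\<^sup>L (jac H) (?f k) = \<dots>" .
  qed
  with 1 have "?t
    sums ip (K u) (\<lambda>s. A (?l * s))" by simp
  moreover have "?t
    sums (2 * Gamma (H + 1 / 2) / sqrt pi * sinc_at x u)"
    by (intro sums_mult sinc_at_sums)
  ultimately show ?thesis using sums_unique2 by blast
qed

lemma sinc_expansion:
  assumes u: "0 < u" "u \<le> 1" and x: "\<And>n. lam n = (x n)\<^sup>2 / 4"
  shows "(\<lambda>n. (sinc_at (x n) u)\<^sup>2 / nrm n) sums
     (pi / (4 * (Gamma (H + 1 / 2))\<^sup>2) * (u powr (2 * H) * Beta (1 - H) (2 * H)))"
proof -
  have G: "Gamma (H + 1 / 2) > 0" using H0 by (intro Gamma_real_pos) auto
  have "(\<lambda>n. pi / (4 * (Gamma (H + 1 / 2))\<^sup>2) * ((ip (K u) (\<phi> n))\<^sup>2 / ip (\<phi> n) (\<phi> n))) sums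
     (pi / (4 * (Gamma (H + 1 / 2))\<^sup>2) * ip (K u) (K u))"
    by (intro sums_mult parseval expandable_K u)
  moreover have "pi / (4 * (Gamma (H + 1 / 2))\<^sup>2) * ((ip (K u) (\<phi> n))\<^sup>2 / ip (\<phi> n) (\<phi> n)) = (sinc_at (x n) u)\<^sup>2 / nrm n" for n
  proof -
    have "ip (K u) (\<phi> n) = 2 * Gamma (H + 1 / 2) / sqrt pi * sinc_at (x n) u"
      unfolding x by (rule ip_K_A[OF u])
    then show ?thesis using G nrm_pos[of n] unfolding nrm_def by (simp add: power_mult_distrib power_divide)
  qed
  ultimately show ?thesis unfolding ip_K_K[OF u] by simp
qed

end

section \<open>The variance identity\<close>

text \<open>If one sequence were smaller at n + 1, this value would be attained by the other one
  strictly between n and n + 1. The lemma is meant for \<open>\<omega>\<close> and its reflection,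
  which enumerate the same symmetric set.\<close>

lemma strict_mono_int_eq:
  fixes f g :: "int \<Rightarrow> 'a::linorder"
  assumes f: "strict_mono f" and g: "strict_mono g" and r: "range f = range g" and 0: "f 0 = g 0"
  shows "f (int n) = g (int n)"
proof (induction n)
  case (Suc n)
  have *: False if fg: "strict_mono f" "strict_mono g" "range f = range g" "f (int n) = g (int n)"
      and lt: "f (int (Suc n)) < g (int (Suc n))" for f g :: "int \<Rightarrow> 'a"
  proof -
    obtain m where m: "f (int (Suc n)) = g m" using fg(3) by (metis rangeE rangeI)
    have "f (int n) < f (int (Suc n))" using fg(1) by (simp add: strict_mono_less)
    then have "g (int n) < g m" using m fg(4) by simp
    then have "int n < m" "m < int (Suc n)" using m lt fg(2) by (auto simp: strict_mono_less)
    then show False by simp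
  qed
  show ?case using *[OF f g r Suc.IH] *[OF g f r[symmetric] Suc.IH[symmetric]] by (meson linorder_cases)
qed (use 0 in simp)

lemma Gamma_duplication_real:
  fixes x :: real
  assumes "x > 0"
  shows "Gamma x * Gamma (x + 1 / 2) = 2 powr (1 - 2 * x) * sqrt pi * Gamma (2 * x)"
proof -
  have np: "complex_of_real y \<notin> \<int>\<^sub>\<le>\<^sub>0" if "y > 0" for y
  proof
    assume "complex_of_real y \<in> \<int>\<^sub>\<le>\<^sub>0"
    then have "y \<in> \<int>\<^sub>\<le>\<^sub>0" by (simp add: of_real_in_nonpos_Ints_iff)
    then show False using nonpos_Ints_nonpos[of y] that by simp
  qed
  have "Gamma (complex_of_real x) * Gamma (complex_of_real x + 1 / 2) =
     exp ((1 - 2 * complex_of_real x) * of_real (ln 2)) * of_real (sqrt pi) * Gamma (2 * complex_of_real x)"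
    using np[of x] np[of "x + 1 / 2"] assms by (intro Gamma_legendre_duplication) auto
  then have "Gamma (complex_of_real x) * Gamma (complex_of_real (x + 1 / 2)) =
     exp (complex_of_real ((1 - 2 * x) * ln 2)) * of_real (sqrt pi) * Gamma (complex_of_real (2 * x))"
    by simp
  then have "complex_of_real (Gamma x * Gamma (x + 1 / 2)) = of_real (exp ((1 - 2 * x) * ln 2) * sqrt pi * Gamma (2 * x))"
    unfolding Gamma_complex_of_real exp_of_real by (simp only: of_real_mult)
  then have "Gamma x * Gamma (x + 1 / 2) = exp ((1 - 2 * x) * ln 2) * sqrt pi * Gamma (2 * x)"
    by (simp only: of_real_eq_iff)
  then show ?thesis by (simp add: powr_def)
qed

lemma Gamma_plus1_pos: "x > 0 \<Longrightarrow> Gamma (x + 1) = x * Gamma (x::real)"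
  using nonpos_Ints_nonpos[of x] by (intro Gamma_plus1) auto

text \<open>Legendre's duplication formula at H + 1/2 and at 3/2 - H; the two powers of 2 multiply
  to 1/4. It reconciles the constant in \<open>dH_sq\<close> with the one from Parseval's
  identity.\<close>

lemma (in hurst) Gamma_constant_identity:
  "pi * (2 * H * Gamma (2 * H)) * Gamma (3 - 2 * H)
     = 4 * ((1 - H) * Gamma (1 - H)) * Gamma (H + 1 / 2) * Gamma (1 + H) * Gamma (3 / 2 - H)"
proof -
  have d1: "Gamma (H + 1 / 2) * Gamma (1 + H) = 2 powr (- 2 * H) * sqrt pi * (2 * H * Gamma (2 * H))"
    using Gamma_duplication_real[of "H + 1 / 2"] Gamma_plus1_pos[of "2 * H"] H0 by (simp add: algebra_simps)
  have d2: "Gamma (3 / 2 - H) * ((1 - H) * Gamma (1 - H)) = 2 powr (2 * H - 2) * sqrt pi * Gamma (3 - 2 * H)"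
  proof -
    have e: "3 / 2 - H + 1 / 2 = (1 - H) + 1" "1 - 2 * (3 / 2 - H) = 2 * H - 2" "2 * (3 / 2 - H) = 3 - 2 * H" by simp_all
    have "Gamma ((1 - H) + 1) = (1 - H) * Gamma (1 - H)" using H1 by (intro Gamma_plus1_pos) simp
    then show ?thesis using Gamma_duplication_real[of "3 / 2 - H"] H1 unfolding e by simp
  qed
  have "4 * ((1 - H) * Gamma (1 - H)) * Gamma (H + 1 / 2) * Gamma (1 + H) * Gamma (3 / 2 - H)
    = 4 * (Gamma (H + 1 / 2) * Gamma (1 + H)) * (Gamma (3 / 2 - H) * ((1 - H) * Gamma (1 - H)))" by simp
  also have "\<dots> = 4 * (2 powr (- 2 * H) * 2 powr (2 * H - 2)) * (sqrt pi * sqrt pi) * (2 * H * Gamma (2 * H)) * Gamma (3 - 2 * H)"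
    unfolding d1 d2 by (simp only: mult_ac)
  also have "2 powr (- 2 * H) * 2 powr (2 * H - 2) = (1 / 4 :: real)"
  proof -
    have e: "(- 2 * H) + (2 * H - 2) = - 2" by simp
    show ?thesis unfolding powr_add[symmetric] e by (simp add: powr_minus_divide)
  qed
  finally show ?thesis by simp
qed

text \<open>A Tauberian step: each frequency \<open>y \<ge> 1\<close> is seen by the dyadic scale \<open>u\<close> with
  \<open>y u \<in> [1/2, 1)\<close>.\<close>

lemma summable_powr_of_sin_square_bound:
  fixes a y :: "nat \<Rightarrow> real"
  assumes p: "p > 0" and a: "\<And>k. a k \<ge> 0" and y: "eventually (\<lambda>k. y k \<ge> 1) sequentially"
    and bd: "\<And>u N. 0 < u \<Longrightarrow> u \<le> 1 \<Longrightarrow> (\<Sum>k<N. a k * (sin (y k * u))\<^sup>2) \<le> D * u powr (2 * p)"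
  shows "summable (\<lambda>k. a k * y k powr p)"
proof -
  define s0 where "s0 = (sin (1 / 2 :: real))\<^sup>2"
  have s0: "s0 > 0" using sin_gt_zero_02[of "1/2"] by (simp add: s0_def)
  \<comment> \<open>At the scale \<open>u i = 1 / 2 ^ (i + 1)\<close> one has
    \<open>u i powr p = r ^ (i + 1)\<close>. Weighting this scale by \<open>1 / r ^ (i + 1)\<close>
    leaves \<open>D * r ^ (i + 1)\<close> of the assumed bound, a geometric series.\<close>
  define r where "r = (2::real) powr (- p)"
  have r: "0 < r" "r < 1" using p by (auto simp: r_def powr_less_one)
  have D: "D \<ge> 0" using bd[of 1 0] by simp
  define b where "b k = (if y k \<ge> 1 then a k * y k powr p else 0)" for k
  have "\<exists>j. y k < 2 ^ (j + 1) \<and> 2 ^ j \<le> y k" if "y k \<ge> 1" for k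
  proof -
    have "\<exists>j. y k < 2 ^ j" by (rule real_arch_pow) simp
    then obtain j where j: "y k < 2 ^ j" "\<And>i. i < j \<Longrightarrow> \<not> y k < 2 ^ i"
      using exists_least_iff[of "\<lambda>j. y k < 2 ^ j"] by blast
    then show ?thesis using that by (cases j) (auto simp: not_less)
  qed
  then obtain j where j: "\<And>k. y k \<ge> 1 \<Longrightarrow> y k < 2 ^ (j k + 1) \<and> 2 ^ j k \<le> y k" by metis
  define u where "u i = (1 :: real) / 2 ^ (i + 1)" for i :: nat
  have u: "0 < u i" "u i \<le> 1" for i
    using one_le_power[of "2::real" "i + 1"] by (auto simp: u_def divide_le_eq_1_pos)
  have up: "u i powr p = r ^ (i + 1)" for i
  proof -
    have "u i = 2 powr (- real (i + 1))" 
      using powr_realpow[of 2 "i + 1"] unfolding u_def powr_minus_divide by simp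
    moreover have "- real (i + 1) * p = - p * real (i + 1)" by (simp add: algebra_simps)
    ultimately have "u i powr p = (2 powr (- p)) powr real (i + 1)" by (simp only: powr_powr)
    also have "\<dots> = r ^ (i + 1)" using r unfolding r_def[symmetric] by (intro powr_realpow)
    finally show ?thesis .
  qed
  have b_le: "b k \<le> (\<Sum>i<J. (1 / (s0 * r ^ (i + 1))) * (a k * (sin (y k * u i))\<^sup>2))" if J: "J > j k" for k J
  proof (cases "y k \<ge> 1")
    case False
    then show ?thesis using r s0 a by (auto simp: b_def intro!: sum_nonneg mult_nonneg_nonneg)
  next
    case True
    have yu: "1 / 2 \<le> y k * u (j k)" "y k * u (j k) \<le> 1"
      using j[OF True] by (auto simp: u_def field_simps)
    have "sin (1 / 2) \<le> sin (y k * u (j k))"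
      using yu pi_gt3 by (intro sin_monotone_2pi_le) auto
    then have s: "s0 \<le> (sin (y k * u (j k)))\<^sup>2"
      unfolding s0_def using sin_gt_zero_02[of "1/2"] by (intro power_mono) auto
    have "y k powr p \<le> 1 / r ^ (j k + 1)"
    proof -
      have "(y k * u (j k)) powr p \<le> 1" using yu p by (intro powr_le1) auto
      moreover have "(y k * u (j k)) powr p = y k powr p * r ^ (j k + 1)"
        using True u(1)[of "j k"] up by (simp add: powr_mult)
      ultimately show ?thesis using r by (simp add: pos_le_divide_eq)
    qed
    then have "a k * y k powr p \<le> a k * (1 / r ^ (j k + 1))" using a by (intro mult_left_mono)
    then have "b k \<le> a k * (1 / r ^ (j k + 1))" using True by (simp only: b_def if_True)
    also have "\<dots> = (1 / (s0 * r ^ (j k + 1))) * (a k * s0)" using s0 r by simp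
    also have "\<dots> \<le> (1 / (s0 * r ^ (j k + 1))) * (a k * (sin (y k * u (j k)))\<^sup>2)"
      using s a s0 r by (intro mult_left_mono) auto
    also have "\<dots> \<le> (\<Sum>i<J. (1 / (s0 * r ^ (i + 1))) * (a k * (sin (y k * u i))\<^sup>2))"
      using J a s0 r by (intro member_le_sum[of "j k" "{..<J}"]) auto
    finally show ?thesis .
  qed
  have "summable b"
  proof (rule summableI_nonneg_bounded)
    show "0 \<le> b k" for k using a by (simp add: b_def)
    fix N
    \<comment> \<open>\<open>J\<close> exceeds the scale of each of the first \<open>N\<close>
      frequencies, so that one finite sum over scales serves all of them and the sums can be
      interchanged.\<close>
    define J where "J = Suc (Max (insert 0 (j ` {..<N})))"
    have J: "J > j k" if "k < N" for k unfolding J_def using that by (auto intro!: le_imp_less_Suc Max_ge)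
    have "sum b {..<N} \<le> (\<Sum>k<N. \<Sum>i<J. (1 / (s0 * r ^ (i + 1))) * (a k * (sin (y k * u i))\<^sup>2))"
      using J by (intro sum_mono b_le) auto
    also have "\<dots> = (\<Sum>i<J. (1 / (s0 * r ^ (i + 1))) * (\<Sum>k<N. a k * (sin (y k * u i))\<^sup>2))"
      by (subst sum.swap) (simp add: sum_distrib_left)
    also have "\<dots> \<le> (\<Sum>i<J. (1 / (s0 * r ^ (i + 1))) * (D * u i powr (2 * p)))"
      using u r s0 by (intro sum_mono mult_left_mono bd) auto
    also have "\<dots> = (\<Sum>i<J. D * r / s0 * r ^ i)"
    proof (rule sum.cong)
      fix i
      have "u i powr (2 * p) = (u i powr p) * (u i powr p)" by (simp flip: powr_add)
      then show "(1 / (s0 * r ^ (i + 1))) * (D * u i powr (2 * p)) = D * r / s0 * r ^ i"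
        unfolding up using r s0 by (simp add: field_simps)
    qed simp
    also have "\<dots> = D * r / s0 * (\<Sum>i<J. r ^ i)" by (simp add: sum_distrib_left)
    also have "\<dots> \<le> D * r / s0 * (\<Sum>i. r ^ i)"
      using r D s0 by (intro mult_left_mono sum_le_suminf summable_geometric) auto
    finally show "sum b {..<N} \<le> D * r / s0 * (\<Sum>i. r ^ i)" .
  qed
  moreover have "eventually (\<lambda>k. b k = a k * y k powr p) sequentially"
    using y by eventually_elim (simp add: b_def)
  ultimately show ?thesis by (simp only: summable_cong)
qed

section \<open>The coefficient functions of the series\<close>

lemma cmod_exp_i_minus_1: "(cmod (exp (\<i> * of_real x) - 1))\<^sup>2 = 4 * (sin (x / 2))\<^sup>2"
proof -
  have "(cmod (exp (\<i> * of_real x) - 1))\<^sup>2 = (cos x - 1)\<^sup>2 + (sin x)\<^sup>2"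
    by (simp add: cmod_power2 Re_exp Im_exp)
  also have "\<dots> = 2 - 2 * cos x" using sin_cos_squared_add[of x] by (simp add: power2_eq_square algebra_simps)
  also have "cos x = 1 - 2 * (sin (x / 2))\<^sup>2" using cos_double_sin[of "x / 2"] by simp
  finally show ?thesis by simp
qed

lemma fBm_coeff_eq:
  "x \<noteq> 0 \<Longrightarrow> fBm_coeff T x t = (exp (\<i> * of_real (2 * x * t / T)) - 1) / (\<i> * of_real (2 * x / T))"
  by (simp add: fBm_coeff_def mult_ac)

lemma cmod_fBm_coeff:
  assumes "T > 0"
  shows "(cmod (fBm_coeff T x t))\<^sup>2 = T\<^sup>2 * (sinc_at x (t / T))\<^sup>2"
proof (cases "x = 0")
  case True
  then show ?thesis using assms by (simp add: fBm_coeff_def sinc_at_def power_divide)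
next
  case False
  have n: "cmod (\<i> * of_real (2 * x / T)) = \<bar>2 * x / T\<bar>"
    by (simp only: norm_mult norm_ii norm_of_real mult_1_left)
  have "(cmod (fBm_coeff T x t))\<^sup>2 = 4 * (sin (2 * x * t / T / 2))\<^sup>2 / (2 * x / T)\<^sup>2"
    unfolding fBm_coeff_eq[OF False] norm_divide power_divide cmod_exp_i_minus_1 n power2_abs ..
  then show ?thesis using False assms by (simp add: sinc_at_def power_divide power_mult_distrib)
qed

text \<open>The difference is the coefficient at \<open>s - t\<close> times a number of modulus 1;
  this reflects the stationarity of the increments.\<close>

lemma cmod_fBm_coeff_diff: "cmod (fBm_coeff T x s - fBm_coeff T x t) = cmod (fBm_coeff T x (s - t))"
proof (cases "x = 0")
  case True
  then show ?thesis by (simp add: fBm_coeff_def flip: of_real_diff)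
next
  case False
  have "exp (\<i> * of_real (2 * x * s / T)) = exp (\<i> * of_real (2 * x * t / T)) * exp (\<i> * of_real (2 * x * (s - t) / T))"
    by (simp flip: exp_add add: diff_divide_distrib right_diff_distrib distrib_left algebra_simps)
  moreover have "(e1 - 1) / d - (e2 - 1) / d = e2 * ((e3 - 1) / d)" if "e1 = e2 * e3" for e1 e2 e3 d :: complex
    using that by (simp add: right_diff_distrib flip: diff_divide_distrib)
  ultimately have "fBm_coeff T x s - fBm_coeff T x t = exp (\<i> * of_real (2 * x * t / T)) * fBm_coeff T x (s - t)"
    unfolding fBm_coeff_eq[OF False] by blast
  then show ?thesis by (simp add: norm_mult norm_exp_i_times)
qed

lemma sinc_at_0: "sinc_at x 0 = 0"
  by (simp add: sinc_at_def)

lemma sinc_at_bounds: "\<bar>sinc_at x u\<bar> \<le> \<bar>u\<bar>" "x \<noteq> 0 \<Longrightarrow> \<bar>sinc_at x u\<bar> \<le> 1 / \<bar>x\<bar>"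
proof -
  have "\<bar>sin (x * u)\<bar> \<le> \<bar>x * u\<bar>" by (rule abs_sin_x_le_abs_x)
  then show "\<bar>sinc_at x u\<bar> \<le> \<bar>u\<bar>" by (auto simp: sinc_at_def abs_mult divide_le_eq mult.commute)
  show "x \<noteq> 0 \<Longrightarrow> \<bar>sinc_at x u\<bar> \<le> 1 / \<bar>x\<bar>"
    by (auto simp: sinc_at_def intro!: divide_right_mono)
qed

lemma cmod_fBm_coeff_abs: "T > 0 \<Longrightarrow> cmod (fBm_coeff T x t) = T * \<bar>sinc_at x (t / T)\<bar>"
proof -
  assume T: "T > 0"
  have "(cmod (fBm_coeff T x t))\<^sup>2 = (T * \<bar>sinc_at x (t / T)\<bar>)\<^sup>2"
    unfolding cmod_fBm_coeff[OF T] by (simp add: power_mult_distrib)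
  then show ?thesis using T by (subst (asm) power2_eq_iff_nonneg) auto
qed

lemma fBm_coeff_lipschitz: "T > 0 \<Longrightarrow> cmod (fBm_coeff T x s - fBm_coeff T x t) \<le> \<bar>s - t\<bar>"
  unfolding cmod_fBm_coeff_diff cmod_fBm_coeff_abs using sinc_at_bounds(1)[of x "(s - t) / T"]
  by (simp add: field_simps)

lemma fBm_coeff_bound: "T > 0 \<Longrightarrow> x \<noteq> 0 \<Longrightarrow> cmod (fBm_coeff T x t) \<le> T / \<bar>x\<bar>"
  unfolding cmod_fBm_coeff_abs using sinc_at_bounds(2)[of x "t / T"] by (simp add: field_simps)

lemma fBm_coeff_uminus: "fBm_coeff T (- x) t = cnj (fBm_coeff T x t)"
  by (simp add: fBm_coeff_def exp_cnj)

lemma sum_int_symmetric: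
  fixes g :: "int \<Rightarrow> 'a::comm_monoid_add"
  shows "(\<Sum>n\<in>{- int N..int N}. g n) = g 0 + (\<Sum>k=1..N. g (int k) + g (- int k))"
proof (induction N)
  case (Suc N)
  have "{- int (Suc N)..int (Suc N)} = insert (int (Suc N)) (insert (- int (Suc N)) {- int N..int N})" by auto
  then show ?case using Suc by (simp add: add_ac del: of_nat_Suc)
qed simp

lemma sum_Im_symmetric:
  fixes z :: "int \<Rightarrow> complex"
  assumes "\<And>n. z (- n) = cnj (z n)"
  shows "(\<Sum>n\<in>{- int N..int N}. Im (z n)) = 0"
  unfolding sum_int_symmetric assms using assms[of 0] by (simp add: complex_eq_iff)

section \<open>The zeros of J_{1-H}, and the variance and covariance of the series\<close>

locale fBm_series = hurst +
  fixes T :: real and \<omega> :: "int \<Rightarrow> real"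
  assumes T: "0 < T" and mono: "strict_mono \<omega>" and \<omega>_0: "\<omega> 0 = 0"
    and zeros: "range \<omega> = {x :: real. bessel_J (of_real (1 - H)) (of_real x) = 0}"
begin

lemma zeros_iff: "x \<in> range \<omega> \<longleftrightarrow> x = 0 \<or> C (x\<^sup>2 / 4) = 0"
proof -
  have "x \<in> range \<omega> \<longleftrightarrow> bessel_J (of_real (1 - H)) (of_real x) = 0" unfolding zeros by simp
  also have "\<dots> \<longleftrightarrow> x = 0 \<or> C (x\<^sup>2 / 4) = 0"
    using bessel_J_eq_0_iff[of "1 - H" x] H1 by (simp add: C_def)
  finally show ?thesis .
qed

lemma \<omega>_uminus: "\<omega> (- n) = - \<omega> n"
proof -
  define \<tau> where "\<tau> n = - \<omega> (- n)" for n
  have *: "\<omega> (int k) = \<tau> (int k)" for k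
  proof (rule strict_mono_int_eq[OF mono])
    show "strict_mono \<tau>" using mono by (auto simp: \<tau>_def strict_mono_def)
    show "range \<omega> = range \<tau>"
    proof (rule set_eqI)
      fix x
      have "x \<in> range \<tau> \<longleftrightarrow> - x \<in> range \<omega>"
      proof
        assume "- x \<in> range \<omega>"
        then obtain n where "- x = \<omega> n" by auto
        then have "x = \<tau> (- n)" by (simp add: \<tau>_def)
        then show "x \<in> range \<tau>" by blast
      qed (auto simp: \<tau>_def)
      then show "x \<in> range \<omega> \<longleftrightarrow> x \<in> range \<tau>" by (simp add: zeros_iff)
    qed
  qed (simp add: \<tau>_def \<omega>_0)
  show ?thesis
  proof (cases "n \<ge> 0")
    case True then show ?thesis using *[of "nat n"] by (simp add: \<tau>_def)
  next
    case False then show ?thesis using *[of "nat (- n)"] by (simp add: \<tau>_def)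
  qed
qed

lemma \<omega>_pos: "n > 0 \<Longrightarrow> \<omega> n > 0" and \<omega>_eq_0_iff: "\<omega> n = 0 \<longleftrightarrow> n = 0"
  using mono \<omega>_0 by (metis strict_mono_less, metis strict_mono_eq)

lemma \<omega>_nat_nonneg: "\<omega> (int k) \<ge> 0"
  using \<omega>_pos[of "int k"] \<omega>_0 by (cases "k = 0") auto

sublocale bessel_zeros H "\<lambda>n. (\<omega> (int n))\<^sup>2 / 4"
proof
  show "(\<omega> (int 0))\<^sup>2 / 4 = 0" by (simp add: \<omega>_0)
  show "strict_mono (\<lambda>n. (\<omega> (int n))\<^sup>2 / 4)"
  proof (rule strict_monoI)
    fix m n :: nat assume "m < n"
    then have "\<omega> (int m) < \<omega> (int n)" using mono by (simp add: strict_mono_less)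
    then have "(\<omega> (int m))\<^sup>2 < (\<omega> (int n))\<^sup>2" using \<omega>_nat_nonneg[of m] by (intro power_strict_mono) auto
    then show "(\<omega> (int m))\<^sup>2 / 4 < (\<omega> (int n))\<^sup>2 / 4" by simp
  qed
  show "E x = 0 \<longleftrightarrow> x \<in> range (\<lambda>n. (\<omega> (int n))\<^sup>2 / 4)" for x
  proof (cases "x < 0")
    case True
    then have "E x \<noteq> 0" using C_pos[of x] by (simp add: E_def)
    moreover have "x \<notin> range (\<lambda>n. (\<omega> (int n))\<^sup>2 / 4)" using True by (auto simp: not_less[symmetric])
    ultimately show ?thesis by blast
  next
    case False
    define y where "y = 2 * sqrt x"
    have y: "y \<ge> 0" "y\<^sup>2 / 4 = x" using False by (auto simp: y_def power_mult_distrib)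
    have "E x = 0 \<longleftrightarrow> y \<in> range \<omega>" unfolding zeros_iff E_def y(2) using y by (auto simp: y_def)
    also have "\<dots> \<longleftrightarrow> (\<exists>n::nat. y = \<omega> (int n))"
    proof
      assume "y \<in> range \<omega>"
      then obtain n where n: "y = \<omega> n" by auto
      then have "n \<ge> 0" using y \<omega>_0 mono by (metis strict_mono_less_eq)
      then show "\<exists>n::nat. y = \<omega> (int n)" using n by (intro exI[of _ "nat n"]) simp
    qed auto
    also have "\<dots> \<longleftrightarrow> x \<in> range (\<lambda>n. (\<omega> (int n))\<^sup>2 / 4)"
    proof
      assume "x \<in> range (\<lambda>n. (\<omega> (int n))\<^sup>2 / 4)"
      then obtain n where "y\<^sup>2 = (\<omega> (int n))\<^sup>2" using y(2) by auto
      then show "\<exists>n::nat. y = \<omega> (int n)" using y \<omega>_nat_nonneg by (auto simp: power2_eq_iff_nonneg)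
    next
      assume "\<exists>n::nat. y = \<omega> (int n)"
      then obtain n :: nat where "y = \<omega> (int n)" ..
      then have "x = (\<omega> (int n))\<^sup>2 / 4" using y(2) by simp
      then show "x \<in> range (\<lambda>n. (\<omega> (int n))\<^sup>2 / 4)" by blast
    qed
    finally show ?thesis .
  qed
qed

definition W :: real where "W = (1 - H) * (Gamma (1 - H))\<^sup>2 * V_fBm H T"

lemma V_pos: "V_fBm H T > 0" and W_pos: "W > 0"
proof -
  have "Gamma (3 / 2 - H) > 0" "Gamma (H + 1 / 2) > 0" "Gamma (3 - 2 * H) > 0" "Gamma (1 - H) > 0"
    using H0 H1 by (auto intro!: Gamma_real_pos)
  then have "V_fBm H T > 0" "(Gamma (1 - H))\<^sup>2 > 0" using H0 T unfolding V_fBm_def dH_sq_def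
    by (intro mult_pos_pos divide_pos_pos zero_less_power; simp)+
  then show "V_fBm H T > 0" "W > 0" using H1 unfolding W_def by (auto intro!: mult_pos_pos)
qed

abbreviation \<sigma>2 :: "int \<Rightarrow> real" where "\<sigma>2 n \<equiv> 1 / inv_sigma_sq H T (\<omega> n)"

text \<open>The factor 2 makes up for the two indices k and -k that belong to the same
  \<open>\<phi> k\<close>, whereas 0 occurs once. At 0 the factor 1 - H in \<open>W\<close> cancels
  the one in \<open>nrm_0\<close>.\<close>

lemma inv_sigma_sq_nat: "inv_sigma_sq H T (\<omega> (int k)) = (if k = 0 then 1 else 2) * (W * nrm k)"
proof (cases "k = 0")
  case True
  have "Gamma (1 - H) > 0" using H1 by (intro Gamma_real_pos) auto
  then have "(Gamma (1 - H))\<^sup>2 \<noteq> 0" by (simp only: zero_less_power less_imp_neq[symmetric] not_False_eq_True)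
  then have "W * nrm 0 = V_fBm H T" using H1
    by (simp add: W_def nrm_0 A_0 rGamma_inverse_Gamma power_divide power_inverse right_inverse del: power_eq_0_iff)
  then show ?thesis using True by (simp add: inv_sigma_sq_def \<omega>_0)
next
  case False
  then show ?thesis using nrm_eq[OF False] \<omega>_eq_0_iff[of "int k"]
    by (simp add: inv_sigma_sq_def W_def bessel_series_eq_clifford A_def add.commute)
qed

lemma \<sigma>2_uminus: "\<sigma>2 (- n) = \<sigma>2 n"
  by (simp add: \<omega>_uminus inv_sigma_sq_def bessel_series_eq_clifford)

lemma \<sigma>2_nonneg: "\<sigma>2 n \<ge> 0"
  using V_pos H1 by (simp add: inv_sigma_sq_def)

lemma sum_\<sigma>2:
  "(\<Sum>n\<in>{- int N..int N}. \<sigma>2 n * (sinc_at (\<omega> n) u)\<^sup>2) = (\<Sum>k\<le>N. (sinc_at (\<omega> (int k)) u)\<^sup>2 / nrm k) / W"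
proof -
  have s: "(sinc_at (- x) u)\<^sup>2 = (sinc_at x u)\<^sup>2" for x by (simp add: sinc_at_def power_divide)
  have "(\<Sum>n\<in>{- int N..int N}. \<sigma>2 n * (sinc_at (\<omega> n) u)\<^sup>2)
     = \<sigma>2 0 * (sinc_at (\<omega> 0) u)\<^sup>2 + (\<Sum>k=1..N. 2 * (\<sigma>2 (int k) * (sinc_at (\<omega> (int k)) u)\<^sup>2))"
    unfolding sum_int_symmetric \<sigma>2_uminus unfolding \<omega>_uminus s by simp
  also have "\<dots> = (sinc_at (\<omega> (int 0)) u)\<^sup>2 / nrm 0 / W + (\<Sum>k=1..N. (sinc_at (\<omega> (int k)) u)\<^sup>2 / nrm k / W)"
  proof (intro arg_cong2[where f = "(+)"] sum.cong)
    show "\<sigma>2 0 * (sinc_at (\<omega> 0) u)\<^sup>2 = (sinc_at (\<omega> (int 0)) u)\<^sup>2 / nrm 0 / W"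
      using inv_sigma_sq_nat[of 0] by (simp add: mult.commute)
    fix k assume "k \<in> {1..N}"
    then show "2 * (\<sigma>2 (int k) * (sinc_at (\<omega> (int k)) u)\<^sup>2) = (sinc_at (\<omega> (int k)) u)\<^sup>2 / nrm k / W"
      unfolding inv_sigma_sq_nat by (simp add: mult.commute)
  qed simp
  also have "\<dots> = (\<Sum>k\<le>N. (sinc_at (\<omega> (int k)) u)\<^sup>2 / nrm k / W)"
    by (simp add: atMost_atLeast0 sum.atLeast_Suc_atMost)
  finally show ?thesis by (simp add: sum_divide_distrib)
qed

lemma variance_constant:
  assumes t: "0 < t"
  shows "T\<^sup>2 * (pi / (4 * (Gamma (H + 1 / 2))\<^sup>2) * ((t / T) powr (2 * H) * Beta (1 - H) (2 * H)) / W) = t powr (2 * H)"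
proof -
  define G1 G2 G3 G4 G5 G6 where G: "G1 = Gamma (1 - H)" "G2 = Gamma (2 * H)" "G3 = Gamma (1 + H)"
    "G4 = Gamma (H + 1 / 2)" "G5 = Gamma (3 / 2 - H)" "G6 = Gamma (3 - 2 * H)"
  have pos: "G1 > 0" "G2 > 0" "G3 > 0" "G4 > 0" "G5 > 0" "G6 > 0"
    unfolding G using H0 H1 by (auto intro!: Gamma_real_pos)
  have id: "pi * (2 * H * G2) * G6 = 4 * ((1 - H) * G1) * G4 * G3 * G5"
    unfolding G by (rule Gamma_constant_identity)
  have B: "Beta (1 - H) (2 * H) = G1 * G2 / G3" unfolding Beta_def G by (simp add: add.commute)
  have Tp: "T\<^sup>2 * (t / T) powr (2 * H) = t powr (2 * H) * T powr (2 - 2 * H)"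
  proof -
    have "T powr 2 = T powr (2 - 2 * H) * T powr (2 * H)" by (simp flip: powr_add)
    then have "T\<^sup>2 = T powr (2 - 2 * H) * T powr (2 * H)" using T by simp
    then show ?thesis using T t by (simp add: powr_divide)
  qed
  have W: "W = (1 - H) * G1\<^sup>2 * (G5 / (2 * H * G4 * G6) * T powr (2 - 2 * H))"
    unfolding W_def V_fBm_def dH_sq_def G ..
  define P where "P = T powr (2 - 2 * H)"
  have P: "P > 0" using T by (simp add: P_def)
  have "T\<^sup>2 * (pi / (4 * G4\<^sup>2) * ((t / T) powr (2 * H) * (G1 * G2 / G3)) / W)
     = t powr (2 * H) * (P * (pi / (4 * G4\<^sup>2) * (G1 * G2 / G3)) / W)"
  proof -
    have "T\<^sup>2 * (pi / (4 * G4\<^sup>2) * ((t / T) powr (2 * H) * (G1 * G2 / G3)) / W)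
      = (T\<^sup>2 * (t / T) powr (2 * H)) * (pi / (4 * G4\<^sup>2) * (G1 * G2 / G3)) / W" by simp
    then show ?thesis unfolding Tp P_def by simp
  qed
  also have "P * (pi / (4 * G4\<^sup>2) * (G1 * G2 / G3)) / W = (pi * (2 * H * G2) * G6) / (4 * ((1 - H) * G1) * G4 * G3 * G5)"
    unfolding W P_def[symmetric] using pos P H0 H1 by (simp add: field_simps power2_eq_square)
  also have "\<dots> = 1" unfolding id using pos H0 H1 by simp
  finally show ?thesis unfolding B G by simp
qed

lemma variance_limit:
  assumes t: "0 \<le> t" "t \<le> T"
  shows "(\<lambda>N. \<Sum>n\<in>{- int N..int N}. \<sigma>2 n * (cmod (fBm_coeff T (\<omega> n) t))\<^sup>2) \<longlonglongrightarrow> t powr (2 * H)"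
proof (cases "t = 0")
  case True
  then show ?thesis by (simp add: cmod_fBm_coeff[OF T] sinc_at_0)
next
  case False
  then have tT: "0 < t" "0 < t / T" "t / T \<le> 1" using t T by auto
  let ?S = "pi / (4 * (Gamma (H + 1 / 2))\<^sup>2) * ((t / T) powr (2 * H) * Beta (1 - H) (2 * H))"
  have "(\<lambda>k. (sinc_at (\<omega> (int k)) (t / T))\<^sup>2 / nrm k) sums ?S"
    by (rule sinc_expansion) (use tT in auto)
  then have "(\<lambda>N. \<Sum>k\<le>N. (sinc_at (\<omega> (int k)) (t / T))\<^sup>2 / nrm k) \<longlonglongrightarrow> ?S"
    by (simp add: sums_def_le)
  then have "(\<lambda>N. T\<^sup>2 * ((\<Sum>k\<le>N. (sinc_at (\<omega> (int k)) (t / T))\<^sup>2 / nrm k) / W)) \<longlonglongrightarrow> T\<^sup>2 * (?S / W)"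
    using W_pos by (intro tendsto_intros) auto
  then show ?thesis unfolding variance_constant[OF tT(1)] sum_\<sigma>2[symmetric] cmod_fBm_coeff[OF T]
    by (simp add: sum_distrib_left mult_ac)
qed

lemma covariance_limit:
  assumes s: "s \<in> {0..T}" and t: "t \<in> {0..T}"
  shows "(\<lambda>N. \<Sum>n\<in>{- int N..int N}. of_real (\<sigma>2 n) * (fBm_coeff T (\<omega> n) s * cnj (fBm_coeff T (\<omega> n) t)))
     \<longlonglongrightarrow> complex_of_real ((s powr (2 * H) + t powr (2 * H) - \<bar>s - t\<bar> powr (2 * H)) / 2)"
proof -
  let ?c = "\<lambda>n t. fBm_coeff T (\<omega> n) t"
  let ?S = "\<lambda>N t. \<Sum>n\<in>{- int N..int N}. \<sigma>2 n * (cmod (?c n t))\<^sup>2"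
  have eq: "(\<Sum>n\<in>{- int N..int N}. of_real (\<sigma>2 n) * (?c n s * cnj (?c n t)))
      = of_real ((?S N s + ?S N t - ?S N \<bar>s - t\<bar>) / 2)" for N
  proof -
    let ?z = "\<lambda>n. of_real (\<sigma>2 n) * (?c n s * cnj (?c n t))"
    \<comment> \<open>The terms for n and -n are conjugate, so the symmetric partial sums are
      real.\<close>
    have sym: "?z (- n) = cnj (?z n)" for n
      unfolding \<sigma>2_uminus unfolding \<omega>_uminus fBm_coeff_uminus by simp
    have re: "Re (?z n) = \<sigma>2 n * ((cmod (?c n s))\<^sup>2 + (cmod (?c n t))\<^sup>2 - (cmod (?c n \<bar>s - t\<bar>))\<^sup>2) / 2" for n
    proof -
      have "cmod (?c n \<bar>s - t\<bar>) = cmod (?c n s - ?c n t)"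
        using cmod_fBm_coeff_diff[of T "\<omega> n" s t] cmod_fBm_coeff_diff[of T "\<omega> n" t s]
        by (cases "s \<ge> t") (auto simp: abs_if norm_minus_commute)
      moreover have "(cmod a)\<^sup>2 + (cmod b)\<^sup>2 - (cmod (a - b))\<^sup>2 = 2 * Re (a * cnj b)" for a b
        unfolding cmod_power2 by (simp add: power2_eq_square algebra_simps)
      ultimately have "(cmod (?c n s))\<^sup>2 + (cmod (?c n t))\<^sup>2 - (cmod (?c n \<bar>s - t\<bar>))\<^sup>2 = 2 * Re (?c n s * cnj (?c n t))"
        by (simp only:)
      note e = this
      have "Re (of_real r * w) = r * (2 * Re w) / 2" for r w by simp
      then show ?thesis unfolding e .
    qed
    have "(\<Sum>n\<in>{- int N..int N}. Im (?z n)) = 0"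
      using sym by (rule sum_Im_symmetric)
    then have im: "Im (\<Sum>n\<in>{- int N..int N}. ?z n) = 0" by simp
    have "Re (\<Sum>n\<in>{- int N..int N}. ?z n) = (\<Sum>n\<in>{- int N..int N}. Re (?z n))" by simp
    also have "\<dots> = (?S N s + ?S N t - ?S N \<bar>s - t\<bar>) / 2"
      unfolding re by (simp add: sum_divide_distrib[symmetric] sum.distrib[symmetric] sum_subtractf[symmetric] algebra_simps)
    finally show ?thesis using im by (simp only: complex_eq_iff Re_complex_of_real Im_complex_of_real)
  qed
  have "(\<lambda>N. (?S N s + ?S N t - ?S N \<bar>s - t\<bar>) / 2) \<longlonglongrightarrow> (s powr (2 * H) + t powr (2 * H) - \<bar>s - t\<bar> powr (2 * H)) / 2"
    using s t by (intro tendsto_intros variance_limit) auto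
  then show ?thesis unfolding eq by (intro tendsto_of_real)
qed

lemma \<omega>_growth: "\<exists>K>0. \<forall>k. real k \<le> K * (\<omega> (int k)) ^ 4"
proof -
  obtain K where K: "K > 0" "\<And>k. real k \<le> K * (1 + (\<omega> (int k))\<^sup>2 / 4)\<^sup>2" using lam_growth by blast
  have w1: "\<omega> 1 > 0" by (rule \<omega>_pos) simp
  define K' where "K' = K * (1 / (\<omega> 1)\<^sup>2 + 1 / 4)\<^sup>2"
  have "K' > 0" unfolding K'_def using K w1 by (intro mult_pos_pos zero_less_power add_pos_pos) auto
  moreover have "real k \<le> K' * (\<omega> (int k)) ^ 4" for k
  proof (cases "k = 0")
    case False
    then have "\<omega> 1 \<le> \<omega> (int k)" using mono by (simp add: strict_mono_less_eq)
    then have "(\<omega> 1)\<^sup>2 \<le> (\<omega> (int k))\<^sup>2" using w1 by (intro power_mono) auto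
    then have "1 \<le> (\<omega> (int k))\<^sup>2 / (\<omega> 1)\<^sup>2" using w1 by simp
    then have "1 + (\<omega> (int k))\<^sup>2 / 4 \<le> (1 / (\<omega> 1)\<^sup>2 + 1 / 4) * (\<omega> (int k))\<^sup>2"
      by (simp add: algebra_simps)
    then have "(1 + (\<omega> (int k))\<^sup>2 / 4)\<^sup>2 \<le> ((1 / (\<omega> 1)\<^sup>2 + 1 / 4) * (\<omega> (int k))\<^sup>2)\<^sup>2"
      by (intro power_mono) auto
    then have "K * (1 + (\<omega> (int k))\<^sup>2 / 4)\<^sup>2 \<le> K * ((1 / (\<omega> 1)\<^sup>2 + 1 / 4) * (\<omega> (int k))\<^sup>2)\<^sup>2"
      using K by (intro mult_left_mono) auto
    also have "\<dots> = K' * (\<omega> (int k)) ^ 4" by (simp add: K'_def power_mult_distrib power_mult[symmetric])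
    finally show ?thesis using K(2)[of k] by linarith
  qed (simp add: \<omega>_0)
  ultimately show ?thesis by blast
qed

lemma summable_\<sigma>2: "summable (\<lambda>k. \<sigma>2 (int k) / (\<omega> (int k))\<^sup>2 * \<omega> (int k) powr H)"
proof -
  let ?a = "\<lambda>k. \<sigma>2 (int k) / (\<omega> (int k))\<^sup>2"
  obtain N0 where N0: "\<And>N. N \<ge> N0 \<Longrightarrow> (\<omega> (int N))\<^sup>2 / 4 > 1" using lam_unbounded by blast
  have ev: "eventually (\<lambda>k. \<omega> (int k) \<ge> 1) sequentially"
    unfolding eventually_sequentially
  proof (intro exI allI impI)
    fix k assume "N0 \<le> k"
    then have "1\<^sup>2 \<le> (\<omega> (int k))\<^sup>2" using N0[of k] by simp
    then show "\<omega> (int k) \<ge> 1" using \<omega>_nat_nonneg[of k] by (rule power2_le_imp_le)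
  qed
  define D where "D = pi / (4 * (Gamma (H + 1 / 2))\<^sup>2) * Beta (1 - H) (2 * H) / W"
  show ?thesis
  proof (rule summable_powr_of_sin_square_bound[OF H0 _ ev, where D = D])
    show "?a k \<ge> 0" for k using \<sigma>2_nonneg by simp
    fix u :: real and N assume u: "0 < u" "u \<le> 1"
    let ?g = "\<lambda>k. (sinc_at (\<omega> (int k)) u)\<^sup>2 / nrm k"
    have g: "?g sums (pi / (4 * (Gamma (H + 1 / 2))\<^sup>2) * (u powr (2 * H) * Beta (1 - H) (2 * H)))"
      by (rule sinc_expansion) (use u in auto)
    have "(\<Sum>k<N. ?a k * (sin (\<omega> (int k) * u))\<^sup>2) \<le> (\<Sum>k<N. ?g k / W)"
    proof (rule sum_mono)
      fix k
      show "?a k * (sin (\<omega> (int k) * u))\<^sup>2 \<le> ?g k / W"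
      proof (cases "k = 0")
        \<comment> \<open>Since \<open>\<omega> 0 = 0\<close> and \<open>x / 0 = 0\<close>, the left
          side vanishes.\<close>
        case True then show ?thesis using W_pos nrm_pos[of 0] by (simp add: \<omega>_0)
      next
        case False
        have "?a k * (sin (\<omega> (int k) * u))\<^sup>2 = ?g k / W / 2"
          unfolding inv_sigma_sq_nat using False \<omega>_eq_0_iff[of "int k"] by (simp add: sinc_at_def power_divide mult_ac)
        also have "\<dots> \<le> ?g k / W"
        proof -
          have "x / 2 \<le> x" if "x \<ge> 0" for x :: real using that by simp
          moreover have "?g k / W \<ge> 0" using W_pos nrm_pos[of k] by (intro divide_nonneg_pos zero_le_power2)
          ultimately show ?thesis by blast
        qed
        finally show ?thesis .
      qed
    qed
    also have "\<dots> = (\<Sum>k<N. ?g k) / W" by (simp add: sum_divide_distrib)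
    also have "\<dots> \<le> (pi / (4 * (Gamma (H + 1 / 2))\<^sup>2) * (u powr (2 * H) * Beta (1 - H) (2 * H))) / W"
      using sums_unique[OF g] sum_le_suminf[OF sums_summable[OF g], of "{..<N}"] W_pos nrm_pos
      by (intro divide_right_mono) (auto simp: less_imp_le)
    also have "\<dots> = D * u powr (2 * H)" by (simp add: D_def)
    finally show "(\<Sum>k<N. ?a k * (sin (\<omega> (int k) * u))\<^sup>2) \<le> D * u powr (2 * H)" .
  qed
qed

end

section \<open>Centered Gaussian variables\<close>

lemma char_scaled_std_normal:
  "char (distr std_normal_distribution borel (\<lambda>x. c * x)) t = of_real (exp (- (t\<^sup>2 * c\<^sup>2 / 2)))"
proof -
  have "char (distr std_normal_distribution borel (\<lambda>x. c * x)) t = char std_normal_distribution (t * c)"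
    unfolding char_def by (subst integral_distr) (auto simp: mult_ac)
  then show ?thesis unfolding char_std_normal_distribution by (simp add: power_mult_distrib)
qed

context prob_space
begin

text \<open>Stated with the characteristic function, so that variance 0 is included and the class is
  visibly stable under independent sums and almost sure limits.\<close>

definition centered_gaussian :: "real \<Rightarrow> ('a \<Rightarrow> real) \<Rightarrow> bool" where
  "centered_gaussian v X \<longleftrightarrow> X \<in> borel_measurable M \<and> v \<ge> 0 \<and>
     (\<forall>t. char (distr M borel X) t = of_real (exp (- (t\<^sup>2 * v / 2))))"

text \<open>By Levy's uniqueness theorem the law is that of a multiple of a standard normal
  variable, which covers \<open>v = 0\<close> too; all moments are read off from there.\<close>

lemma centered_gaussian_distr:
  assumes "centered_gaussian v X"
  shows "distr M borel X = distr std_normal_distribution borel (\<lambda>x. sqrt v * x)"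
proof (rule Levy_uniqueness)
  have X: "X \<in> borel_measurable M" "v \<ge> 0" using assms by (auto simp: centered_gaussian_def)
  show "real_distribution (distr M borel X)" using X by simp
  show "real_distribution (distr std_normal_distribution borel (\<lambda>x. sqrt v * x))"
    using real_dist_normal_dist by (intro prob_space.real_distribution_distr) (auto simp: real_distribution_def)
  show "char (distr M borel X) = char (distr std_normal_distribution borel (\<lambda>x. sqrt v * x))"
    using assms X(2) by (intro ext) (simp add: centered_gaussian_def char_scaled_std_normal)
qed

lemma centered_gaussian_moment:
  assumes "centered_gaussian v X"
  shows "integrable M (\<lambda>w. X w ^ k)"
    and "expectation (\<lambda>w. X w ^ k) = sqrt v ^ k * integral\<^sup>L std_normal_distribution (\<lambda>x. x ^ k)"
proof -
  have X [measurable]: "X \<in> borel_measurable M" using assms by (auto simp: centered_gaussian_def)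
  have "integrable std_normal_distribution (\<lambda>x. (sqrt v * x) ^ k)"
    unfolding power_mult_distrib by (intro integrable_mult_right integrable_std_normal_distribution_moment)
  then have "integrable (distr std_normal_distribution borel (\<lambda>x. sqrt v * x)) (\<lambda>x. x ^ k)"
    by (subst integrable_distr_eq) auto
  then have "integrable (distr M borel X) (\<lambda>x. x ^ k)" unfolding centered_gaussian_distr[OF assms] .
  then show "integrable M (\<lambda>w. X w ^ k)" by (subst (asm) integrable_distr_eq) auto
  have "expectation (\<lambda>w. X w ^ k) = integral\<^sup>L (distr M borel X) (\<lambda>x. x ^ k)"
    by (subst integral_distr) auto
  also have "\<dots> = integral\<^sup>L std_normal_distribution (\<lambda>x. (sqrt v * x) ^ k)"
    unfolding centered_gaussian_distr[OF assms] by (subst integral_distr) auto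
  finally show "expectation (\<lambda>w. X w ^ k) = sqrt v ^ k * integral\<^sup>L std_normal_distribution (\<lambda>x. x ^ k)"
    by (simp add: power_mult_distrib)
qed

lemma centered_gaussian_mean:
  assumes "centered_gaussian v X"
  shows "integrable M X" "expectation X = 0"
  using centered_gaussian_moment[OF assms, of 1] integral_std_normal_distribution_moment_odd[of 1] by simp_all

lemma centered_gaussian_variance:
  assumes "centered_gaussian v X"
  shows "integrable M (\<lambda>w. (X w)\<^sup>2)" "expectation (\<lambda>w. (X w)\<^sup>2) = v"
proof -
  have "integral\<^sup>L std_normal_distribution (\<lambda>x. x ^ 2) = 1"
    using std_normal_distribution_even_moments(1)[of 1] by (simp add: fact_2)
  then show "integrable M (\<lambda>w. (X w)\<^sup>2)" "expectation (\<lambda>w. (X w)\<^sup>2) = v"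
    using centered_gaussian_moment[OF assms, of 2] assms by (simp_all add: centered_gaussian_def)
qed

lemma centered_gaussian_imp_gaussian_real:
  assumes "centered_gaussian v X"
  shows "gaussian_real M X"
proof (cases "v > 0")
  case False
  then have "v = 0" using assms by (simp add: centered_gaussian_def)
  then have "expectation (\<lambda>w. (X w)\<^sup>2) = 0" using centered_gaussian_variance(2)[OF assms] by simp
  then have "AE w in M. (X w)\<^sup>2 = 0"
    using integral_nonneg_eq_0_iff_AE[OF centered_gaussian_variance(1)[OF assms]] by simp
  then have "AE w in M. X w = 0" by eventually_elim simp
  then show ?thesis using assms by (auto simp: gaussian_real_def centered_gaussian_def)
next
  case True
  interpret N: prob_space std_normal_distribution using real_dist_normal_dist by (simp add: real_distribution_def)
  have "distributed std_normal_distribution lborel (\<lambda>x. x) std_normal_density"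
    by (simp add: distributed_def distr_id2)
  then have "distributed std_normal_distribution lborel (\<lambda>x. 0 + sqrt v * x) (normal_density (0 + sqrt v * 0) (\<bar>sqrt v\<bar> * 1))"
    using True by (intro N.normal_density_affine) auto
  then have "distr std_normal_distribution lborel (\<lambda>x. sqrt v * x) = density lborel (normal_density 0 (sqrt v))"
    using True by (simp add: distributed_def)
  moreover have "distr M lborel X = distr M borel X"
    "distr std_normal_distribution lborel (\<lambda>x. sqrt v * x) = distr std_normal_distribution borel (\<lambda>x. sqrt v * x)"
    by (auto intro!: distr_cong)
  ultimately have "distributed M lborel X (normal_density 0 (sqrt v))"
    using assms centered_gaussian_distr[OF assms] by (simp add: distributed_def centered_gaussian_def)
  then show ?thesis using True assms unfolding gaussian_real_def centered_gaussian_def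
    by (intro conjI disjI1 exI[of _ 0] exI[of _ "sqrt v"]) auto
qed

lemma char_distr: "X \<in> borel_measurable M \<Longrightarrow> char (distr M borel X) t = (CLINT w|M. iexp (t * X w))"
  unfolding char_def by (subst integral_distr) auto

lemma centered_gaussian_zero: "centered_gaussian 0 (\<lambda>w. 0)"
  unfolding centered_gaussian_def by (intro conjI allI, simp, simp, subst char_distr) (auto simp: prob_space)

lemma gaussian_real_shift:
  assumes X: "gaussian_real M X"
  obtains \<mu> v where "centered_gaussian v (\<lambda>w. X w - \<mu>)"
proof -
  have [measurable]: "X \<in> borel_measurable M" using X by (simp add: gaussian_real_def)
  consider \<mu> where "AE w in M. X w = \<mu>" | \<mu> \<sigma> where "\<sigma> > 0" "distributed M lborel X (normal_density \<mu> \<sigma>)"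
    using X by (auto simp: gaussian_real_def)
  then show ?thesis
  proof cases
    case 1
    have "char (distr M borel (\<lambda>w. X w - \<mu>)) t = char (distr M borel (\<lambda>w. 0)) t" for t
    proof -
      have "(\<lambda>w. X w - \<mu>) \<in> borel_measurable M" "(\<lambda>w. 0 :: real) \<in> borel_measurable M" by measurable
      from this[THEN char_distr] show ?thesis
        using 1 by (simp only:) (intro integral_cong_AE, auto)
    qed
    then show ?thesis
      using that[of 0 \<mu>] centered_gaussian_zero by (simp add: centered_gaussian_def)
  next
    case 2
    then have "distributed M lborel (\<lambda>w. (X w - \<mu>) / \<sigma>) std_normal_density"
      using normal_standard_normal_convert by blast
    then have std: "distr M borel (\<lambda>w. (X w - \<mu>) / \<sigma>) = std_normal_distribution"
      unfolding distributed_def by (metis distr_cong sets_lborel)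
    have "char (distr M borel (\<lambda>w. X w - \<mu>)) t = char (distr M borel (\<lambda>w. (X w - \<mu>) / \<sigma>)) (t * \<sigma>)" for t
      using 2(1) by (subst (1 2) char_distr) auto
    then have "centered_gaussian (\<sigma>\<^sup>2) (\<lambda>w. X w - \<mu>)"
      unfolding std char_std_normal_distribution by (simp add: centered_gaussian_def power_mult_distrib)
    then show ?thesis by (rule that)
  qed
qed

lemma gaussian_real_integrable:
  assumes X: "gaussian_real M X"
  shows "integrable M X" "integrable M (\<lambda>w. (X w)\<^sup>2)"
proof -
  obtain \<mu> v where c: "centered_gaussian v (\<lambda>w. X w - \<mu>)" using gaussian_real_shift[OF X] .
  note i = centered_gaussian_mean(1)[OF c] centered_gaussian_variance(1)[OF c]
  have "integrable M (\<lambda>w. (X w - \<mu>) + \<mu>)" using i by (intro Bochner_Integration.integrable_add) auto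
  then show "integrable M X" by simp
  have "integrable M (\<lambda>w. (X w - \<mu>)\<^sup>2 + 2 * \<mu> * (X w - \<mu>) + \<mu>\<^sup>2)"
    using i by (intro Bochner_Integration.integrable_add integrable_mult_right) auto
  then show "integrable M (\<lambda>w. (X w)\<^sup>2)" by (simp add: power2_eq_square algebra_simps)
qed

lemma gaussian_real_imp_centered:
  assumes X: "gaussian_real M X" and mean: "expectation X = 0"
  shows "centered_gaussian (expectation (\<lambda>w. (X w)\<^sup>2)) X"
proof -
  obtain \<mu> v where c: "centered_gaussian v (\<lambda>w. X w - \<mu>)" using gaussian_real_shift[OF X] .
  have "expectation (\<lambda>w. X w - \<mu>) = - \<mu>"
    using gaussian_real_integrable(1)[OF X] by (simp add: mean prob_space)
  then have "\<mu> = 0" using centered_gaussian_mean(2)[OF c] by simp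
  then have "centered_gaussian v X" using c by simp
  then show ?thesis using centered_gaussian_variance(2) by simp
qed

lemma centered_gaussian_sum:
  assumes "finite I" "indep_vars (\<lambda>_. borel) X I" "\<And>i. i \<in> I \<Longrightarrow> centered_gaussian (v i) (X i)"
  shows "centered_gaussian (\<Sum>i\<in>I. v i) (\<lambda>w. \<Sum>i\<in>I. X i w)"
proof -
  have "(\<lambda>w. \<Sum>i\<in>I. X i w) \<in> borel_measurable M"
    using assms(3) by (intro borel_measurable_sum) (auto simp: centered_gaussian_def)
  moreover have "(\<Sum>i\<in>I. v i) \<ge> 0" using assms(3) by (intro sum_nonneg) (auto simp: centered_gaussian_def)
  moreover have "char (distr M borel (\<lambda>w. \<Sum>i\<in>I. X i w)) t = of_real (exp (- (t\<^sup>2 * (\<Sum>i\<in>I. v i) / 2)))" for t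
  proof -
    have "char (distr M borel (\<lambda>w. \<Sum>i\<in>I. X i w)) t = (\<Prod>i\<in>I. of_real (exp (- (t\<^sup>2 * v i / 2))))"
      unfolding char_distr_sum[OF assms(2)] using assms(3) by (intro prod.cong) (auto simp: centered_gaussian_def)
    also have "\<dots> = of_real (exp (\<Sum>i\<in>I. - (t\<^sup>2 * v i / 2)))" using assms(1) by (simp add: exp_sum del: exp_of_real)
    also have "(\<Sum>i\<in>I. - (t\<^sup>2 * v i / 2)) = - (t\<^sup>2 * (\<Sum>i\<in>I. v i) / 2)"
      by (simp add: sum_negf sum_distrib_left sum_divide_distrib)
    finally show ?thesis .
  qed
  ultimately show ?thesis by (simp add: centered_gaussian_def)
qed

text \<open>The characteristic functions converge by dominated convergence with the constant bound
  1.\<close>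

lemma centered_gaussian_limit:
  assumes X: "\<And>n::nat. centered_gaussian (v n) (X n)" and Y [measurable]: "Y \<in> borel_measurable M"
    and lim: "AE w in M. (\<lambda>n. X n w) \<longlonglongrightarrow> Y w" and v: "v \<longlonglongrightarrow> v'"
  shows "centered_gaussian v' Y"
proof -
  have [measurable]: "X n \<in> borel_measurable M" for n using X by (simp add: centered_gaussian_def)
  have "v' \<ge> 0" using v by (rule LIMSEQ_le_const) (use X in \<open>auto simp: centered_gaussian_def\<close>)
  moreover have "char (distr M borel Y) t = of_real (exp (- (t\<^sup>2 * v' / 2)))" for t
  proof (rule LIMSEQ_unique)
    have "(\<lambda>n. CLINT w|M. iexp (t * X n w)) \<longlonglongrightarrow> (CLINT w|M. iexp (t * Y w))"
    proof (rule integral_dominated_convergence[where w = "\<lambda>_. 1"])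
      show "AE w in M. (\<lambda>n. iexp (t * X n w)) \<longlonglongrightarrow> iexp (t * Y w)"
        using lim by eventually_elim (intro tendsto_intros)
    qed auto
    then show "(\<lambda>n. char (distr M borel (X n)) t) \<longlonglongrightarrow> char (distr M borel Y) t"
      unfolding char_def by (simp add: integral_distr)
    have "(\<lambda>n. complex_of_real (exp (- (t\<^sup>2 * v n / 2)))) \<longlonglongrightarrow> of_real (exp (- (t\<^sup>2 * v' / 2)))"
      by (intro tendsto_of_real tendsto_exp tendsto_minus tendsto_divide tendsto_mult tendsto_const v) auto
    then show "(\<lambda>n. char (distr M borel (X n)) t) \<longlonglongrightarrow> of_real (exp (- (t\<^sup>2 * v' / 2)))"
      using X by (simp add: centered_gaussian_def)
  qed
  ultimately show ?thesis by (simp add: centered_gaussian_def)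
qed

text \<open>Markov's inequality for the moment of order \<open>2 * k\<close>. The free
  \<open>k\<close> produces any power of decay even when the threshold grows like a small power
  only.\<close>

lemma centered_gaussian_tail:
  assumes X: "centered_gaussian v X" and a: "a > 0" and v: "v \<le> V"
  shows "prob {w \<in> space M. a \<le> \<bar>X w\<bar>} \<le> fact (2 * k) / (2 ^ k * fact k) * V ^ k / a ^ (2 * k)"
proof -
  have [measurable]: "X \<in> borel_measurable M" and v0: "v \<ge> 0" using X by (auto simp: centered_gaussian_def)
  have "prob {w \<in> space M. a \<le> \<bar>X w\<bar>} \<le> prob {w \<in> space M. a ^ (2 * k) \<le> X w ^ (2 * k)}"
  proof (rule finite_measure_mono)
    show "{w \<in> space M. a \<le> \<bar>X w\<bar>} \<subseteq> {w \<in> space M. a ^ (2 * k) \<le> X w ^ (2 * k)}"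
    proof safe
      fix w assume "a \<le> \<bar>X w\<bar>"
      then have "a ^ (2 * k) \<le> \<bar>X w\<bar> ^ (2 * k)" using a by (intro power_mono) auto
      then show "a ^ (2 * k) \<le> X w ^ (2 * k)" by (simp add: power_even_abs)
    qed
  qed measurable
  also have "\<dots> \<le> expectation (\<lambda>w. X w ^ (2 * k)) / a ^ (2 * k)"
    using a by (intro integral_Markov_inequality_measure[where A = "{}"] centered_gaussian_moment(1)[OF X]) auto
  also have "expectation (\<lambda>w. X w ^ (2 * k)) = v ^ k * (fact (2 * k) / (2 ^ k * fact k))"
    unfolding centered_gaussian_moment(2)[OF X] std_normal_distribution_even_moments(1)
    using v0 by (simp add: power_mult)
  also have "v ^ k * (fact (2 * k) / (2 ^ k * fact k)) / a ^ (2 * k) \<le> V ^ k * (fact (2 * k) / (2 ^ k * fact k)) / a ^ (2 * k)"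
    using a v v0 by (intro divide_right_mono mult_right_mono power_mono) auto
  finally show ?thesis by (simp add: mult_ac)
qed

end

section \<open>Linear combinations of independent complex Gaussian variables\<close>

locale gaussian_sequence = prob_space M for M :: "'a measure" +
  fixes Z :: "'i \<Rightarrow> 'a \<Rightarrow> complex" and s :: "'i \<Rightarrow> real"
  assumes indep: "indep_vars (\<lambda>_. borel) Z UNIV"
    and gaussian: "\<And>n. gaussian_complex M (Z n)"
    and mean: "\<And>n. integral\<^sup>L M (Z n) = 0"
    and variance_Z: "\<And>n. integral\<^sup>L M (\<lambda>w. (cmod (Z n w))\<^sup>2) = s n"
begin

lemma Z_measurable [measurable]: "Z n \<in> borel_measurable M"
  using gaussian[of n] by (simp add: gaussian_complex_def)

lemma square_integrable_Re: "integrable M (\<lambda>w. (Re (Z n w))\<^sup>2)"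
  and square_integrable_Im: "integrable M (\<lambda>w. (Im (Z n w))\<^sup>2)"
  and integrable_Z: "integrable M (Z n)"
proof -
  have re: "gaussian_real M (\<lambda>w. Re (Z n w))" and im: "gaussian_real M (\<lambda>w. Im (Z n w))"
    using gaussian[of n] unfolding gaussian_complex_def
    by (auto dest: spec[of _ 1] spec[of _ "- \<i>"])
  show "integrable M (\<lambda>w. (Re (Z n w))\<^sup>2)" "integrable M (\<lambda>w. (Im (Z n w))\<^sup>2)"
    by (rule gaussian_real_integrable(2)[OF re], rule gaussian_real_integrable(2)[OF im])
  have "integrable M (\<lambda>w. of_real (Re (Z n w)) + \<i> * of_real (Im (Z n w)))"
    by (intro Bochner_Integration.integrable_add integrable_mult_right integrable_of_real
        gaussian_real_integrable(1)[OF re] gaussian_real_integrable(1)[OF im])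
  then show "integrable M (Z n)" by (simp add: complex_eq[symmetric])
qed

lemma square_integrable_Z: "integrable M (\<lambda>w. (cmod (Z n w))\<^sup>2)"
  unfolding cmod_power2 by (intro Bochner_Integration.integrable_add square_integrable_Re square_integrable_Im)

lemma s_nonneg: "s n \<ge> 0"
  unfolding variance_Z[symmetric] by simp

text \<open>In the absence of circular symmetry this depends on the argument of \<open>d\<close>;
  \<open>var_le\<close> bounds it by the modulus alone.\<close>

definition var :: "complex \<Rightarrow> 'i \<Rightarrow> real" where
  "var d n = expectation (\<lambda>w. (Re (d * Z n w))\<^sup>2)"

lemma var_nonneg: "var d n \<ge> 0" by (simp add: var_def)

lemma var_le: "var d n \<le> (cmod d)\<^sup>2 * s n"
proof -
  have le: "(Re (d * Z n w))\<^sup>2 \<le> (cmod d)\<^sup>2 * (cmod (Z n w))\<^sup>2" for w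
    using abs_Re_le_cmod[of "d * Z n w"] power_mono[of "\<bar>Re (d * Z n w)\<bar>" "cmod (d * Z n w)" 2]
    by (simp only: power2_abs norm_mult power_mult_distrib abs_ge_zero)
  have i: "integrable M (\<lambda>w. (cmod d)\<^sup>2 * (cmod (Z n w))\<^sup>2)"
    by (intro integrable_mult_right square_integrable_Z)
  have "var d n \<le> expectation (\<lambda>w. (cmod d)\<^sup>2 * (cmod (Z n w))\<^sup>2)"
    unfolding var_def
  proof (rule integral_mono)
    show "integrable M (\<lambda>w. (Re (d * Z n w))\<^sup>2)"
      by (rule Bochner_Integration.integrable_bound[OF i]) (use le in \<open>auto simp del: times_complex.simps\<close>)
  qed (use i le in auto)
  then show ?thesis by (simp add: variance_Z)
qed

lemma gaussian_Re: "centered_gaussian (var d n) (\<lambda>w. Re (d * Z n w))"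
  unfolding var_def
proof (rule gaussian_real_imp_centered)
  show "gaussian_real M (\<lambda>w. Re (d * Z n w))" using gaussian[of n] by (simp add: gaussian_complex_def)
  have "expectation (\<lambda>w. Re (d * Z n w)) = Re (integral\<^sup>L M (\<lambda>w. d * Z n w))"
    using integrable_Z by (intro integral_Re) auto
  then show "expectation (\<lambda>w. Re (d * Z n w)) = 0" by (simp add: mean)
qed

lemma gaussian_sum:
  assumes "finite F"
  shows "centered_gaussian (\<Sum>n\<in>F. var (d n) n) (\<lambda>w. Re (\<Sum>n\<in>F. d n * Z n w))"
proof -
  have "indep_vars (\<lambda>_. borel) Z F" using indep by (rule indep_vars_subset) auto
  then have "indep_vars (\<lambda>_. borel) (\<lambda>n w. Re (d n * Z n w)) F"
    by (rule indep_vars_compose2[where Y = "\<lambda>n z. Re (d n * z)"]) auto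
  then have "centered_gaussian (\<Sum>n\<in>F. var (d n) n) (\<lambda>w. \<Sum>n\<in>F. Re (d n * Z n w))"
    using assms by (intro centered_gaussian_sum gaussian_Re)
  then show ?thesis by (simp only: Re_sum)
qed

lemma covariance_Z: 
  "integrable M (\<lambda>w. Z m w * cnj (Z n w))"
  "integral\<^sup>L M (\<lambda>w. Z m w * cnj (Z n w)) = (if m = n then of_real (s n) else 0)"
proof -
  have "integrable M (\<lambda>w. Z m w * cnj (Z n w)) \<and> integral\<^sup>L M (\<lambda>w. Z m w * cnj (Z n w)) = (if m = n then of_real (s n) else 0)"
  proof (cases "m = n")
    case True
    have "integrable M (\<lambda>w. complex_of_real ((cmod (Z n w))\<^sup>2))" by (intro integrable_of_real square_integrable_Z)
    moreover have "integral\<^sup>L M (\<lambda>w. complex_of_real ((cmod (Z n w))\<^sup>2)) = of_real (s n)"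
      by (simp only: integral_complex_of_real variance_Z)
    ultimately show ?thesis using True by (simp only: complex_norm_square) simp
  next
    case False
    \<comment> \<open>Conjugating one of two independent variables keeps them independent, so the
      expectation of the product factorizes.\<close>
    define Y where "Y i w = (if i = m then Z i w else cnj (Z i w))" for i w
    have ind: "indep_vars (\<lambda>_. borel) Y {m, n}"
      unfolding Y_def[abs_def]
    proof (rule indep_vars_compose2[where Y = "\<lambda>i z. if i = m then z else cnj z"])
      show "indep_vars (\<lambda>_. borel) Z {m, n}" using indep by (rule indep_vars_subset) auto
      have "(\<lambda>z. cnj z) \<in> borel_measurable borel"
        by (intro borel_measurable_continuous_onI continuous_on_cnj continuous_on_id)
      then show "(\<lambda>z. if i = m then z else cnj z) \<in> borel_measurable borel" for i
        by (cases "i = m") auto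
    qed
    have int: "integrable M (Y i)" for i
      unfolding Y_def[abs_def] using integrable_Z by (cases "i = m") auto
    have e: "(\<Prod>i\<in>{m, n}. Y i w) = Z m w * cnj (Z n w)" for w using False by (auto simp: Y_def)
    have "integral\<^sup>L M (Y m) = 0" unfolding Y_def[abs_def] using mean[of m] by simp
    then show ?thesis
      using indep_vars_integrable[OF _ ind int] indep_vars_lebesgue_integral[OF _ ind int] False
      unfolding e by simp
  qed
  then show "integrable M (\<lambda>w. Z m w * cnj (Z n w))"
    "integral\<^sup>L M (\<lambda>w. Z m w * cnj (Z n w)) = (if m = n then of_real (s n) else 0)" by auto
qed

lemma covariance_sum:
  assumes "finite F"
  shows "integrable M (\<lambda>w. (\<Sum>n\<in>F. a n * Z n w) * cnj (\<Sum>n\<in>F. b n * Z n w))"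
    and "integral\<^sup>L M (\<lambda>w. (\<Sum>n\<in>F. a n * Z n w) * cnj (\<Sum>n\<in>F. b n * Z n w)) = (\<Sum>n\<in>F. of_real (s n) * (a n * cnj (b n)))"
proof -
  have e: "(\<Sum>n\<in>F. a n * Z n w) * cnj (\<Sum>n\<in>F. b n * Z n w) = (\<Sum>m\<in>F. \<Sum>n\<in>F. (a m * cnj (b n)) * (Z m w * cnj (Z n w)))" for w
    by (simp add: sum_product mult_ac)
  show "integrable M (\<lambda>w. (\<Sum>n\<in>F. a n * Z n w) * cnj (\<Sum>n\<in>F. b n * Z n w))"
    unfolding e by (intro Bochner_Integration.integrable_sum integrable_mult_right covariance_Z)
  have "integral\<^sup>L M (\<lambda>w. (\<Sum>n\<in>F. a n * Z n w) * cnj (\<Sum>n\<in>F. b n * Z n w))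
     = (\<Sum>m\<in>F. \<Sum>n\<in>F. (a m * cnj (b n)) * (if m = n then of_real (s n) else 0))"
    unfolding e covariance_Z(2)[symmetric]
    by (subst Bochner_Integration.integral_sum, intro Bochner_Integration.integrable_sum integrable_mult_right covariance_Z,
        intro sum.cong refl, subst Bochner_Integration.integral_sum, intro integrable_mult_right covariance_Z)
       simp
  also have "\<dots> = (\<Sum>m\<in>F. \<Sum>n\<in>F. if m = n then of_real (s n) * (a n * cnj (b n)) else 0)"
    by (intro sum.cong) auto
  also have "\<dots> = (\<Sum>n\<in>F. of_real (s n) * (a n * cnj (b n)))" using assms by simp
  finally show "integral\<^sup>L M (\<lambda>w. (\<Sum>n\<in>F. a n * Z n w) * cnj (\<Sum>n\<in>F. b n * Z n w)) = (\<Sum>n\<in>F. of_real (s n) * (a n * cnj (b n)))" .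
qed

end

section \<open>Uniform convergence\<close>

lemma summation_by_parts:
  fixes U :: "nat \<Rightarrow> complex" and v :: "nat \<Rightarrow> real"
  assumes "U 0 = 0"
  shows "(\<Sum>k=1..N. of_real (v k) * (U k - U (k - 1))) = of_real (v N) * U N + (\<Sum>k<N. of_real (v k - v (Suc k)) * U k)"
  using assms by (induction N) (auto simp: algebra_simps)

text \<open>With p and q the square roots of \<open>v k\<close> and \<open>v (Suc k)\<close>, the
  factor p^2 - q^2 is at most 2 p (p - q), and p |U| is at most B. The terms are thus dominated by 2
  B (p - q), a telescoping series. The index 0 is exempt from the conditions on \<open>v\<close>,
  since the frequency there is 0 in the application.\<close>

lemma uniform_limit_by_parts:
  fixes U :: "nat \<Rightarrow> 'b \<Rightarrow> complex" and v :: "nat \<Rightarrow> real"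
  assumes U0: "\<And>t. U 0 t = 0" and v: "\<And>k. k \<ge> 1 \<Longrightarrow> 0 < v k \<and> v (Suc k) \<le> v k" "v \<longlonglongrightarrow> 0"
    and B: "\<And>N t. N \<ge> N1 \<Longrightarrow> t \<in> S \<Longrightarrow> cmod (U N t) * sqrt (v N) \<le> B"
  shows "\<exists>l. uniform_limit S (\<lambda>N t. \<Sum>k=1..N. of_real (v k) * (U k t - U (k - 1) t)) l sequentially"
proof -
  have sv: "(\<lambda>k. sqrt (v k)) \<longlonglongrightarrow> 0" using tendsto_real_sqrt[OF v(2)] by simp
  have 1: "uniform_limit S (\<lambda>N t. of_real (v N) * U N t) (\<lambda>_. 0) sequentially"
  proof (rule uniform_limitI)
    fix e :: real assume e: "e > 0"
    have "(\<lambda>k. \<bar>B\<bar> * sqrt (v k)) \<longlonglongrightarrow> \<bar>B\<bar> * 0" by (intro tendsto_intros sv)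
    then have "eventually (\<lambda>k. \<bar>B\<bar> * sqrt (v k) < e) sequentially" using e by (simp add: order_tendstoD)
    then show "\<forall>\<^sub>F n in sequentially. \<forall>x\<in>S. dist (of_real (v n) * U n x) 0 < e"
      using eventually_ge_at_top[of "max 1 N1"]
    proof eventually_elim
      case (elim n)
      show ?case
      proof
        fix t assume "t \<in> S"
        then have b: "cmod (U n t) * sqrt (v n) \<le> B" using B elim by simp
        have vn: "v n > 0" using v(1)[of n] elim by simp
        have "dist (of_real (v n) * U n t) 0 = (cmod (U n t) * sqrt (v n)) * sqrt (v n)"
          using vn by (simp add: norm_mult mult.assoc)
        also have "\<dots> \<le> \<bar>B\<bar> * sqrt (v n)" using b vn by (intro mult_right_mono) auto
        finally show "dist (of_real (v n) * U n t) 0 < e" using elim by simp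
      qed
    qed
  qed
  have 2: "uniform_limit S (\<lambda>N t. \<Sum>k<N. of_real (v k - v (Suc k)) * U k t)
      (\<lambda>t. \<Sum>k. of_real (v k - v (Suc k)) * U k t) sequentially"
  proof (rule Weierstrass_m_test_ev)
    show "summable (\<lambda>k. 2 * \<bar>B\<bar> * (sqrt (v k) - sqrt (v (Suc k))))"
      by (intro summable_mult telescope_summable'[OF sv])
    show "\<forall>\<^sub>F k in sequentially. \<forall>t\<in>S. norm (of_real (v k - v (Suc k)) * U k t) \<le> 2 * \<bar>B\<bar> * (sqrt (v k) - sqrt (v (Suc k)))"
      using eventually_ge_at_top[of "max 1 N1"]
    proof eventually_elim
      case (elim k)
      show ?case
      proof
        fix t assume "t \<in> S"
        then have b: "cmod (U k t) * sqrt (v k) \<le> \<bar>B\<bar>" using B[of k t] elim by simp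
        have vk: "0 < v k" "0 < v (Suc k)" "v (Suc k) \<le> v k" using v(1)[of k] v(1)[of "Suc k"] elim by auto
        define p q where "p = sqrt (v k)" "q = sqrt (v (Suc k))"
        have pq: "0 < p" "0 < q" "q \<le> p" "v k = p * p" "v (Suc k) = q * q" using vk by (auto simp: p_q_def)
        have "norm (of_real (v k - v (Suc k)) * U k t) = (v k - v (Suc k)) * cmod (U k t)"
          using vk by (simp add: norm_mult flip: of_real_diff)
        also have "\<dots> = (p - q) * ((p + q) * cmod (U k t))" unfolding pq by (simp add: algebra_simps)
        also have "\<dots> \<le> (p - q) * ((2 * p) * cmod (U k t))"
          using pq by (intro mult_left_mono mult_right_mono) auto
        also have "\<dots> \<le> (p - q) * (2 * \<bar>B\<bar>)"
          using b pq unfolding p_q_def(1)[symmetric] by (intro mult_left_mono) (auto simp: mult_ac)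
        finally show "norm (of_real (v k - v (Suc k)) * U k t) \<le> 2 * \<bar>B\<bar> * (sqrt (v k) - sqrt (v (Suc k)))"
          by (simp add: p_q_def mult_ac)
      qed
    qed
  qed
  have "(\<Sum>k=1..N. of_real (v k) * (U k t - U (k - 1) t))
      = of_real (v N) * U N t + (\<Sum>k<N. of_real (v k - v (Suc k)) * U k t)" for N t
    using summation_by_parts[of "\<lambda>k. U k t" v N] U0 by simp
  then show ?thesis using uniform_limit_add[OF 1 2] by auto
qed

section \<open>Almost sure growth of the weighted partial sums\<close>

locale gaussian_trigonometric_series = gaussian_sequence M Z s
  for M :: "'a measure" and Z :: "int \<Rightarrow> 'a \<Rightarrow> complex" and s :: "int \<Rightarrow> real" +
  fixes f :: "int \<Rightarrow> real \<Rightarrow> complex" and T p D K :: real and y :: "nat \<Rightarrow> real"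
  assumes T: "T > 0" and p: "0 < p" "p \<le> 1" and K: "K > 0"
    and f_lipschitz: "\<And>n t u. cmod (f n t - f n u) \<le> \<bar>t - u\<bar>"
    and f_bound: "\<And>k t. k \<ge> 1 \<Longrightarrow> cmod (f (int k) t) \<le> T / y k \<and> cmod (f (- int k) t) \<le> T / y k"
    and y_pos: "\<And>k. k \<ge> 1 \<Longrightarrow> y k > 0" and y_mono: "\<And>k. k \<ge> 1 \<Longrightarrow> y k \<le> y (Suc k)"
    and y_growth: "\<And>k. real k \<le> K * y k ^ 4"
    and s_sym: "\<And>n. s (- n) = s n"
    and s_summable: "\<And>N. (\<Sum>k=1..N. s (int k) / (y k)\<^sup>2 * y k powr p) \<le> D"
begin

lemma y_le: "1 \<le> j \<Longrightarrow> j \<le> k \<Longrightarrow> y j \<le> y k"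
  using y_mono by (induction k) (auto simp: le_Suc_eq intro: order_trans)

lemma D_nonneg: "D \<ge> 0" using s_summable[of 0] by simp

lemma s_le: "k \<ge> 1 \<Longrightarrow> s (int k) / (y k)\<^sup>2 * y k powr p \<le> D"
proof -
  assume k: "k \<ge> 1"
  have "s (int k) / (y k)\<^sup>2 * y k powr p \<le> (\<Sum>k=1..k. s (int k) / (y k)\<^sup>2 * y k powr p)"
    using k s_nonneg by (intro member_le_sum) auto
  then show ?thesis using s_summable[of k] by linarith
qed

text \<open>The square of this weight uses up exactly the factor \<open>y k powr p\<close> in
  \<open>s_summable\<close>, so the weighted partial sums still have bounded variance.\<close>

definition w :: "nat \<Rightarrow> real" where "w k = y k powr (p / 2)"

lemma w_pos: "k \<ge> 1 \<Longrightarrow> w k > 0" using y_pos[of k] by (simp add: w_def)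

lemma w_square: "k \<ge> 1 \<Longrightarrow> (w k)\<^sup>2 = y k powr p"
  unfolding w_def power2_eq_square by (simp flip: powr_add)

definition U :: "nat \<Rightarrow> real \<Rightarrow> 'a \<Rightarrow> complex" where
  "U N t x = (\<Sum>k=1..N. of_real (w k) * (f (int k) t * Z (int k) x + f (- int k) t * Z (- int k) x))"

lemma U_measurable [measurable]: "U N t \<in> borel_measurable M"
  unfolding U_def[abs_def] by measurable

lemma sum_nonzero_symmetric:
  fixes g :: "int \<Rightarrow> 'b::comm_monoid_add"
  shows "(\<Sum>n\<in>{- int N..int N} - {0}. g n) = (\<Sum>k=1..N. g (int k) + g (- int k))"
proof (induction N)
  case (Suc N)
  have "{- int (Suc N)..int (Suc N)} - {0} = insert (int (Suc N)) (insert (- int (Suc N)) ({- int N..int N} - {0}))" by auto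
  then show ?case using Suc by (simp add: add_ac del: of_nat_Suc)
qed simp

lemma U_eq: "c * U N t x = (\<Sum>n\<in>{- int N..int N} - {0}. (c * of_real (w (nat \<bar>n\<bar>)) * f n t) * Z n x)"
  unfolding U_def sum_nonzero_symmetric sum_distrib_left by (intro sum.cong) (auto simp: algebra_simps)

text \<open>The bound is uniform in \<open>N\<close> and \<open>t\<close>; its 2 counts the indices
  k and -k. The values c = 1 and c = -i give the real and the imaginary part of
  \<open>U\<close>.\<close>

lemma U_gaussian:
  assumes c: "cmod c = 1"
  shows "\<exists>v. v \<le> 2 * T\<^sup>2 * D \<and> centered_gaussian v (\<lambda>x. Re (c * U N t x))"
proof (intro exI conjI)
  let ?d = "\<lambda>n. c * of_real (w (nat \<bar>n\<bar>)) * f n t"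
  let ?F = "{- int N..int N} - {0}"
  show "centered_gaussian (\<Sum>n\<in>?F. var (?d n) n) (\<lambda>x. Re (c * U N t x))"
    unfolding U_eq by (rule gaussian_sum) simp
  have "(\<Sum>n\<in>?F. var (?d n) n) \<le> (\<Sum>n\<in>?F. (cmod (?d n))\<^sup>2 * s n)"
    by (intro sum_mono var_le)
  also have "\<dots> = (\<Sum>k=1..N. (cmod (?d (int k)))\<^sup>2 * s (int k) + (cmod (?d (- int k)))\<^sup>2 * s (- int k))"
    by (rule sum_nonzero_symmetric)
  also have "\<dots> \<le> (\<Sum>k=1..N. 2 * T\<^sup>2 * (s (int k) / (y k)\<^sup>2 * y k powr p))"
  proof (rule sum_mono)
    fix k assume "k \<in> {1..N}"
    then have k: "k \<ge> 1" by simp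
    have *: "(cmod (c * of_real (w k) * f n t))\<^sup>2 * s (int k) \<le> T\<^sup>2 * (s (int k) / (y k)\<^sup>2 * y k powr p)"
      if "cmod (f n t) \<le> T / y k" for n
    proof -
      have "(cmod (f n t))\<^sup>2 \<le> (T / y k)\<^sup>2" using that by (intro power_mono) auto
      then have "(w k)\<^sup>2 * (cmod (f n t))\<^sup>2 * s (int k) \<le> (w k)\<^sup>2 * (T / y k)\<^sup>2 * s (int k)"
        using s_nonneg by (intro mult_right_mono mult_left_mono) auto
      moreover have "(cmod (c * of_real (w k) * f n t))\<^sup>2 = (w k)\<^sup>2 * (cmod (f n t))\<^sup>2"
        using c by (simp add: norm_mult power_mult_distrib)
      ultimately show ?thesis unfolding w_square[OF k] by (simp add: power_divide mult_ac)
    qed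
    show "(cmod (?d (int k)))\<^sup>2 * s (int k) + (cmod (?d (- int k)))\<^sup>2 * s (- int k) \<le> 2 * T\<^sup>2 * (s (int k) / (y k)\<^sup>2 * y k powr p)"
    proof -
      have le: "a + b \<le> 2 * q * r" if "a \<le> q * r" "b \<le> q * r" for a b q r :: real
        using that by linarith
      show ?thesis
        unfolding s_sym abs_minus_cancel abs_of_nat nat_int using f_bound[OF k, of t] by (intro le *) auto
    qed
  qed
  also have "\<dots> \<le> 2 * T\<^sup>2 * D"
    unfolding sum_distrib_left[symmetric] using s_summable by (intro mult_left_mono) auto
  finally show "(\<Sum>n\<in>?F. var (?d n) n) \<le> 2 * T\<^sup>2 * D" .
qed

definition Lip :: "nat \<Rightarrow> 'a \<Rightarrow> real" where
  "Lip N x = (\<Sum>k=1..N. w k * (cmod (Z (int k) x) + cmod (Z (- int k) x)))"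

lemma Lip_measurable [measurable]: "Lip N \<in> borel_measurable M"
  unfolding Lip_def[abs_def] by measurable

lemma Lip_nonneg: "Lip N x \<ge> 0"
  unfolding Lip_def using w_pos by (intro sum_nonneg mult_nonneg_nonneg add_nonneg_nonneg) (auto intro: less_imp_le)

lemma U_lipschitz: "cmod (U N t x - U N u x) \<le> Lip N x * \<bar>t - u\<bar>"
proof -
  have "U N t x - U N u x = (\<Sum>k=1..N. of_real (w k) * ((f (int k) t - f (int k) u) * Z (int k) x + (f (- int k) t - f (- int k) u) * Z (- int k) x))"
    unfolding U_def sum_subtractf[symmetric] by (intro sum.cong) (auto simp: algebra_simps)
  also have "cmod \<dots> \<le> (\<Sum>k=1..N. w k * (\<bar>t - u\<bar> * cmod (Z (int k) x) + \<bar>t - u\<bar> * cmod (Z (- int k) x)))"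
  proof (rule sum_norm_le)
    fix k assume "k \<in> {1..N}"
    then have w: "w k > 0" using w_pos by simp
    have "cmod ((f (int k) t - f (int k) u) * Z (int k) x + (f (- int k) t - f (- int k) u) * Z (- int k) x)
      \<le> \<bar>t - u\<bar> * cmod (Z (int k) x) + \<bar>t - u\<bar> * cmod (Z (- int k) x)"
      using f_lipschitz by (intro order_trans[OF norm_triangle_ineq] add_mono) (auto simp: norm_mult intro!: mult_right_mono)
    then show "cmod (of_real (w k) * ((f (int k) t - f (int k) u) * Z (int k) x + (f (- int k) t - f (- int k) u) * Z (- int k) x))
      \<le> w k * (\<bar>t - u\<bar> * cmod (Z (int k) x) + \<bar>t - u\<bar> * cmod (Z (- int k) x))"
      using w by (simp add: norm_mult)
  qed
  also have "\<dots> = Lip N x * \<bar>t - u\<bar>"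
    unfolding Lip_def sum_distrib_right by (intro sum.cong) (auto simp: algebra_simps)
  finally show ?thesis .
qed

lemma w_le: "k \<ge> 1 \<Longrightarrow> k \<le> N \<Longrightarrow> 1 \<le> y N \<Longrightarrow> w k \<le> y N"
proof -
  assume k: "k \<ge> 1" "k \<le> N" and yN: "1 \<le> y N"
  have "w k \<le> y N powr (p / 2)" unfolding w_def using y_le[OF k] y_pos[OF k(1)] p by (intro powr_mono2) auto
  also have "\<dots> \<le> y N powr 1" using yN p by (intro powr_mono) auto
  finally show ?thesis using yN by simp
qed

lemma s_le_y: "k \<ge> 1 \<Longrightarrow> k \<le> N \<Longrightarrow> 1 \<le> y N \<Longrightarrow> s (int k) \<le> D * (y N)\<^sup>2"
proof -
  assume k: "k \<ge> 1" "k \<le> N" and yN: "1 \<le> y N"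
  have yk: "y k > 0" "y k \<le> y N" using y_pos y_le k by auto
  have "y k powr 2 = y k powr p * y k powr (2 - p)" by (simp flip: powr_add)
  then have "(y k)\<^sup>2 = y k powr p * y k powr (2 - p)" using yk by simp
  then have "s (int k) = s (int k) / (y k)\<^sup>2 * y k powr p * y k powr (2 - p)" using yk by simp
  also have "\<dots> \<le> D * y k powr (2 - p)" using s_le[OF k(1)] by (intro mult_right_mono) auto
  also have "\<dots> \<le> D * y N powr (2 - p)" using D_nonneg yk p by (intro mult_left_mono powr_mono2) auto
  also have "\<dots> \<le> D * y N powr 2" using D_nonneg yN p by (intro mult_left_mono powr_mono) auto
  finally show ?thesis using yN by simp
qed

lemma integrable_cmod_Z: "integrable M (\<lambda>x. cmod (Z n x))" using integrable_Z by (rule integrable_norm)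

lemma expectation_cmod_Z: "expectation (\<lambda>x. cmod (Z n x)) \<le> 1 + s n"
proof -
  have "expectation (\<lambda>x. cmod (Z n x)) \<le> expectation (\<lambda>x. 1 + (cmod (Z n x))\<^sup>2)"
  proof (rule integral_mono)
    fix x
    have "0 \<le> (cmod (Z n x) - 1 / 2)\<^sup>2" by simp
    then have "cmod (Z n x) \<le> 1 / 4 + (cmod (Z n x))\<^sup>2" by (simp add: power2_eq_square algebra_simps)
    then show "cmod (Z n x) \<le> 1 + (cmod (Z n x))\<^sup>2" by simp
  qed (use integrable_cmod_Z square_integrable_Z in auto)
  also have "\<dots> = 1 + s n" using square_integrable_Z by (simp add: variance_Z prob_space)
  finally show ?thesis .
qed

lemma integrable_Lip: "integrable M (Lip N)"
  unfolding Lip_def[abs_def]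
  by (intro Bochner_Integration.integrable_sum integrable_mult_right Bochner_Integration.integrable_add integrable_cmod_Z)

text \<open>7 = 1 + 2 + 4: the weights contribute \<open>y N\<close>, the expectations of |Z|
  contribute \<open>(y N)\<^sup>2\<close>, and the number of terms contributes
  \<open>y N ^ 4\<close> by \<open>y_growth\<close>.\<close>

lemma expectation_Lip: 
  assumes yN: "1 \<le> y N"
  shows "expectation (Lip N) \<le> 2 * K * (1 + D) * y N ^ 7"
proof -
  have "expectation (Lip N) = (\<Sum>k=1..N. w k * (expectation (\<lambda>x. cmod (Z (int k) x)) + expectation (\<lambda>x. cmod (Z (- int k) x))))"
    unfolding Lip_def[abs_def] using integrable_cmod_Z by (subst Bochner_Integration.integral_sum) auto
  also have "\<dots> \<le> (\<Sum>k=1..N. y N * (2 * ((1 + D) * (y N)\<^sup>2)))"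
  proof (intro sum_mono mult_mono)
    fix k assume "k \<in> {1..N}"
    then have k: "1 \<le> k" "k \<le> N" by auto
    show "w k \<le> y N" using w_le k yN by simp
    have "1 \<le> (y N)\<^sup>2" using yN by (simp add: one_le_power)
    then have "1 + s (int k) \<le> (1 + D) * (y N)\<^sup>2" using s_le_y[OF k yN] by (simp add: distrib_right)
    then show "expectation (\<lambda>x. cmod (Z (int k) x)) + expectation (\<lambda>x. cmod (Z (- int k) x)) \<le> 2 * ((1 + D) * (y N)\<^sup>2)"
      using expectation_cmod_Z[of "int k"] expectation_cmod_Z[of "- int k"] s_sym[of "int k"] by simp
  qed (use yN in auto)
  also have "\<dots> = real N * (2 * (1 + D) * y N ^ 3)" by (simp add: power2_eq_square power3_eq_cube)
  also have "\<dots> \<le> (K * y N ^ 4) * (2 * (1 + D) * y N ^ 3)"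
    using y_growth[of N] D_nonneg yN by (intro mult_right_mono) auto
  also have "\<dots> = 2 * K * (1 + D) * (y N ^ 4 * y N ^ 3)" by (simp only: mult_ac)
  also have "y N ^ 4 * y N ^ 3 = y N ^ 7" by (simp flip: power_add)
  finally show ?thesis .
qed

text \<open>The square root of the weight \<open>w N\<close>: this growth is exactly what
  \<open>uniform_limit_by_parts\<close> tolerates.\<close>

definition level :: "nat \<Rightarrow> real" where "level N = y N powr (p / 4)"
text \<open>15 = 7 + 8: Markov's inequality for \<open>Lip N\<close> at the threshold
  \<open>y N ^ 15\<close> leaves the probability O(1 / y N ^ 8), and below this threshold
  \<open>U N\<close> differs by at most \<open>T\<close> from its value at the next node to the
  left.\<close>

definition grid :: "nat \<Rightarrow> nat" where "grid N = nat \<lceil>y N ^ 15\<rceil>"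
definition node :: "nat \<Rightarrow> nat \<Rightarrow> real" where "node N j = T * real j / real (grid N)"

definition bad :: "nat \<Rightarrow> 'a set" where
  "bad N = (\<Union>j\<in>{..grid N}. {x \<in> space M. level N \<le> \<bar>Re (1 * U N (node N j) x)\<bar>} \<union> {x \<in> space M. level N \<le> \<bar>Re (- \<i> * U N (node N j) x)\<bar>})
     \<union> {x \<in> space M. y N ^ 15 \<le> Lip N x}"

lemma bad_measurable [measurable]: "bad N \<in> sets M"
  unfolding bad_def by measurable

lemma prob_bad:
  obtains B where "B \<ge> 0" "\<And>N. N \<ge> 1 \<Longrightarrow> 1 \<le> y N \<Longrightarrow> prob (bad N) \<le> B / y N ^ 8"
proof -
  \<comment> \<open>46 = 2 * (15 + 8): then \<open>level N ^ (2 * k)\<close>, which is y N to the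
    power p k / 2, is at least \<open>y N ^ 23\<close>. Summed over about \<open>y N ^ 15\<close>
    nodes, the tails leave O(1 / y N ^ 8).\<close>
  obtain k :: nat where k: "real k \<ge> 46 / p" using real_arch_simple by blast
  define Q where "Q = fact (2 * k) / (2 ^ k * fact k) * (2 * T\<^sup>2 * D) ^ k"
  have Q: "Q \<ge> 0" unfolding Q_def using D_nonneg by simp
  define B where "B = 6 * Q + 2 * K * (1 + D)"
  have "prob (bad N) \<le> B / y N ^ 8" if N: "N \<ge> 1" and yN: "1 \<le> y N" for N
  proof -
    have lev: "level N > 0" using yN by (simp add: level_def)
    have "y N ^ 23 \<le> level N ^ (2 * k)"
    proof -
      have "46 \<le> real k * p" using k p by (simp add: pos_divide_le_eq)
      then have "23 \<le> p / 4 * real (2 * k)" by (simp add: mult.commute)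
      then have "y N powr 23 \<le> y N powr (p / 4 * real (2 * k))" using yN by (intro powr_mono) auto
      moreover have "y N powr (p / 4 * real (2 * k)) = level N ^ (2 * k)"
        using lev by (simp only: powr_powr[symmetric] level_def[symmetric] powr_realpow)
      moreover have "y N powr 23 = y N ^ 23" using yN powr_realpow[of "y N" 23] by simp
      ultimately show ?thesis by simp
    qed
    then have "Q / level N ^ (2 * k) \<le> Q / y N ^ 23" using Q yN lev by (intro divide_left_mono mult_pos_pos zero_less_power) auto
    have tail: "prob {x \<in> space M. level N \<le> \<bar>Re (c * U N t x)\<bar>} \<le> Q / y N ^ 23" if c: "cmod c = 1" for c t
    proof -
      obtain v where v: "v \<le> 2 * T\<^sup>2 * D" "centered_gaussian v (\<lambda>x. Re (c * U N t x))" using U_gaussian[OF c] by blast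
      have "prob {x \<in> space M. level N \<le> \<bar>Re (c * U N t x)\<bar>} \<le> Q / level N ^ (2 * k)"
        unfolding Q_def by (rule centered_gaussian_tail[OF v(2) lev v(1)])
      also have "\<dots> \<le> Q / y N ^ 23" by fact
      finally show ?thesis .
    qed
    have g: "real (grid N) + 1 \<le> 3 * y N ^ 15"
    proof -
      have "1 \<le> y N ^ 15" using yN by (rule one_le_power)
      then show ?thesis unfolding grid_def using ceiling_correct[of "y N ^ 15"] by (simp add: of_nat_nat)
    qed
    let ?A = "\<lambda>j. {x \<in> space M. level N \<le> \<bar>Re (1 * U N (node N j) x)\<bar>}"
    let ?B = "\<lambda>j. {x \<in> space M. level N \<le> \<bar>Re (- \<i> * U N (node N j) x)\<bar>}"
    let ?C = "{x \<in> space M. y N ^ 15 \<le> Lip N x}"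
    have "prob (\<Union>j\<in>{..grid N}. ?A j \<union> ?B j) \<le> (\<Sum>j\<in>{..grid N}. prob (?A j \<union> ?B j))"
      by (intro finite_measure_subadditive_finite) (auto simp del: times_complex.sel)
    also have "\<dots> \<le> (\<Sum>j\<in>{..grid N}. 2 * Q / y N ^ 23)"
    proof (rule sum_mono)
      fix j
      have "prob (?A j \<union> ?B j) \<le> prob (?A j) + prob (?B j)"
        by (intro measure_Un_le) measurable
      also have "\<dots> \<le> Q / y N ^ 23 + Q / y N ^ 23" by (intro add_mono tail) auto
      finally show "prob (?A j \<union> ?B j) \<le> 2 * Q / y N ^ 23" by simp
    qed
    also have "\<dots> = (real (grid N) + 1) * (2 * Q / y N ^ 23)" by simp
    also have "\<dots> \<le> (3 * y N ^ 15) * (2 * Q / y N ^ 23)" using g Q yN by (intro mult_right_mono) auto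
    also have "\<dots> = 6 * Q * (y N ^ 15 / y N ^ 23)" by simp
    also have "y N ^ 15 / y N ^ 23 = 1 / y N ^ 8" using yN by (simp add: divide_simps flip: power_add)
    finally have 1: "prob (\<Union>j\<in>{..grid N}. ?A j \<union> ?B j) \<le> 6 * Q / y N ^ 8" by simp
    have "prob ?C \<le> expectation (Lip N) / y N ^ 15"
      using yN Lip_nonneg by (intro integral_Markov_inequality_measure[where A = "{}"] integrable_Lip) auto
    also have "\<dots> \<le> 2 * K * (1 + D) * y N ^ 7 / y N ^ 15" using expectation_Lip[OF yN] yN by (intro divide_right_mono) auto
    also have "\<dots> = 2 * K * (1 + D) * (y N ^ 7 / y N ^ 15)" by simp
    also have "y N ^ 7 / y N ^ 15 = 1 / y N ^ 8" using yN by (simp add: divide_simps flip: power_add)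
    finally have 2: "prob ?C \<le> 2 * K * (1 + D) / y N ^ 8" by simp
    have "prob (bad N) \<le> prob (\<Union>j\<in>{..grid N}. ?A j \<union> ?B j) + prob ?C"
      unfolding bad_def by (intro measure_Un_le) measurable
    also have "\<dots> \<le> B / y N ^ 8" using 1 2 by (simp add: B_def add_divide_distrib)
    finally show ?thesis .
  qed
  moreover have "B \<ge> 0" unfolding B_def using Q K D_nonneg by simp
  ultimately show ?thesis using that by blast
qed

lemma y_at_top: "filterlim y at_top sequentially"
  unfolding filterlim_at_top
proof
  fix R :: real
  obtain N0 :: nat where N0: "real N0 > K * \<bar>R\<bar> ^ 4" using reals_Archimedean2 by blast
  show "\<forall>\<^sub>F k in sequentially. R \<le> y k"
    using eventually_ge_at_top[of "max 1 N0"]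
  proof eventually_elim
    case (elim k)
    show ?case
    proof (rule ccontr)
      assume "\<not> R \<le> y k"
      then have "y k ^ 4 \<le> \<bar>R\<bar> ^ 4" using y_pos[of k] elim by (intro power_mono) auto
      then have "K * y k ^ 4 \<le> K * \<bar>R\<bar> ^ 4" using K by (intro mult_left_mono) auto
      then show False using y_growth[of k] N0 elim by simp
    qed
  qed
qed

lemma eventually_y_ge_1: "\<forall>\<^sub>F k in sequentially. 1 \<le> y k"
  using y_at_top unfolding filterlim_at_top by blast

text \<open>By \<open>y_growth\<close>, \<open>1 / y N ^ 8\<close> is at most K^2 / N^2, which is
  summable.\<close>

lemma AE_eventually_not_bad: "AE x in M. \<forall>\<^sub>F N in sequentially. x \<in> space M - bad N"
proof (rule borel_cantelli_AE1)
  obtain B where B: "B \<ge> 0" "\<And>N. N \<ge> 1 \<Longrightarrow> 1 \<le> y N \<Longrightarrow> prob (bad N) \<le> B / y N ^ 8"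
    using prob_bad by blast
  show "summable (\<lambda>N. prob (bad N))"
  proof (rule summable_comparison_test_ev)
    show "summable (\<lambda>N. B * K\<^sup>2 * inverse (real N ^ 2))"
      by (intro summable_mult inverse_power_summable) auto
    show "\<forall>\<^sub>F N in sequentially. norm (prob (bad N)) \<le> B * K\<^sup>2 * inverse (real N ^ 2)"
      using eventually_y_ge_1 eventually_ge_at_top[of 1]
    proof eventually_elim
      case (elim N)
      have "(real N)\<^sup>2 \<le> (K * y N ^ 4)\<^sup>2" using y_growth[of N] by (intro power_mono) auto
      also have "\<dots> = K\<^sup>2 * y N ^ 8" by (simp add: power_mult_distrib flip: power_mult)
      finally have "1 / y N ^ 8 \<le> K\<^sup>2 / (real N)\<^sup>2" using elim by (simp add: field_simps)
      then have "B * (1 / y N ^ 8) \<le> B * (K\<^sup>2 / (real N)\<^sup>2)" using B by (intro mult_left_mono)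
      moreover have "prob (bad N) \<le> B * (1 / y N ^ 8)" using B(2)[of N] elim by simp
      moreover have "B * (K\<^sup>2 / (real N)\<^sup>2) = B * K\<^sup>2 * inverse (real N ^ 2)" by (simp add: divide_inverse)
      ultimately show ?case by simp
    qed
  qed
qed (auto simp: emeasure_eq_measure)

lemma uniform_convergence_tail:
  "AE x in M. \<exists>l. uniform_limit {0..T} (\<lambda>N t. \<Sum>k=1..N. f (int k) t * Z (int k) x + f (- int k) t * Z (- int k) x) l sequentially"
  using AE_eventually_not_bad AE_space
proof eventually_elim
  case (elim x)
  define v where "v k = 1 / w k" for k
  obtain N1 where N1: "\<And>N. N \<ge> N1 \<Longrightarrow> x \<notin> bad N" "\<And>N. N \<ge> N1 \<Longrightarrow> 1 \<le> y N"
    using eventually_conj[OF elim(1) eventually_y_ge_1] unfolding eventually_sequentially by blast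
  have "\<exists>l. uniform_limit {0..T} (\<lambda>N t. \<Sum>k=1..N. of_real (v k) * (U k t x - U (k - 1) t x)) l sequentially"
  proof (rule uniform_limit_by_parts)
    show "U 0 t x = 0" for t by (simp add: U_def)
    show "0 < v k \<and> v (Suc k) \<le> v k" if k: "k \<ge> 1" for k
    proof -
      have "w k \<le> w (Suc k)" unfolding w_def using y_mono[OF k] y_pos[OF k] p by (intro powr_mono2) auto
      then show ?thesis using w_pos[OF k] by (simp add: v_def frac_le)
    qed
    show "v \<longlonglongrightarrow> 0"
    proof -
      have "((\<lambda>z. 1 / z powr (p / 2)) \<longlongrightarrow> 0) at_top" using p by real_asymp
      then show ?thesis unfolding v_def[abs_def] w_def using y_at_top by (rule filterlim_compose)
    qed
    fix N t assume N: "N \<ge> max 1 N1" and t: "t \<in> {0..T}"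
    have yN: "1 \<le> y N" and nb: "x \<notin> bad N" using N1[of N] N by auto
    have y15: "1 \<le> y N ^ 15" using yN by (rule one_le_power)
    have G: "y N ^ 15 \<le> real (grid N)" unfolding grid_def by (simp add: real_nat_ceiling_ge)
    have G0: "real (grid N) > 0" using G y15 by linarith
    \<comment> \<open>\<open>node N j\<close> is the last node that does not exceed
      \<open>t\<close>.\<close>
    define j where "j = nat \<lfloor>t * real (grid N) / T\<rfloor>"
    have tj: "real j \<le> t * real (grid N) / T" "t * real (grid N) / T < real j + 1"
    proof -
      have "0 \<le> t * real (grid N) / T" using t T by auto
      then show "real j \<le> t * real (grid N) / T" "t * real (grid N) / T < real j + 1"
        unfolding j_def by (simp_all add: of_nat_nat)
    qed
    have "t * real (grid N) / T \<le> real (grid N)" using t T G0 by (simp add: pos_divide_le_eq mult.commute)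
    then have j: "j \<le> grid N" using tj(1) by linarith
    have n1: "node N j \<le> t" using tj(1) T G0 unfolding node_def by (simp add: field_simps)
    have "t * real (grid N) \<le> T * (real j + 1)" using tj(2) T by (simp add: pos_divide_less_eq mult.commute)
    then have "t \<le> T * (real j + 1) / real (grid N)" using G0 by (simp only: pos_le_divide_eq)
    then have n2: "t - node N j \<le> T / real (grid N)" unfolding node_def by (simp add: distrib_left add_divide_distrib)
    have nt: "\<bar>t - node N j\<bar> \<le> T / y N ^ 15"
    proof -
      have "T / real (grid N) \<le> T / y N ^ 15" using G G0 T yN by (intro divide_left_mono mult_pos_pos) auto
      then show ?thesis using n1 n2 by simp
    qed
    have "Lip N x < y N ^ 15" using nb elim(2) unfolding bad_def by auto
    then have "cmod (U N t x - U N (node N j) x) \<le> y N ^ 15 * (T / y N ^ 15)"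
      using U_lipschitz[of N t x "node N j"] nt Lip_nonneg[of N x] yN T
      by (intro order_trans[OF _ mult_mono[of "Lip N x" "y N ^ 15" "\<bar>t - node N j\<bar>" "T / y N ^ 15"]]) auto
    then have d: "cmod (U N t x - U N (node N j) x) \<le> T" using yN by simp
    have "\<bar>Re (1 * U N (node N j) x)\<bar> < level N" "\<bar>Re (- \<i> * U N (node N j) x)\<bar> < level N"
      using nb elim(2) j unfolding bad_def by (auto simp: not_le simp del: times_complex.sel)
    then have "cmod (U N (node N j) x) \<le> 2 * level N"
      using cmod_le[of "U N (node N j) x"] by simp
    then have b: "cmod (U N t x) \<le> 2 * level N + T"
      using d norm_triangle_sub[of "U N t x" "U N (node N j) x"] by linarith
    have lev: "1 \<le> level N" unfolding level_def using yN p by (intro ge_one_powr_ge_zero) auto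
    have "T * 1 \<le> T * level N" using lev T by (intro mult_left_mono) auto
    then have b2: "cmod (U N t x) \<le> (2 + T) * level N" using b by (simp add: distrib_right)
    have "sqrt (v N) = 1 / level N"
    proof -
      have "w N = level N * level N" unfolding w_def level_def by (simp flip: powr_add)
      then show ?thesis using lev by (simp add: v_def real_sqrt_divide real_sqrt_mult)
    qed
    then show "cmod (U N t x) * sqrt (v N) \<le> 2 + T" using b2 lev by (simp add: pos_divide_le_eq)
  qed
  moreover have "of_real (v k) * (U k t x - U (k - 1) t x) = f (int k) t * Z (int k) x + f (- int k) t * Z (- int k) x"
    if k: "k \<in> {1..N}" for k t N
  proof -
    obtain m where m: "k = Suc m" using k by (cases k) auto
    have "U k t x - U (k - 1) t x = of_real (w k) * (f (int k) t * Z (int k) x + f (- int k) t * Z (- int k) x)"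
      unfolding m U_def by simp
    then show ?thesis using w_pos[of k] k by (simp add: v_def)
  qed
  then have "(\<Sum>k=1..N. of_real (v k) * (U k t x - U (k - 1) t x)) = (\<Sum>k=1..N. f (int k) t * Z (int k) x + f (- int k) t * Z (- int k) x)" for N t
    by (intro sum.cong) auto
  ultimately show ?case by simp
qed

end

section \<open>The limit process\<close>

context prob_space
begin

lemma product_polarization:
  fixes U V :: "'a \<Rightarrow> real"
  assumes U: "integrable M (\<lambda>x. (U x)\<^sup>2)" and V: "integrable M (\<lambda>x. (V x)\<^sup>2)"
    and UV: "integrable M (\<lambda>x. (U x + V x)\<^sup>2)"
  shows "integrable M (\<lambda>x. U x * V x)"
    and "expectation (\<lambda>x. U x * V x) = (expectation (\<lambda>x. (U x + V x)\<^sup>2) - expectation (\<lambda>x. (U x)\<^sup>2) - expectation (\<lambda>x. (V x)\<^sup>2)) / 2"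
proof -
  have e: "U x * V x = ((U x + V x)\<^sup>2 - (U x)\<^sup>2 - (V x)\<^sup>2) / 2" for x by (simp add: power2_sum)
  show "integrable M (\<lambda>x. U x * V x)" unfolding e using U V UV by auto
  show "expectation (\<lambda>x. U x * V x) = (expectation (\<lambda>x. (U x + V x)\<^sup>2) - expectation (\<lambda>x. (U x)\<^sup>2) - expectation (\<lambda>x. (V x)\<^sup>2)) / 2"
    unfolding e using U V UV by simp
qed

end

locale gaussian_series_limit = gaussian_sequence M Z s
  for M :: "'a measure" and Z :: "int \<Rightarrow> 'a \<Rightarrow> complex" and s :: "int \<Rightarrow> real" +
  fixes f :: "int \<Rightarrow> real \<Rightarrow> complex" and I :: "real set"
    and X :: "real \<Rightarrow> 'a \<Rightarrow> complex" and R :: "real \<Rightarrow> real \<Rightarrow> complex"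
  assumes X_measurable: "\<And>t. t \<in> I \<Longrightarrow> X t \<in> borel_measurable M"
    and AE_limit: "\<And>t. t \<in> I \<Longrightarrow> AE x in M. (\<lambda>N. \<Sum>n\<in>{- int N..int N}. f n t * Z n x) \<longlonglongrightarrow> X t x"
    and R_limit: "\<And>t u. t \<in> I \<Longrightarrow> u \<in> I \<Longrightarrow>
      (\<lambda>N. \<Sum>n\<in>{- int N..int N}. of_real (s n) * (f n t * cnj (f n u))) \<longlonglongrightarrow> R t u"
begin

definition S :: "nat \<Rightarrow> real \<Rightarrow> 'a \<Rightarrow> complex" where
  "S N t x = (\<Sum>n\<in>{- int N..int N}. f n t * Z n x)"

lemma variance_bounded:
  assumes "t \<in> I"
  obtains B where "\<And>N. (\<Sum>n\<in>{- int N..int N}. s n * (cmod (f n t))\<^sup>2) \<le> B"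
proof -
  have "(\<lambda>N. cmod (\<Sum>n\<in>{- int N..int N}. of_real (s n) * (f n t * cnj (f n t)))) \<longlonglongrightarrow> cmod (R t t)"
    by (intro tendsto_norm R_limit assms)
  moreover have "cmod (\<Sum>n\<in>{- int N..int N}. of_real (s n) * (f n t * cnj (f n t)))
      = (\<Sum>n\<in>{- int N..int N}. s n * (cmod (f n t))\<^sup>2)" for N
  proof -
    have "(\<Sum>n\<in>{- int N..int N}. of_real (s n) * (f n t * cnj (f n t))) = of_real (\<Sum>n\<in>{- int N..int N}. s n * (cmod (f n t))\<^sup>2)"
      unfolding complex_norm_square[symmetric] by simp
    also have "cmod \<dots> = (\<Sum>n\<in>{- int N..int N}. s n * (cmod (f n t))\<^sup>2)"
      unfolding norm_of_real using s_nonneg by (intro abs_of_nonneg sum_nonneg) auto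
    finally show ?thesis .
  qed
  ultimately have "(\<lambda>N. \<Sum>n\<in>{- int N..int N}. s n * (cmod (f n t))\<^sup>2) \<longlonglongrightarrow> cmod (R t t)"
    by simp
  then have "Bseq (\<lambda>N. \<Sum>n\<in>{- int N..int N}. s n * (cmod (f n t))\<^sup>2)"
    by (intro convergent_imp_Bseq convergentI)
  then obtain B where "\<forall>N. norm (\<Sum>n\<in>{- int N..int N}. s n * (cmod (f n t))\<^sup>2) \<le> B"
    unfolding Bseq_def by blast
  then have "(\<Sum>n\<in>{- int N..int N}. s n * (cmod (f n t))\<^sup>2) \<le> B" for N
    unfolding real_norm_def by (blast intro: abs_le_D1)
  then show ?thesis by (rule that)
qed

text \<open>By independence the variances of the partial sums increase with \<open>N\<close>, and
  \<open>variance_bounded\<close> bounds them, so they converge and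
  \<open>centered_gaussian_limit\<close> applies. The separate index type allows a time to occur
  twice, as in \<open>pair\<close> with \<open>t = u\<close>.\<close>

lemma linear_combination:
  fixes c :: "'j \<Rightarrow> complex" and \<tau> :: "'j \<Rightarrow> real"
  assumes F: "finite F" "\<And>j. j \<in> F \<Longrightarrow> \<tau> j \<in> I"
  obtains v where "centered_gaussian v (\<lambda>x. Re (\<Sum>j\<in>F. c j * X (\<tau> j) x))"
    and "\<And>N. integrable M (\<lambda>x. (Re (\<Sum>j\<in>F. c j * S N (\<tau> j) x))\<^sup>2)"
    and "(\<lambda>N. expectation (\<lambda>x. (Re (\<Sum>j\<in>F. c j * S N (\<tau> j) x))\<^sup>2)) \<longlonglongrightarrow> v"
proof -
  define d where "d n = (\<Sum>j\<in>F. c j * f n (\<tau> j))" for n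
  define v where "v N = (\<Sum>n\<in>{- int N..int N}. var (d n) n)" for N
  have eq: "(\<Sum>j\<in>F. c j * S N (\<tau> j) x) = (\<Sum>n\<in>{- int N..int N}. d n * Z n x)" for N x
    unfolding S_def d_def sum_distrib_left sum_distrib_right by (subst sum.swap) (simp add: mult_ac)
  have G: "centered_gaussian (v N) (\<lambda>x. Re (\<Sum>j\<in>F. c j * S N (\<tau> j) x))" for N
    unfolding eq v_def by (intro gaussian_sum) simp
  have "\<exists>B. \<forall>N. (\<Sum>n\<in>{- int N..int N}. s n * (cmod (f n (\<tau> j)))\<^sup>2) \<le> B" if "j \<in> F" for j
    using variance_bounded[OF F(2)[OF that]] by metis
  then obtain B where B: "\<And>j N. j \<in> F \<Longrightarrow> (\<Sum>n\<in>{- int N..int N}. s n * (cmod (f n (\<tau> j)))\<^sup>2) \<le> B j" by metis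
  have "v N \<le> card F * (\<Sum>j\<in>F. (cmod (c j))\<^sup>2 * B j)" for N
  proof -
    have d: "(cmod (d n))\<^sup>2 \<le> card F * (\<Sum>j\<in>F. (cmod (c j))\<^sup>2 * (cmod (f n (\<tau> j)))\<^sup>2)" for n
    proof -
      have "(cmod (d n))\<^sup>2 \<le> (\<Sum>j\<in>F. cmod (c j * f n (\<tau> j)))\<^sup>2"
        unfolding d_def by (intro power_mono norm_sum) auto
      also have "\<dots> \<le> (\<Sum>j\<in>F. (cmod (c j * f n (\<tau> j)))\<^sup>2) * card F" by (rule sum_squared_le_sum_of_squares)
      finally show ?thesis by (simp add: norm_mult power_mult_distrib mult.commute)
    qed
    have "v N \<le> (\<Sum>n\<in>{- int N..int N}. (cmod (d n))\<^sup>2 * s n)" unfolding v_def by (intro sum_mono var_le)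
    also have "\<dots> \<le> (\<Sum>n\<in>{- int N..int N}. (card F * (\<Sum>j\<in>F. (cmod (c j))\<^sup>2 * (cmod (f n (\<tau> j)))\<^sup>2)) * s n)"
      by (intro sum_mono mult_right_mono d s_nonneg)
    also have "\<dots> = card F * (\<Sum>j\<in>F. (cmod (c j))\<^sup>2 * (\<Sum>n\<in>{- int N..int N}. s n * (cmod (f n (\<tau> j)))\<^sup>2))"
      by (simp add: sum_distrib_left sum_distrib_right mult_ac) (rule sum.swap)
    also have "\<dots> \<le> card F * (\<Sum>j\<in>F. (cmod (c j))\<^sup>2 * B j)"
      by (intro mult_left_mono sum_mono B) auto
    finally show ?thesis .
  qed
  moreover have "incseq v"
    unfolding v_def by (intro incseq_SucI sum_mono2) (auto simp: var_nonneg)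
  ultimately obtain v' where v': "v \<longlonglongrightarrow> v'" using incseq_convergent by metis
  have "AE x in M. \<forall>j\<in>F. (\<lambda>N. S N (\<tau> j) x) \<longlonglongrightarrow> X (\<tau> j) x"
    using F AE_limit unfolding S_def by (intro AE_finite_allI) auto
  then have "AE x in M. (\<lambda>N. Re (\<Sum>j\<in>F. c j * S N (\<tau> j) x)) \<longlonglongrightarrow> Re (\<Sum>j\<in>F. c j * X (\<tau> j) x)"
    by eventually_elim (intro tendsto_intros, auto)
  then have "centered_gaussian v' (\<lambda>x. Re (\<Sum>j\<in>F. c j * X (\<tau> j) x))"
    using F X_measurable by (intro centered_gaussian_limit[OF G _ _ v'] borel_measurable_Re borel_measurable_sum borel_measurable_times) auto
  moreover have "expectation (\<lambda>x. (Re (\<Sum>j\<in>F. c j * S N (\<tau> j) x))\<^sup>2) = v N" for N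
    by (rule centered_gaussian_variance(2)[OF G])
  ultimately show ?thesis
    using that[of v'] v' centered_gaussian_variance(1)[OF G] by simp
qed

lemma gaussian_process: "gaussian_complex_process M I X"
  unfolding gaussian_complex_process_def
proof (intro conjI ballI allI impI)
  show "X t \<in> borel_measurable M" if "t \<in> I" for t using X_measurable that .
  fix F c assume "finite F \<and> F \<subseteq> I"
  then show "gaussian_real M (\<lambda>w. Re (\<Sum>t\<in>F. c t * X t w))"
    using linear_combination[of F "\<lambda>t. t" c] centered_gaussian_imp_gaussian_real by blast
qed

lemma single:
  assumes "t \<in> I"
  obtains v where "centered_gaussian v (\<lambda>x. Re (a * X t x))"
    and "\<And>N. integrable M (\<lambda>x. (Re (a * S N t x))\<^sup>2)"
    and "(\<lambda>N. expectation (\<lambda>x. (Re (a * S N t x))\<^sup>2)) \<longlonglongrightarrow> v"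
  using linear_combination[of "{()}" "\<lambda>_. t" "\<lambda>_. a"] assms by auto

lemma pair:
  assumes "t \<in> I" "u \<in> I"
  obtains v where "centered_gaussian v (\<lambda>x. Re (a * X t x) + Re (b * X u x))"
    and "\<And>N. integrable M (\<lambda>x. (Re (a * S N t x) + Re (b * S N u x))\<^sup>2)"
    and "(\<lambda>N. expectation (\<lambda>x. (Re (a * S N t x) + Re (b * S N u x))\<^sup>2)) \<longlonglongrightarrow> v"
proof -
  obtain v where "centered_gaussian v (\<lambda>x. Re (\<Sum>j\<in>(UNIV :: bool set). (if j then a else b) * X (if j then t else u) x))"
    and "\<And>N. integrable M (\<lambda>x. (Re (\<Sum>j\<in>(UNIV :: bool set). (if j then a else b) * S N (if j then t else u) x))\<^sup>2)"
    and "(\<lambda>N. expectation (\<lambda>x. (Re (\<Sum>j\<in>(UNIV :: bool set). (if j then a else b) * S N (if j then t else u) x))\<^sup>2)) \<longlonglongrightarrow> v"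
    by (rule linear_combination[of "UNIV :: bool set" "\<lambda>j. if j then t else u" "\<lambda>j. if j then a else b"]) (use assms in auto)
  then show ?thesis using that[of v] by (simp add: UNIV_bool add.commute del: times_complex.sel)
qed

text \<open>Almost sure convergence alone does not carry over to expectations of products.
  Polarization reduces them to second moments, and for these \<open>linear_combination\<close>
  identifies the limit with the variance of the limit variable.\<close>

lemma real_product:
  assumes t: "t \<in> I" and u: "u \<in> I"
  shows "integrable M (\<lambda>x. Re (a * X t x) * Re (b * X u x))"
    and "integrable M (\<lambda>x. Re (a * S N t x) * Re (b * S N u x))"
    and "(\<lambda>N. expectation (\<lambda>x. Re (a * S N t x) * Re (b * S N u x))) \<longlonglongrightarrow> expectation (\<lambda>x. Re (a * X t x) * Re (b * X u x))"
proof -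
  obtain v1 where v1: "centered_gaussian v1 (\<lambda>x. Re (a * X t x))"
     "\<And>N. integrable M (\<lambda>x. (Re (a * S N t x))\<^sup>2)"
     "(\<lambda>N. expectation (\<lambda>x. (Re (a * S N t x))\<^sup>2)) \<longlonglongrightarrow> v1" using single[OF t] by blast
  obtain v2 where v2: "centered_gaussian v2 (\<lambda>x. Re (b * X u x))"
     "\<And>N. integrable M (\<lambda>x. (Re (b * S N u x))\<^sup>2)"
     "(\<lambda>N. expectation (\<lambda>x. (Re (b * S N u x))\<^sup>2)) \<longlonglongrightarrow> v2" using single[OF u] by blast
  obtain v where v: "centered_gaussian v (\<lambda>x. Re (a * X t x) + Re (b * X u x))"
     "\<And>N. integrable M (\<lambda>x. (Re (a * S N t x) + Re (b * S N u x))\<^sup>2)"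
     "(\<lambda>N. expectation (\<lambda>x. (Re (a * S N t x) + Re (b * S N u x))\<^sup>2)) \<longlonglongrightarrow> v" using pair[OF t u] by blast
  note PX = product_polarization[OF centered_gaussian_variance(1)[OF v1(1)] centered_gaussian_variance(1)[OF v2(1)] centered_gaussian_variance(1)[OF v(1)]]
  note PS = product_polarization[OF v1(2) v2(2) v(2)]
  show "integrable M (\<lambda>x. Re (a * X t x) * Re (b * X u x))" by (rule PX(1))
  show "integrable M (\<lambda>x. Re (a * S N t x) * Re (b * S N u x))" by (rule PS(1))
  show "(\<lambda>N. expectation (\<lambda>x. Re (a * S N t x) * Re (b * S N u x))) \<longlonglongrightarrow> expectation (\<lambda>x. Re (a * X t x) * Re (b * X u x))"
    unfolding PX(2) PS(2) centered_gaussian_variance(2)[OF v1(1)] centered_gaussian_variance(2)[OF v2(1)] centered_gaussian_variance(2)[OF v(1)]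
    by (intro tendsto_intros v v1 v2) auto
qed

lemma mean_zero:
  assumes t: "t \<in> I"
  shows "integral\<^sup>L M (X t) = 0"
proof -
  obtain v1 where "centered_gaussian v1 (\<lambda>x. Re (1 * X t x))" using single[OF t, of 1] by blast
  note re = centered_gaussian_mean[OF this]
  obtain v2 where "centered_gaussian v2 (\<lambda>x. Re (- \<i> * X t x))" using single[OF t, of "- \<i>"] by blast
  note im = centered_gaussian_mean[OF this]
  have X: "X t = (\<lambda>x. of_real (Re (1 * X t x)) + \<i> * of_real (Re (- \<i> * X t x)))"
    by (auto simp: complex_eq_iff)
  have "integral\<^sup>L M (X t) = integral\<^sup>L M (\<lambda>x. of_real (Re (1 * X t x))) + integral\<^sup>L M (\<lambda>x. \<i> * of_real (Re (- \<i> * X t x)))"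
    by (subst X, intro Bochner_Integration.integral_add integrable_mult_right integrable_of_real re im)
  also have "integral\<^sup>L M (\<lambda>x. complex_of_real (Re (1 * X t x))) = 0"
    by (simp only: integral_complex_of_real re of_real_0)
  also have "integral\<^sup>L M (\<lambda>x. \<i> * complex_of_real (Re (- \<i> * X t x))) = 0"
    by (simp only: integral_mult_right_zero integral_complex_of_real im of_real_0 mult_zero_right)
  finally show ?thesis by simp
qed

lemma covariance:
  assumes t: "t \<in> I" and u: "u \<in> I"
  shows "integral\<^sup>L M (\<lambda>x. X t x * cnj (X u x)) = R t u"
proof -
  \<comment> \<open>The four real products in \<open>A x * cnj (B x)\<close>. The imaginary part is
    written as the real part of a product with \<open>- \<i>\<close>, the form that
    \<open>real_product\<close> treats.\<close>
  define E where "E A B = complex_of_real (expectation (\<lambda>x. Re (1 * A x) * Re (1 * B x))) + of_real (expectation (\<lambda>x. Re (- \<i> * A x) * Re (- \<i> * B x)))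
     + \<i> * (of_real (expectation (\<lambda>x. Re (- \<i> * A x) * Re (1 * B x))) - of_real (expectation (\<lambda>x. Re (1 * A x) * Re (- \<i> * B x))))"
    for A B :: "'a \<Rightarrow> complex"
  have E: "integral\<^sup>L M (\<lambda>x. A x * cnj (B x)) = E A B"
    if int: "\<And>a b. integrable M (\<lambda>x. Re (a * A x) * Re (b * B x))" for A B
  proof -
    have e: "A x * cnj (B x) = of_real (Re (1 * A x) * Re (1 * B x)) + of_real (Re (- \<i> * A x) * Re (- \<i> * B x))
      + \<i> * (of_real (Re (- \<i> * A x) * Re (1 * B x)) - of_real (Re (1 * A x) * Re (- \<i> * B x)))" for x
      by (simp add: complex_eq_iff algebra_simps)
    note i = integrable_of_real[OF int]
    show ?thesis
      unfolding e E_def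
      by (subst Bochner_Integration.integral_add, intro Bochner_Integration.integrable_add i,
          intro integrable_mult_right Bochner_Integration.integrable_diff i,
          subst Bochner_Integration.integral_add, intro i, intro i,
          subst integral_mult_right_zero, subst Bochner_Integration.integral_diff, intro i, intro i)
         (simp only: integral_complex_of_real)
  qed
  have lim: "(\<lambda>N. E (S N t) (S N u)) \<longlonglongrightarrow> E (X t) (X u)"
    unfolding E_def by (intro tendsto_intros tendsto_of_real real_product(3) t u)
  have EX: "integral\<^sup>L M (\<lambda>x. X t x * cnj (X u x)) = E (X t) (X u)" by (intro E real_product(1) t u)
  have "E (S N t) (S N u) = (\<Sum>n\<in>{- int N..int N}. of_real (s n) * (f n t * cnj (f n u)))" for N
  proof -
    have "E (S N t) (S N u) = integral\<^sup>L M (\<lambda>x. S N t x * cnj (S N u x))" by (intro E[symmetric] real_product(2) t u)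
    also have "\<dots> = (\<Sum>n\<in>{- int N..int N}. of_real (s n) * (f n t * cnj (f n u)))"
      unfolding S_def by (rule covariance_sum(2)) simp
    finally show ?thesis .
  qed
  then show ?thesis unfolding EX using LIMSEQ_unique[OF lim] R_limit[OF t u] by simp
qed

end

section \<open>Construction of the process from the series\<close>

theorem theorem8p1:
  fixes M :: "'a measure" and H T :: real
    and \<omega> :: "int \<Rightarrow> real" and Z :: "int \<Rightarrow> 'a \<Rightarrow> complex"
  assumes "prob_space M"
    and "0 < H" and "H < 1" and "0 < T"
    and "strict_mono \<omega>" and "\<omega> 0 = 0"
    and "range \<omega> = {x :: real. bessel_J (of_real (1 - H)) (of_real x) = 0}"
    and "prob_space.indep_vars M (\<lambda>_. borel) Z UNIV"
    and "\<And>n. gaussian_complex M (Z n)"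
    and "\<And>n. integral\<^sup>L M (Z n) = 0"
    and "\<And>n. integral\<^sup>L M (\<lambda>w. (cmod (Z n w))\<^sup>2) = 1 / inv_sigma_sq H T (\<omega> n)"
  shows "\<exists>X. (AE w in M. uniform_limit {0..T}
                 (\<lambda>N t. \<Sum>n\<in>{- int N..int N}. fBm_coeff T (\<omega> n) t * Z n w)
                 (\<lambda>t. X t w) sequentially)
           \<and> complex_fBm M H {0..T} X"
proof -
  interpret prob_space M by fact
  interpret B: fBm_series H T \<omega> using assms by unfold_locales auto
  interpret Z: gaussian_sequence M Z "B.\<sigma>2" using assms by unfold_locales auto
  let ?f = "\<lambda>n t. fBm_coeff T (\<omega> n) t"
  obtain K where K: "K > 0" "\<And>k. real k \<le> K * \<omega> (int k) ^ 4" using B.\<omega>_growth by blast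
  interpret S: gaussian_trigonometric_series M Z "B.\<sigma>2" ?f T H
    "\<Sum>k. B.\<sigma>2 (int k) / (\<omega> (int k))\<^sup>2 * \<omega> (int k) powr H" K "\<lambda>k. \<omega> (int k)"
  proof
    show "T > 0" "0 < H" "H \<le> 1" "K > 0" using assms K by auto
    show "cmod (?f n t - ?f n u) \<le> \<bar>t - u\<bar>" for n t u
      using \<open>0 < T\<close> by (rule fBm_coeff_lipschitz)
    fix k :: nat assume k: "k \<ge> 1"
    show pos: "\<omega> (int k) > 0" using k by (intro B.\<omega>_pos) simp
    show "\<omega> (int k) \<le> \<omega> (int (Suc k))" using assms(5) by (simp add: strict_mono_less_eq)
    show "cmod (?f (int k) t) \<le> T / \<omega> (int k) \<and> cmod (?f (- int k) t) \<le> T / \<omega> (int k)" for t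
      using fBm_coeff_bound[OF \<open>0 < T\<close>, of "\<omega> (int k)" t] pos
      by (simp add: B.\<omega>_uminus fBm_coeff_uminus)
  next
    show "real k \<le> K * \<omega> (int k) ^ 4" for k by (rule K)
    show "B.\<sigma>2 (- n) = B.\<sigma>2 n" for n by (rule B.\<sigma>2_uminus)
    show "(\<Sum>k=1..N. B.\<sigma>2 (int k) / (\<omega> (int k))\<^sup>2 * \<omega> (int k) powr H)
      \<le> (\<Sum>k. B.\<sigma>2 (int k) / (\<omega> (int k))\<^sup>2 * \<omega> (int k) powr H)" for N
      using B.\<sigma>2_nonneg by (intro sum_le_suminf B.summable_\<sigma>2) auto
  qed
  let ?S = "\<lambda>w N t. \<Sum>n\<in>{- int N..int N}. ?f n t * Z n w"
  have "AE w in M. \<exists>l. uniform_limit {0..T} (?S w) l sequentially"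
    using S.uniform_convergence_tail
  proof eventually_elim
    case (elim w)
    then obtain l where "uniform_limit {0..T} (\<lambda>N t. \<Sum>k=1..N. ?f (int k) t * Z (int k) w + ?f (- int k) t * Z (- int k) w) l sequentially"
      by blast
    from uniform_limit_add[OF uniform_limit_const this, of "\<lambda>t. ?f 0 t * Z 0 w"]
    show ?case unfolding sum_int_symmetric by blast
  qed
  \<comment> \<open>The set where uniform convergence fails is enclosed in a measurable null
    set.\<close>
  then obtain N where N: "{w \<in> space M. \<not> (\<exists>l. uniform_limit {0..T} (?S w) l sequentially)} \<subseteq> N" "N \<in> null_sets M"
    by (auto elim!: AE_E simp: null_sets_def)
  \<comment> \<open>Paths are set to 0 on \<open>N\<close>. Then every path is continuous, as
    \<open>complex_fBm\<close> demands, and \<open>X t\<close> is a limit at every point of the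
    space, hence measurable.\<close>
  define X where "X t w = lim (\<lambda>n. if w \<in> N then 0 else ?S w n t)" for t w
  have unif: "uniform_limit {0..T} (?S w) (\<lambda>t. X t w) sequentially" if w: "w \<in> space M" "w \<notin> N" for w
  proof -
    obtain l where l: "uniform_limit {0..T} (?S w) l sequentially" using N(1) w by blast
    have Xl: "X t w = l t" if "t \<in> {0..T}" for t
      unfolding X_def using w tendsto_uniform_limitI[OF l that] by (auto intro: limI)
    show ?thesis by (rule uniform_limit_cong'[THEN iffD2, OF refl Xl l])
  qed
  have lim: "(\<lambda>n. if w \<in> N then 0 else ?S w n t) \<longlonglongrightarrow> X t w" if "w \<in> space M" "t \<in> {0..T}" for w t
  proof (cases "w \<in> N")
    case True then show ?thesis by (simp add: X_def)
  next
    case False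
    then show ?thesis using tendsto_uniform_limitI[OF unif[OF that(1) False] that(2)] by simp
  qed
  have AE_N: "AE w in M. w \<notin> N" using N(2) by (rule AE_not_in)
  have AE_unif: "AE w in M. uniform_limit {0..T} (?S w) (\<lambda>t. X t w) sequentially"
    using AE_N AE_space by eventually_elim (rule unif)
  interpret L: gaussian_series_limit M Z "B.\<sigma>2" ?f "{0..T}" X
    "\<lambda>t u. of_real ((t powr (2 * H) + u powr (2 * H) - \<bar>t - u\<bar> powr (2 * H)) / 2)"
  proof
    fix t assume t: "t \<in> {0..T}"
    have [measurable]: "N \<in> sets M" using N(2) by auto
    show "X t \<in> borel_measurable M"
      by (rule borel_measurable_LIMSEQ_metric[of "\<lambda>n w. if w \<in> N then 0 else ?S w n t"]) (measurable, rule lim[OF _ t])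
    show "AE w in M. (\<lambda>n. ?S w n t) \<longlonglongrightarrow> X t w"
      using AE_unif by eventually_elim (rule tendsto_uniform_limitI[OF _ t])
    fix u assume "u \<in> {0..T}"
    with t show "(\<lambda>n. \<Sum>k\<in>{- int n..int n}. of_real (B.\<sigma>2 k) * (?f k t * cnj (?f k u)))
        \<longlonglongrightarrow> of_real ((t powr (2 * H) + u powr (2 * H) - \<bar>t - u\<bar> powr (2 * H)) / 2)"
      by (rule B.covariance_limit)
  qed
  have "continuous_on {0..T} (\<lambda>t. X t w)" if w: "w \<in> space M" for w
  proof (cases "w \<in> N")
    case True then show ?thesis by (simp add: X_def)
  next
    case False
    have f_cont: "continuous_on {0..T} (?f n)" for n
    proof (rule continuous_onI)
      fix t e :: real assume "e > 0"
      then show "\<exists>d>0. \<forall>u\<in>{0..T}. dist u t < d \<longrightarrow> dist (?f n u) (?f n t) \<le> e"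
        using fBm_coeff_lipschitz[OF \<open>0 < T\<close>, of "\<omega> n" _ t]
        by (intro exI[of _ e]) (auto simp: dist_norm intro: order_trans less_imp_le)
    qed
    show ?thesis
      by (rule uniform_limit_theorem[OF _ unif[OF w False]]) (auto intro!: always_eventually continuous_intros f_cont)
  qed
  then have "complex_fBm M H {0..T} X"
    unfolding complex_fBm_def using L.gaussian_process L.mean_zero L.covariance by blast
  then show ?thesis using AE_unif by blast
qed

end
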